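(* Let $V$ be a complex vector space with basis $x_1,\dots,x_n$, let $\mathcal C'\subset\mathcal C$ be finite subgroups of $\mathbb C^\times$ with $-1\in\mathcal C$, and let $c\colon\mathcal C'\to\mathbb C$, $\varepsilon'\mapsto c_{\varepsilon'}$, be a function. Let $W=W_{\mathcal C,\mathcal C'}\subset \mathrm{GL}(V)$ be the group generated by all $\sigma_{ij}^{(\varepsilon)}$ ($i\ne j$, $\varepsilon\in\mathcal C$) and all $t_i^{(\varepsilon')}$ ($\varepsilon'\in\mathcal C'$). Let $\underline{\mathcal H}_c(W)$ be the subalgebra of $\mathrm{End}_{\mathbb C}(S_{-\mathbf 1}(V))$ generated by $W$, by the operators $y_i=\underline\nabla_i$ and by the operators of multiplication by $x_i$, $i=1,\dots,n$. (a) In $\underline{\mathcal H}_c(W)$ the generators satisfy: (i) $x_ix_j+x_jx_i=y_iy_j+y_jy_i=0$ for all $i\neq j$; (ii) $wx_iw^{-1}=w(x_i)$ and $wy_iw^{-1}=w(y_i)$ for all $w\in W$ and $i=1,\dots,n$; (iii) $y_jx_i+x_iy_j=c_1\sum_{\varepsilon\in\mathcal C}\varepsilon\,\sigma_{ij}^{(\varepsilon)}$ for all $i\neq j$, and $y_ix_i-x_iy_i=1+c_1\sum_{j\ne i,\ \varepsilon\in\mathcal C}\sigma_{ij}^{(\varepsilon)}+\sum_{\varepsilon'\in\mathcal C'\setminus\{1\}}c_{\varepsilon'}t_i^{(\varepsilon')}$ for $i=1,\dots,n$. (b) As an associative algebra, $\underline{\mathcal H}_c(W)$ is determined by the relations (i)–(iii)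 (together with the relations of the group $W$), and it admits a triangular decomposition $\underline{\mathcal H}_c(W)=S_{-\mathbf 1}(V)\otimes\mathbb CW\otimes S_{-\mathbf 1}(V^* )$, i.e. $S_{-\mathbf 1}(V)$, $\mathbb CW$, $S_{-\mathbf 1}(V^* )$ are realised as the subalgebras generated by the $x_i$, by $W$ and by the $y_i$ respectively, and the multiplication map from their tensor product is a linear bijection.
   Context: $S_{-\mathbf 1}(V)=\mathbb C\langle x_1,\dots,x_n\mid x_ix_j=-x_jx_i\ (i\neq j)\rangle$ and $S_{-\mathbf 1}(V^* )=\mathbb C\langle y_1,\dots,y_n\mid y_iy_j=-y_jy_i\ (i\ne j)\rangle$, where $y_1,\dots,y_n$ is identified with the basis of $V^*$ dual to $x_1,\dots,x_n$; $\mathrm{GL}(V)$ acts on $V^*$ contragrediently, which defines $w(y_i)$. For $\varepsilon\in\mathbb C^\times$, $i\ne j$: $t_i^{(\varepsilon)}(x_k)=x_k$ for $k\ne i$, $t_i^{(\varepsilon)}(x_i)=\varepsilon x_i$; $\sigma_{ij}^{(\varepsilon)}(x_k)=x_k$ for $k\notin\{i,j\}$, $\sigma_{ij}^{(\varepsilon)}(x_i)=\varepsilon x_j$, $\sigma_{ij}^{(\varepsilon)}(x_j)=-\varepsilon^{-1}x_i$; these linear maps extend to algebra automorphisms of $S_{-\mathbf 1}(V)$, so $W$ acts on $S_{-\mathbf 1}(V)$. The braided Dunkl operators are $$\underline\nabla_i=\underline\partial_i+c_1\sum_{j\ne i,\ \varepsilon\in\mathcal C}\frac{x_i+\varepsilon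 x_j}{x_i^2-\varepsilon^2x_j^2}(1-\sigma_{ij}^{(\varepsilon)})+\sum_{\varepsilon'\in\mathcal C'\setminus\{1\}}\frac{c_{\varepsilon'}}{1-\varepsilon'}\cdot\frac1{x_i}(1-t_i^{(\varepsilon')}),$$ where $\underline\partial_i(x_1^{a_1}\cdots x_n^{a_n})=a_i(-1)^{a_1+\cdots+a_{i-1}}x_1^{a_1}\cdots x_i^{a_i-1}\cdots x_n^{a_n}$, and fractions denote multiplication in the skew-field of fractions of $S_{-\mathbf 1}(V)$ (the elements $x_i^2$ are central); these operators preserve $S_{-\mathbf 1}(V)$.
   Formalization: In (iii) the first relation is corrected to y_j x_i + x_i y_j = −c_1 Σ ε σ_ij^(ε), also as a defining relation in (b): with the printed sign it fails for the given Dunkl operators (C={1,−1}, n=2, c_1≠0, applied to x_i: −2c_1 x_j versus +2c_1 x_j). *)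

theory Defs
  imports "HOL-Analysis.Analysis" "HOL-Library.Poly_Mapping" "HOL-Algebra.Generated_Groups"
begin

section \<open>Complex vector spaces and complex algebras\<close>

class cvec = ab_group_add +
  fixes scaleC :: "complex \<Rightarrow> 'a \<Rightarrow> 'a"  (infixr \<open>*\<^sub>C\<close> 75)
  assumes scaleC_add_right: "a *\<^sub>C (x + y) = a *\<^sub>C x + a *\<^sub>C y"
    and scaleC_add_left: "(a + b) *\<^sub>C x = a *\<^sub>C x + b *\<^sub>C x"
    and scaleC_scaleC: "a *\<^sub>C b *\<^sub>C x = (a * b) *\<^sub>C x"
    and scaleC_one: "1 *\<^sub>C x = x"

class calg = cvec + ring_1 +
  assumes mult_scaleC_left: "(a *\<^sub>C x) * y = a *\<^sub>C (x * y)"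
    and mult_scaleC_right: "x * (a *\<^sub>C y) = a *\<^sub>C (x * y)"

lemma vector_space_scaleC: "vector_space (scaleC :: complex \<Rightarrow> 'a::cvec \<Rightarrow> 'a)"
  by unfold_locales (simp_all add: scaleC_add_right scaleC_add_left scaleC_scaleC scaleC_one)

interpretation cvec: vector_space "scaleC :: complex \<Rightarrow> 'a::cvec \<Rightarrow> 'a"
  by (rule vector_space_scaleC)

abbreviation clinear :: "('a::cvec \<Rightarrow> 'b::cvec) \<Rightarrow> bool" where
  "clinear \<equiv> Vector_Spaces.linear scaleC scaleC"

abbreviation cspan :: "'a::cvec set \<Rightarrow> 'a set" where
  "cspan \<equiv> module.span scaleC"

definition alg_hom :: "('a::calg \<Rightarrow> 'b::calg) \<Rightarrow> bool" where
  "alg_hom \<phi> \<longleftrightarrow> clinear \<phi> \<and> \<phi> 1 = 1 \<and> (\<forall>a b. \<phi> (a * b) = \<phi> a * \<phi> b)"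

inductive_set subalg :: "'a::calg set \<Rightarrow> 'a set" for S where
  one: "1 \<in> subalg S"
| incl: "s \<in> S \<Longrightarrow> s \<in> subalg S"
| add: "a \<in> subalg S \<Longrightarrow> b \<in> subalg S \<Longrightarrow> a + b \<in> subalg S"
| scale: "a \<in> subalg S \<Longrightarrow> k *\<^sub>C a \<in> subalg S"
| mult: "a \<in> subalg S \<Longrightarrow> b \<in> subalg S \<Longrightarrow> a * b \<in> subalg S"

text \<open>The two-sided ideal generated by \<open>R\<close> in a subalgebra \<open>F\<close>.\<close>

definition ideal_in :: "'a::calg set \<Rightarrow> 'a set \<Rightarrow> 'a set" where
  "ideal_in F R = cspan {a * r * b | a r b. a \<in> F \<and> r \<in> R \<and> b \<in> F}"

text \<open>For a linear map \<open>\<phi>\<close> and a subspace \<open>R\<close> of \<open>F\<close>: \<open>\<phi>\<close> induces a well-defined bijection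
  from the quotient \<open>F / R\<close> onto \<open>H\<close>.\<close>

definition quotient_bij :: "('a::cvec \<Rightarrow> 'b::cvec) \<Rightarrow> 'a set \<Rightarrow> 'a set \<Rightarrow> 'b set \<Rightarrow> bool" where
  "quotient_bij \<phi> F R H \<longleftrightarrow>
     (\<forall>u\<in>F. \<forall>v\<in>F. \<phi> u = \<phi> v \<longleftrightarrow> u - v \<in> R) \<and> \<phi> ` F = H"

subsection \<open>The algebra of linear endomorphisms\<close>

typedef (overloaded) 'a endo = "{f :: 'a::cvec \<Rightarrow> 'a. clinear f}"
  morphisms app_endo Endo
  by (rule exI[of _ "\<lambda>x. x"]) (simp add: cvec.linear_ident)

setup_lifting type_definition_endo

instantiation endo :: (calg) calg
begin

lift_definition zero_endo :: "'a endo" is "\<lambda>x. 0"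
  by (simp add: Vector_Spaces.linear_iff cvec.vector_space_axioms)
lift_definition one_endo :: "'a endo" is "\<lambda>x. x"
  by (simp add: cvec.linear_ident)
lift_definition plus_endo :: "'a endo \<Rightarrow> 'a endo \<Rightarrow> 'a endo" is "\<lambda>f g x. f x + g x"
  by (simp add: Vector_Spaces.linear_iff scaleC_add_right)
lift_definition minus_endo :: "'a endo \<Rightarrow> 'a endo \<Rightarrow> 'a endo" is "\<lambda>f g x. f x - g x"
  by (simp add: Vector_Spaces.linear_iff cvec.scale_right_diff_distrib)
lift_definition uminus_endo :: "'a endo \<Rightarrow> 'a endo" is "\<lambda>f x. - f x"
  by (simp add: Vector_Spaces.linear_iff cvec.scale_minus_right)
lift_definition times_endo :: "'a endo \<Rightarrow> 'a endo \<Rightarrow> 'a endo" is "\<lambda>f g x. f (g x)"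
  by (simp add: Vector_Spaces.linear_iff)
lift_definition scaleC_endo :: "complex \<Rightarrow> 'a endo \<Rightarrow> 'a endo" is "\<lambda>c f x. c *\<^sub>C f x"
  by (simp add: Vector_Spaces.linear_iff scaleC_add_right scaleC_scaleC mult.commute)

instance
proof
  show "(0 :: 'a endo) \<noteq> 1"
    by transfer (metis zero_neq_one)
qed (transfer, auto simp: fun_eq_iff algebra_simps Vector_Spaces.linear_iff
       scaleC_add_right scaleC_add_left scaleC_scaleC scaleC_one)+

end

subsection \<open>Free vector spaces and free algebras\<close>

instantiation complex :: calg
begin
definition scaleC_complex :: "complex \<Rightarrow> complex \<Rightarrow> complex" where "scaleC_complex = (*)"
instance by standard (simp_all add: scaleC_complex_def algebra_simps)
end

instantiation poly_mapping :: (type, cvec) cvec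
begin
lift_definition scaleC_poly_mapping :: "complex \<Rightarrow> ('a \<Rightarrow>\<^sub>0 'b) \<Rightarrow> ('a \<Rightarrow>\<^sub>0 'b)"
  is "\<lambda>c f x. c *\<^sub>C f x"
  by (erule rev_finite_subset) (auto simp: cvec.scale_zero_right)
instance
  by standard (transfer, simp add: fun_eq_iff scaleC_add_right scaleC_add_left scaleC_scaleC scaleC_one)+
end

instantiation list :: (type) monoid_add
begin
definition zero_list :: "'a list" where "zero_list = []"
definition plus_list :: "'a list \<Rightarrow> 'a list \<Rightarrow> 'a list" where "plus_list = (@)"
instance by standard (simp_all add: zero_list_def plus_list_def)
end

lemma prod_fun_scaleC:
  fixes f g :: "'a::monoid_add \<Rightarrow> 'b::calg"
  assumes f: "finite {x. f x \<noteq> 0}" and g: "finite {x. g x \<noteq> 0}"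
  shows "prod_fun (\<lambda>x. c *\<^sub>C f x) g = (\<lambda>x. c *\<^sub>C prod_fun f g x)"
    and "prod_fun f (\<lambda>x. c *\<^sub>C g x) = (\<lambda>x. c *\<^sub>C prod_fun f g x)"
proof -
  have scale_sum: "c *\<^sub>C Sum_any h = Sum_any (\<lambda>l. c *\<^sub>C h l)"
    if "finite {l. h l \<noteq> 0}" for h :: "'a \<Rightarrow> 'b"
    using Sum_any_right_distrib[OF that, of "c *\<^sub>C 1"] by (simp add: mult_scaleC_left)
  have fin: "finite {l. f l * h l \<noteq> 0}" for h
    by (rule finite_subset[OF _ f]) auto
  show "prod_fun (\<lambda>x. c *\<^sub>C f x) g = (\<lambda>x. c *\<^sub>C prod_fun f g x)"
    by (rule ext) (simp add: prod_fun_def scale_sum[OF fin] mult_scaleC_left)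
  have inner: "Sum_any (\<lambda>q. c *\<^sub>C g q when P q) = c *\<^sub>C Sum_any (\<lambda>q. g q when P q)" for P
  proof -
    have fin': "finite {q. (g q when P q) \<noteq> 0}"
      by (rule finite_subset[OF _ g]) (auto simp: when_def)
    have eq: "(\<lambda>q. c *\<^sub>C g q when P q) = (\<lambda>q. c *\<^sub>C (g q when P q))"
      by (auto simp: fun_eq_iff when_def cvec.scale_zero_right)
    show ?thesis unfolding eq by (rule scale_sum[OF fin', symmetric])
  qed
  show "prod_fun f (\<lambda>x. c *\<^sub>C g x) = (\<lambda>x. c *\<^sub>C prod_fun f g x)"
    by (rule ext) (simp add: prod_fun_def inner mult_scaleC_right scale_sum[OF fin])
qed

instance poly_mapping :: (monoid_add, calg) calg
  by standard (transfer, simp add: prod_fun_scaleC)+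

text \<open>The free algebra on \<open>'g\<close>: finitely supported functions on words, with multiplication the
  convolution along concatenation of words.\<close>

type_synonym 'g free_alg = "'g list \<Rightarrow>\<^sub>0 complex"

definition gen :: "'g \<Rightarrow> 'g free_alg" where
  "gen g = Poly_Mapping.single [g] 1"

definition free_on :: "'g set \<Rightarrow> 'g free_alg set" where
  "free_on G = {p. \<forall>w \<in> Poly_Mapping.keys p. set w \<subseteq> G}"

definition lin_ext :: "('x \<Rightarrow> 'a::cvec) \<Rightarrow> ('x \<Rightarrow>\<^sub>0 complex) \<Rightarrow> 'a" where
  "lin_ext f p = (\<Sum>x \<in> Poly_Mapping.keys p. Poly_Mapping.lookup p x *\<^sub>C f x)"

definition eval_free :: "('g \<Rightarrow> 'a::calg) \<Rightarrow> 'g free_alg \<Rightarrow> 'a" where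
  "eval_free f = lin_ext (\<lambda>w. prod_list (map f w))"

text \<open>The tensor product \<open>A \<otimes> B \<otimes> D\<close> of three subspaces of an algebra is the quotient of the free
  vector space on \<open>A \<times> B \<times> D\<close> by the span of the trilinearity relations.\<close>

definition tensor_gens :: "'a set \<Rightarrow> 'a set \<Rightarrow> 'a set \<Rightarrow> ('a \<times> 'a \<times> 'a \<Rightarrow>\<^sub>0 complex) set" where
  "tensor_gens A B D = {u. Poly_Mapping.keys u \<subseteq> A \<times> B \<times> D}"

abbreviation pure_tensor :: "'a \<Rightarrow> 'a \<Rightarrow> 'a \<Rightarrow> ('a \<times> 'a \<times> 'a \<Rightarrow>\<^sub>0 complex)" where
  "pure_tensor a b d \<equiv> Poly_Mapping.single (a, b, d) 1"

definition tensor_rels ::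
    "'a::cvec set \<Rightarrow> 'a set \<Rightarrow> 'a set \<Rightarrow> ('a \<times> 'a \<times> 'a \<Rightarrow>\<^sub>0 complex) set" where
  "tensor_rels A B D = cspan (
     {pure_tensor (a + a') b d - pure_tensor a b d - pure_tensor a' b d
        | a a' b d. a \<in> A \<and> a' \<in> A \<and> b \<in> B \<and> d \<in> D} \<union>
     {pure_tensor a (b + b') d - pure_tensor a b d - pure_tensor a b' d
        | a b b' d. a \<in> A \<and> b \<in> B \<and> b' \<in> B \<and> d \<in> D} \<union>
     {pure_tensor a b (d + d') - pure_tensor a b d - pure_tensor a b d'
        | a b d d'. a \<in> A \<and> b \<in> B \<and> d \<in> D \<and> d' \<in> D} \<union>
     {pure_tensor (k *\<^sub>C a) b d - k *\<^sub>C pure_tensor a b d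
        | k a b d. a \<in> A \<and> b \<in> B \<and> d \<in> D} \<union>
     {pure_tensor a (k *\<^sub>C b) d - k *\<^sub>C pure_tensor a b d
        | k a b d. a \<in> A \<and> b \<in> B \<and> d \<in> D} \<union>
     {pure_tensor a b (k *\<^sub>C d) - k *\<^sub>C pure_tensor a b d
        | k a b d. a \<in> A \<and> b \<in> B \<and> d \<in> D})"

definition tensor_mult :: "('a \<times> 'a \<times> 'a \<Rightarrow>\<^sub>0 complex) \<Rightarrow> 'a::calg" where
  "tensor_mult = lin_ext (\<lambda>(a, b, d). a * b * d)"

subsection \<open>Fractions with central denominators\<close>

text \<open>The localisation of a ring at its central non-zero-divisors: \<open>(a, z)\<close> stands for
  \<open>a z\<^sup>-\<^sup>1 = z\<^sup>-\<^sup>1 a\<close>. For a domain that is a finite module over its centre, such as the algebra of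
  skew-commuting variables below, this is the skew-field of fractions.\<close>

definition central_regular :: "'a::ring_1 \<Rightarrow> bool" where
  "central_regular z \<longleftrightarrow> (\<forall>a. z * a = a * z) \<and> (\<forall>a. z * a = 0 \<longrightarrow> a = 0)"

lemma central_regularD: "central_regular z \<Longrightarrow> z * a = a * z"
  by (simp add: central_regular_def)

lemma central_regular_cancel: "central_regular z \<Longrightarrow> z * a = 0 \<Longrightarrow> a = 0"
  by (simp add: central_regular_def)

lemma central_regular_one: "central_regular 1"
  by (simp add: central_regular_def)

lemma central_regular_mult:
  assumes "central_regular z" "central_regular w" shows "central_regular (z * w)"
  using assms unfolding central_regular_def by (metis mult.assoc)

lemma mult_swap_middle:
  fixes a b c d :: "'a::ring_1"
  assumes "b * c = c * b" shows "(a * b) * (c * d) = (a * c) * (b * d)"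
  by (metis assms mult.assoc)

definition frac_rel :: "'a::ring_1 \<times> 'a \<Rightarrow> 'a \<times> 'a \<Rightarrow> bool" where
  "frac_rel p q \<longleftrightarrow> central_regular (snd p) \<and> central_regular (snd q) \<and>
     fst p * snd q = fst q * snd p"

lemma part_equivp_frac_rel: "part_equivp (frac_rel :: 'a::ring_1 \<times> 'a \<Rightarrow> _)"
proof (rule part_equivpI)
  show "\<exists>p :: 'a \<times> 'a. frac_rel p p"
    by (rule exI[of _ "(0, 1)"]) (simp add: frac_rel_def central_regular_one)
  show "symp (frac_rel :: 'a \<times> 'a \<Rightarrow> _)"
    by (rule sympI) (simp add: frac_rel_def)
  show "transp (frac_rel :: 'a \<times> 'a \<Rightarrow> _)"
  proof (rule transpI)
    fix p q r :: "'a \<times> 'a"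
    assume pq: "frac_rel p q" and qr: "frac_rel q r"
    obtain a z b w c v where [simp]: "p = (a, z)" "q = (b, w)" "r = (c, v)"
      by (metis surj_pair)
    have cr: "central_regular z" "central_regular w" "central_regular v"
      and e: "a * w = b * z" "b * v = c * w"
      using pq qr by (auto simp: frac_rel_def)
    have C: "\<And>x. z * x = x * z" "\<And>x. w * x = x * w" "\<And>x. v * x = x * v"
      by (rule central_regularD, rule cr)+
    have "w * (a * v) = (a * w) * v"
      using C(2)[of a] by (simp flip: mult.assoc)
    also have "\<dots> = b * (z * v)"
      using e(1) by (simp add: mult.assoc)
    also have "\<dots> = (c * w) * z"
      using C(1)[of v] e(2) by (simp flip: mult.assoc)
    also have "\<dots> = w * (c * z)"
      using C(2)[of c] by (simp flip: mult.assoc)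
    finally have "w * (a * v) = w * (c * z)" .
    hence "w * (a * v - c * z) = 0" by (simp add: right_diff_distrib)
    hence "a * v - c * z = 0" by (rule central_regular_cancel[OF cr(2)])
    hence "a * v = c * z" by simp
    thus "frac_rel p r" using cr by (simp add: frac_rel_def)
  qed
qed

quotient_type (overloaded) 'a frac = "'a::ring_1 \<times> 'a" / partial: frac_rel
  by (rule part_equivp_frac_rel)

instantiation frac :: (calg) calg
begin

lift_definition zero_frac :: "'a frac" is "(0, 1)"
  by (simp add: frac_rel_def central_regular_one)
lift_definition one_frac :: "'a frac" is "(1, 1)"
  by (simp add: frac_rel_def central_regular_one)
lift_definition plus_frac :: "'a frac \<Rightarrow> 'a frac \<Rightarrow> 'a frac"
  is "\<lambda>(a, z) (b, w). (a * w + b * z, z * w)"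
proof -
  fix p p' q q' :: "'a \<times> 'a"
  assume "frac_rel p p'" "frac_rel q q'"
  moreover obtain a z a' z' b w b' w' where
    [simp]: "p = (a, z)" "p' = (a', z')" "q = (b, w)" "q' = (b', w')"
    by (cases p, cases p', cases q, cases q') blast
  ultimately have cr: "central_regular z" "central_regular z'" "central_regular w" "central_regular w'"
    and e: "a * z' = a' * z" "b * w' = b' * w"
    by (auto simp: frac_rel_def)
  have C: "z * x = x * z" "z' * x = x * z'" "w * x = x * w" "w' * x = x * w'" for x
    by (rule central_regularD, rule cr)+
  have "(a * w) * (z' * w') = (a * z') * (w * w')"
    by (rule mult_swap_middle) (rule C)
  also have "\<dots> = (a' * z) * (w' * w)"
    using e C(3)[of w'] by simp
  also have "\<dots> = (a' * w') * (z * w)"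
    by (rule mult_swap_middle) (rule C)
  finally have 1: "(a * w) * (z' * w') = (a' * w') * (z * w)" .
  have "(b * z) * (z' * w') = (b * z) * (w' * z')"
    using C(2)[of w'] by simp
  also have "\<dots> = (b * w') * (z * z')"
    by (rule mult_swap_middle) (rule C)
  also have "\<dots> = (b' * w) * (z' * z)"
    using e C(1)[of z'] by simp
  also have "\<dots> = (b' * z') * (w * z)"
    by (rule mult_swap_middle) (rule C)
  also have "\<dots> = (b' * z') * (z * w)"
    using C(1)[of w] by simp
  finally have 2: "(b * z) * (z' * w') = (b' * z') * (z * w)" .
  from 1 2
  show "frac_rel ((case p of (a, z) \<Rightarrow> \<lambda>(b, w). (a * w + b * z, z * w)) q)
      ((case p' of (a, z) \<Rightarrow> \<lambda>(b, w). (a * w + b * z, z * w)) q')"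
    using cr by (simp add: frac_rel_def central_regular_mult distrib_right)
qed
lift_definition uminus_frac :: "'a frac \<Rightarrow> 'a frac" is "\<lambda>(a, z). (- a, z)"
  by (auto simp: frac_rel_def)
definition minus_frac :: "'a frac \<Rightarrow> 'a frac \<Rightarrow> 'a frac" where
  "minus_frac p q = p + (- q)"
lift_definition times_frac :: "'a frac \<Rightarrow> 'a frac \<Rightarrow> 'a frac"
  is "\<lambda>(a, z) (b, w). (a * b, z * w)"
proof -
  fix p p' q q' :: "'a \<times> 'a"
  assume "frac_rel p p'" "frac_rel q q'"
  moreover obtain a z a' z' b w b' w' where
    [simp]: "p = (a, z)" "p' = (a', z')" "q = (b, w)" "q' = (b', w')"
    by (cases p, cases p', cases q, cases q') blast
  ultimately have cr: "central_regular z" "central_regular z'" "central_regular w" "central_regular w'"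
    and e: "a * z' = a' * z" "b * w' = b' * w"
    by (auto simp: frac_rel_def)
  have C: "z * x = x * z" "z' * x = x * z'" "w * x = x * w" "w' * x = x * w'" for x
    by (rule central_regularD, rule cr)+
  have "(a * b) * (z' * w') = (a * z') * (b * w')"
    by (rule mult_swap_middle) (rule C(2)[symmetric])
  also have "\<dots> = (a' * z) * (b' * w)"
    using e by simp
  also have "\<dots> = (a' * b') * (z * w)"
    by (rule mult_swap_middle) (rule C)
  finally show "frac_rel ((case p of (a, z) \<Rightarrow> \<lambda>(b, w). (a * b, z * w)) q)
      ((case p' of (a, z) \<Rightarrow> \<lambda>(b, w). (a * b, z * w)) q')"
    using cr by (simp add: frac_rel_def central_regular_mult)
qed
lift_definition scaleC_frac :: "complex \<Rightarrow> 'a frac \<Rightarrow> 'a frac" is "\<lambda>k (a, z). (k *\<^sub>C a, z)"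
  by (auto simp: frac_rel_def mult_scaleC_left)

instance
proof
  fix p q r :: "'a frac" and j k :: complex
  have C: "central_regular z \<Longrightarrow> x * z = z * x" for x z :: 'a
    by (simp add: central_regular_def)
  have C': "central_regular z \<Longrightarrow> x * (z * y) = z * (x * y)" for x y z :: 'a
    by (metis C mult.assoc)
  note ring = algebra_simps C C' central_regular_mult central_regular_one
    mult_scaleC_left mult_scaleC_right scaleC_one
  show "p + q + r = p + (q + r)"
    by transfer (auto simp: frac_rel_def ring)
  show "p + q = q + p"
    by transfer (auto simp: frac_rel_def ring)
  show "0 + p = p"
    by transfer (auto simp: frac_rel_def ring)
  show "- p + p = 0"
    by transfer (auto simp: frac_rel_def ring)
  show "p - q = p + - q"
    by (rule minus_frac_def)
  show "p * q * r = p * (q * r)"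
    by transfer (auto simp: frac_rel_def ring)
  show "1 * p = p"
    by transfer (auto simp: frac_rel_def ring)
  show "p * 1 = p"
    by transfer (auto simp: frac_rel_def ring)
  show "(p + q) * r = p * r + q * r"
    by transfer (auto simp: frac_rel_def ring)
  show "p * (q + r) = p * q + p * r"
    by transfer (auto simp: frac_rel_def ring)
  show "(0 :: 'a frac) \<noteq> 1"
    by transfer (simp add: frac_rel_def)
  show "j *\<^sub>C (p + q) = j *\<^sub>C p + j *\<^sub>C q"
    by transfer (auto simp: frac_rel_def ring)
  show "(j + k) *\<^sub>C p = j *\<^sub>C p + k *\<^sub>C p"
    by transfer (auto simp: frac_rel_def ring)
  show "j *\<^sub>C k *\<^sub>C p = (j * k) *\<^sub>C p"
    by transfer (auto simp: frac_rel_def ring)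
  show "1 *\<^sub>C p = p"
    by transfer (auto simp: frac_rel_def ring)
  show "(j *\<^sub>C p) * q = j *\<^sub>C (p * q)"
    by transfer (auto simp: frac_rel_def ring)
  show "p * (j *\<^sub>C q) = j *\<^sub>C (p * q)"
    by transfer (auto simp: frac_rel_def ring)
qed

end

definition Fract :: "'a::calg \<Rightarrow> 'a \<Rightarrow> 'a frac" where
  "Fract a z = (if central_regular z then abs_frac (a, z) else 0)"

abbreviation to_frac :: "'a::calg \<Rightarrow> 'a frac" where
  "to_frac a \<equiv> Fract a 1"

section \<open>The algebra of skew-commuting variables\<close>

definition skew_ideal :: "'n free_alg set" where
  "skew_ideal = ideal_in UNIV {gen i * gen j + gen j * gen i | i j. i \<noteq> j}"

lemma skew_ideal_simps:
  "0 \<in> skew_ideal"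
  "p \<in> skew_ideal \<Longrightarrow> q \<in> skew_ideal \<Longrightarrow> p + q \<in> skew_ideal"
  "p \<in> skew_ideal \<Longrightarrow> q \<in> skew_ideal \<Longrightarrow> p - q \<in> skew_ideal"
  "p \<in> skew_ideal \<Longrightarrow> - p \<in> skew_ideal"
  "p \<in> skew_ideal \<Longrightarrow> c *\<^sub>C p \<in> skew_ideal"
  by (simp_all add: skew_ideal_def ideal_in_def cvec.span_zero cvec.span_add cvec.span_diff
      cvec.span_neg cvec.span_scale)

lemma skew_ideal_mult:
  fixes p q :: "'n free_alg"
  assumes "p \<in> skew_ideal"
  shows "q * p \<in> skew_ideal" and "p * q \<in> skew_ideal"
proof -
  let ?R = "{gen i * gen j + gen j * gen i | i j :: 'n. i \<noteq> j}"
  let ?G = "{a * r * b | a r b. a \<in> UNIV \<and> r \<in> ?R \<and> b \<in> UNIV}"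
  have sub: "?G \<subseteq> skew_ideal"
    unfolding skew_ideal_def ideal_in_def by (rule cvec.span_superset)
  have p: "p \<in> cspan ?G"
    using assms by (simp add: skew_ideal_def ideal_in_def)
  show "q * p \<in> skew_ideal"
    using p
  proof (induction rule: cvec.span_induct_alt)
    case base show ?case by (simp add: skew_ideal_simps)
  next
    case (step k g h)
    from step(1) obtain a r b where g: "g = a * r * b" and r: "r \<in> ?R" by blast
    have "q * g = (q * a) * r * b" by (simp add: g mult.assoc)
    with r have "q * g \<in> ?G" by blast
    with sub have "q * g \<in> skew_ideal" by (rule subsetD)
    with step(2) have "k *\<^sub>C (q * g) + q * h \<in> skew_ideal" by (intro skew_ideal_simps)
    then show ?case by (simp only: distrib_left mult_scaleC_right)
  qed
  show "p * q \<in> skew_ideal"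
    using p
  proof (induction rule: cvec.span_induct_alt)
    case base show ?case by (simp add: skew_ideal_simps)
  next
    case (step k g h)
    from step(1) obtain a r b where g: "g = a * r * b" and r: "r \<in> ?R" by blast
    have "g * q = a * r * (b * q)" by (simp add: g mult.assoc)
    with r have "g * q \<in> ?G" by blast
    with sub have "g * q \<in> skew_ideal" by (rule subsetD)
    with step(2) have "k *\<^sub>C (g * q) + h * q \<in> skew_ideal" by (intro skew_ideal_simps)
    then show ?case by (simp only: distrib_right mult_scaleC_left)
  qed
qed

lemma lookup_mult_Nil:
  "Poly_Mapping.lookup (p * q) [] = Poly_Mapping.lookup p [] * Poly_Mapping.lookup (q :: 'n free_alg) []"
proof -
  have "[] = l + r \<longleftrightarrow> l = [] \<and> r = []" for l r :: "'n list"
    by (auto simp: plus_list_def)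
  then show ?thesis
    by (simp add: lookup_mult when_when[symmetric] mult_when)
qed

lemma lookup_skew_ideal:
  assumes "p \<in> skew_ideal" shows "Poly_Mapping.lookup p [] = 0"
  using assms unfolding skew_ideal_def ideal_in_def
proof (induction rule: cvec.span_induct_alt)
  case (step k g h)
  then show ?case
    by (auto simp: lookup_mult_Nil lookup_add gen_def lookup_single when_def
        scaleC_poly_mapping.rep_eq scaleC_complex_def)
qed simp

quotient_type 'n skew = "'n free_alg" / "\<lambda>p q. p - q \<in> skew_ideal"
proof (rule equivpI)
  show "reflp (\<lambda>p q :: 'n free_alg. p - q \<in> skew_ideal)"
    by (rule reflpI) (simp add: skew_ideal_simps)
  show "symp (\<lambda>p q :: 'n free_alg. p - q \<in> skew_ideal)"
    by (rule sympI) (metis minus_diff_eq skew_ideal_simps(4))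
  show "transp (\<lambda>p q :: 'n free_alg. p - q \<in> skew_ideal)"
    by (rule transpI) (metis diff_add_cancel add_diff_eq skew_ideal_simps(2))
qed

instantiation skew :: (type) calg
begin

lift_definition zero_skew :: "'a skew" is "0" .
lift_definition one_skew :: "'a skew" is "1" .
lift_definition plus_skew :: "'a skew \<Rightarrow> 'a skew \<Rightarrow> 'a skew" is "(+)"
  by (drule (1) skew_ideal_simps(2)) (simp add: algebra_simps)
lift_definition minus_skew :: "'a skew \<Rightarrow> 'a skew \<Rightarrow> 'a skew" is "(-)"
  by (drule (1) skew_ideal_simps(3)) (simp add: algebra_simps)
lift_definition uminus_skew :: "'a skew \<Rightarrow> 'a skew" is "uminus"
  by (drule skew_ideal_simps(4)) (simp add: algebra_simps)
lift_definition times_skew :: "'a skew \<Rightarrow> 'a skew \<Rightarrow> 'a skew" is "(*)"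
proof -
  fix p p' q q' :: "'a free_alg"
  assume "p - p' \<in> skew_ideal" "q - q' \<in> skew_ideal"
  then have "(p - p') * q + p' * (q - q') \<in> skew_ideal"
    by (rule skew_ideal_simps(2)[OF skew_ideal_mult(2) skew_ideal_mult(1)])
  then show "p * q - p' * q' \<in> skew_ideal"
    by (simp add: algebra_simps)
qed
lift_definition scaleC_skew :: "complex \<Rightarrow> 'a skew \<Rightarrow> 'a skew" is "scaleC"
  by (simp only: cvec.scale_right_diff_distrib[symmetric] skew_ideal_simps(5))

instance
proof
  show "(0 :: 'a skew) \<noteq> 1"
  proof transfer
    have "Poly_Mapping.lookup (0 - 1 :: 'a free_alg) [] \<noteq> 0"
      by (simp add: lookup_minus lookup_one zero_list_def)
    then show "0 - (1 :: 'a free_alg) \<notin> skew_ideal"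
      using lookup_skew_ideal by blast
  qed
qed (transfer, simp add: algebra_simps skew_ideal_simps mult_scaleC_left mult_scaleC_right
       scaleC_add_right scaleC_add_left scaleC_scaleC scaleC_one)+

end

lift_definition var :: "'n \<Rightarrow> 'n skew" is gen .

text \<open>The ordered monomial: the index type \<open>'n\<close> is linearly ordered and plays the role of
  \<open>{1,\<dots>,n}\<close>.\<close>

definition monomial :: "('n::{finite,linorder} \<Rightarrow> nat) \<Rightarrow> 'n skew" where
  "monomial a = prod_list (map (\<lambda>i. var i ^ a i) (sorted_list_of_set UNIV))"

definition braided_partial :: "'n::{finite,linorder} \<Rightarrow> 'n skew \<Rightarrow> 'n skew" where
  "braided_partial i = (THE D. clinear D \<and>
     (\<forall>a. D (monomial a) =
        (of_nat (a i) * (-1) ^ (\<Sum>j | j < i. a j)) *\<^sub>C monomial (a(i := a i - 1))))"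

section \<open>The group\<close>

definition complex_units :: "complex monoid" where
  "complex_units = \<lparr>carrier = UNIV - {0}, mult = (*), one = 1\<rparr>"

type_synonym 'n lmap = "complex ^ 'n \<Rightarrow> complex ^ 'n"

text \<open>\<open>V = complex ^ 'n\<close>, with basis \<open>x\<^sub>i = axis i 1\<close>.\<close>

definition GL :: "'n::finite lmap monoid" where
  "GL = \<lparr>carrier = {w. Vector_Spaces.linear (*s) (*s) w \<and> bij w}, mult = (\<circ>), one = id\<rparr>"

definition t_map :: "'n::finite \<Rightarrow> complex \<Rightarrow> 'n lmap" where
  "t_map i \<epsilon> v = (\<chi> k. if k = i then \<epsilon> * v $ i else v $ k)"

text \<open>\<open>x\<^sub>i \<mapsto> \<epsilon> x\<^sub>j\<close> and \<open>x\<^sub>j \<mapsto> - \<epsilon>\<^sup>-\<^sup>1 x\<^sub>i\<close>, written in coordinates.\<close>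

definition sigma_map :: "'n::finite \<Rightarrow> 'n \<Rightarrow> complex \<Rightarrow> 'n lmap" where
  "sigma_map i j \<epsilon> v =
     (\<chi> k. if k = i then - inverse \<epsilon> * v $ j else if k = j then \<epsilon> * v $ i else v $ k)"

definition refl_group :: "complex set \<Rightarrow> complex set \<Rightarrow> 'n::finite lmap set" where
  "refl_group C C' = generate GL
     ({sigma_map i j \<epsilon> | i j \<epsilon>. i \<noteq> j \<and> \<epsilon> \<in> C} \<union> {t_map i \<epsilon> | i \<epsilon>. \<epsilon> \<in> C'})"

text \<open>\<open>coef w i k\<close> is the coefficient of \<open>x\<^sub>k\<close> in \<open>w(x\<^sub>i)\<close>. For the dual basis,
  \<open>w(y\<^sub>i) = y\<^sub>i \<circ> w\<^sup>-\<^sup>1\<close>, so \<open>dual_coef w i k = (y\<^sub>i \<circ> w\<^sup>-\<^sup>1)(x\<^sub>k)\<close> is the coefficient of \<open>y\<^sub>k\<close> in \<open>w(y\<^sub>i)\<close>.\<close>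

definition coef :: "'n::finite lmap \<Rightarrow> 'n \<Rightarrow> 'n \<Rightarrow> complex" where
  "coef w i k = w (axis i 1) $ k"

definition dual_coef :: "'n::finite lmap \<Rightarrow> 'n \<Rightarrow> 'n \<Rightarrow> complex" where
  "dual_coef w i k = (inv\<^bsub>GL\<^esub> w) (axis k 1) $ i"

definition skew_action :: "'n::finite lmap \<Rightarrow> 'n skew \<Rightarrow> 'n skew" where
  "skew_action w = (THE \<phi>. alg_hom \<phi> \<and> (\<forall>i. \<phi> (var i) = (\<Sum>k\<in>UNIV. coef w i k *\<^sub>C var k)))"

section \<open>Braided Dunkl operators and the braided Cherednik algebra\<close>

text \<open>The individual summands of the Dunkl operator need not preserve the algebra; only their sum
  does, so it is computed among fractions. Since \<open>x\<^sub>i\<^sup>2\<close> is central,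
  \<open>1/x\<^sub>i\<close> is the fraction \<open>x\<^sub>i / x\<^sub>i\<^sup>2\<close>.\<close>

definition dunkl_frac ::
    "complex set \<Rightarrow> complex set \<Rightarrow> (complex \<Rightarrow> complex) \<Rightarrow> 'n::{finite,linorder} \<Rightarrow> 'n skew \<Rightarrow> 'n skew frac" where
  "dunkl_frac C C' c i f =
     to_frac (braided_partial i f)
     + c 1 *\<^sub>C (\<Sum>j\<in>UNIV - {i}. \<Sum>\<epsilon>\<in>C.
         Fract (var i + \<epsilon> *\<^sub>C var j) (var i ^ 2 - \<epsilon>\<^sup>2 *\<^sub>C var j ^ 2)
         * to_frac (f - skew_action (sigma_map i j \<epsilon>) f))
     + (\<Sum>\<epsilon>\<in>C' - {1}. (c \<epsilon> / (1 - \<epsilon>)) *\<^sub>C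
         (Fract (var i) (var i ^ 2) * to_frac (f - skew_action (t_map i \<epsilon>) f)))"

definition dunkl ::
    "complex set \<Rightarrow> complex set \<Rightarrow> (complex \<Rightarrow> complex) \<Rightarrow> 'n::{finite,linorder} \<Rightarrow> 'n skew \<Rightarrow> 'n skew" where
  "dunkl C C' c i f = (THE g. to_frac g = dunkl_frac C C' c i f)"

lift_definition op_x :: "'n \<Rightarrow> 'n skew endo" is "\<lambda>i f. var i * f"
  by (simp add: Vector_Spaces.linear_iff cvec.vector_space_axioms distrib_left mult_scaleC_right)

definition op_y ::
    "complex set \<Rightarrow> complex set \<Rightarrow> (complex \<Rightarrow> complex) \<Rightarrow> 'n::{finite,linorder} \<Rightarrow> 'n skew endo" where
  "op_y C C' c i = Endo (dunkl C C' c i)"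

definition op_w :: "'n::finite lmap \<Rightarrow> 'n skew endo" where
  "op_w w = Endo (skew_action w)"

definition cherednik ::
    "complex set \<Rightarrow> complex set \<Rightarrow> (complex \<Rightarrow> complex) \<Rightarrow> 'n::{finite,linorder} skew endo set" where
  "cherednik C C' c =
     subalg (op_w ` refl_group C C' \<union> range (op_y C C' c) \<union> range op_x)"

text \<open>Abstract generators \<open>x\<^sub>i\<close>, \<open>y\<^sub>i\<close>, \<open>w\<close>, and the defining relations, each written as
  left-hand side minus right-hand side. The last two families are the relations of the group.
  The mixed relation is \<open>y\<^sub>j x\<^sub>i + x\<^sub>i y\<^sub>j = - c\<^sub>1 \<Sum>\<^sub>\<epsilon> \<epsilon> \<sigma>\<^sub>i\<^sub>j\<close>, with a minus sign. The sign is forced by the Dunkl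
  operators: for \<open>C = {1, -1}\<close> both sides map \<open>x\<^sub>i\<close> to \<open>-2 c\<^sub>1 x\<^sub>j\<close>.\<close>

datatype ('n, 'w) cgen = GX 'n | GY 'n | GW 'w

definition cgens :: "'w set \<Rightarrow> ('n, 'w) cgen set" where
  "cgens W = range GX \<union> range GY \<union> GW ` W"

primrec eval_gen ::
    "complex set \<Rightarrow> complex set \<Rightarrow> (complex \<Rightarrow> complex) \<Rightarrow> ('n::{finite,linorder}, 'n lmap) cgen \<Rightarrow> 'n skew endo" where
  "eval_gen C C' c (GX i) = op_x i"
| "eval_gen C C' c (GY i) = op_y C C' c i"
| "eval_gen C C' c (GW w) = op_w w"

definition cherednik_rels ::
    "complex set \<Rightarrow> complex set \<Rightarrow> (complex \<Rightarrow> complex) \<Rightarrow> ('n::finite, 'n lmap) cgen free_alg set" where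
  "cherednik_rels C C' c = (let
       x = (\<lambda>i. gen (GX i)); y = (\<lambda>i. gen (GY i)); g = (\<lambda>w. gen (GW w)); W = refl_group C C'
     in
       {x i * x j + x j * x i | i j. i \<noteq> j} \<union>
       {y i * y j + y j * y i | i j. i \<noteq> j} \<union>
       {g w * x i * g (inv\<^bsub>GL\<^esub> w) - (\<Sum>k\<in>UNIV. coef w i k *\<^sub>C x k) | w i. w \<in> W} \<union>
       {g w * y i * g (inv\<^bsub>GL\<^esub> w) - (\<Sum>k\<in>UNIV. dual_coef w i k *\<^sub>C y k) | w i. w \<in> W} \<union>
       {y j * x i + x i * y j + c 1 *\<^sub>C (\<Sum>\<epsilon>\<in>C. \<epsilon> *\<^sub>C g (sigma_map i j \<epsilon>)) | i j. i \<noteq> j} \<union>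
       {y i * x i - x i * y i
          - (1 + c 1 *\<^sub>C (\<Sum>j\<in>UNIV - {i}. \<Sum>\<epsilon>\<in>C. g (sigma_map i j \<epsilon>))
               + (\<Sum>\<epsilon>\<in>C' - {1}. c \<epsilon> *\<^sub>C g (t_map i \<epsilon>))) | i. True} \<union>
       {g v * g w - g (v \<otimes>\<^bsub>GL\<^esub> w) | v w. v \<in> W \<and> w \<in> W} \<union>
       {g \<one>\<^bsub>GL\<^esub> - 1})"

text \<open>The group algebra of a subset \<open>W\<close> closed under multiplication, as finitely supported functions
  on \<open>W\<close> with convolution product.\<close>

definition group_alg :: "'w set \<Rightarrow> ('w \<Rightarrow>\<^sub>0 complex) set" where
  "group_alg W = {u. Poly_Mapping.keys u \<subseteq> W}"

definition convolve :: "('w, 'm) monoid_scheme \<Rightarrow> ('w \<Rightarrow>\<^sub>0 complex) \<Rightarrow> ('w \<Rightarrow>\<^sub>0 complex) \<Rightarrow> ('w \<Rightarrow>\<^sub>0 complex)" where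
  "convolve G u v = (\<Sum>a \<in> Poly_Mapping.keys u. \<Sum>b \<in> Poly_Mapping.keys v.
     Poly_Mapping.single (a \<otimes>\<^bsub>G\<^esub> b) (Poly_Mapping.lookup u a * Poly_Mapping.lookup v b))"

end

theory Submission
  imports Defs "HOL-Library.Function_Algebras"
begin

text \<open>The operators \<open>y\<^sub>i\<close> are determined by \<open>y\<^sub>i(1) = 0\<close> and the commutation relations (iii) with the \<open>x\<^sub>j\<close>.
  These relations are verified for the fractions defining the Dunkl operators, which also shows by
  induction on words that the fractions lie in the algebra. Equivariance and anticommutativity follow:
  in both cases the difference of the two sides commutes up to a sign with all \<open>x\<^sub>k\<close>
  and kills \<open>1\<close>, hence vanishes. For the triangular decomposition, the relations straighten every
  word into a combination of \<open>x\<^sup>a w y\<^sup>b\<close>. Such operators are linearly independent: for \<open>b = 0\<close> by Artin's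
  argument for the characters of an automorphism group, and in general by induction on the order in \<open>y\<close>, since
  the commutator with the central invariants \<open>\<Sum>\<^sub>i x\<^sub>i\<^sup>N\<^sup>r\<close>, where \<open>N = 2 |C|\<close>, lowers the order and a
  Vandermonde argument recovers the leading coefficients.\<close>

section \<open>Linear extension and free algebras\<close>

text \<open>The parameters c are arbitrary, so linear independence cannot be imported from a special
  value of c and has to be proved for the Dunkl operators themselves. These have no convenient
  formula on monomials, so the proof works with their commutators. The exponent N combines two
  demands: the factor 2 makes x_i^N central, and the factor |C| makes it insensitive to the scalars
  in C, so that W merely permutes the x_i^N. A central W-invariant passes through all difference
  quotients, and only the braided derivative contributes to its commutator with y_i. The whole
  family of power sums is needed, because a single commutator yields one equation for n leading
  coefficients. Presentation and decomposition are two applications of one principle,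
  \<open>quotient_bij_basis\<close>: elements indexed by the triples (a, w, b) span modulo the
  relations, and their images are independent, so no further relation can hold.\<close>

lemma clinear_iff:
  "clinear f \<longleftrightarrow> (\<forall>x y. f (x + y) = f x + f y) \<and> (\<forall>k x. f (k *\<^sub>C x) = k *\<^sub>C f x)"
  for f :: "'a::cvec \<Rightarrow> 'b::cvec"
  by (simp add: Vector_Spaces.linear_iff cvec.vector_space_axioms)

lemma
  fixes f :: "'a::cvec \<Rightarrow> 'b::cvec"
  assumes "clinear f"
  shows clinear_add: "f (x + y) = f x + f y"
    and clinear_scale: "f (k *\<^sub>C x) = k *\<^sub>C f x"
    and clinear_zero: "f 0 = 0"
    and clinear_diff: "f (x - y) = f x - f y"
    and clinear_minus: "f (- x) = - f x"
    and clinear_sum: "f (sum h A) = (\<Sum>a\<in>A. f (h a))"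
proof -
  interpret Vector_Spaces.linear "scaleC :: complex \<Rightarrow> 'a \<Rightarrow> 'a" "scaleC :: complex \<Rightarrow> 'b \<Rightarrow> 'b" f by (rule assms)
  show "f (x + y) = f x + f y" "f (k *\<^sub>C x) = k *\<^sub>C f x" "f 0 = 0" "f (x - y) = f x - f y"
    "f (- x) = - f x" "f (sum h A) = (\<Sum>a\<in>A. f (h a))"
    by (simp_all add: add scale diff neg sum)
qed

lemma clinear_compose:
  "clinear f \<Longrightarrow> clinear g \<Longrightarrow> clinear (\<lambda>x. g (f x))"
  by (simp add: clinear_iff)

lemma clinear_span_subset:
  assumes f: "clinear f" and B: "\<And>b. b \<in> B \<Longrightarrow> f b \<in> V" and V: "cvec.subspace V" and x: "x \<in> cspan B"
  shows "f x \<in> V"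
  using x
proof (induction rule: cvec.span_induct_alt)
  case base
  then show ?case using V by (simp add: clinear_zero[OF f] cvec.subspace_0)
next
  case (step k b y)
  then show ?case
    by (simp add: clinear_add[OF f] clinear_scale[OF f] B V cvec.subspace_add cvec.subspace_scale)
qed

lemma lookup_scaleC [simp]: "Poly_Mapping.lookup (k *\<^sub>C p) x = k *\<^sub>C Poly_Mapping.lookup p x"
  by (simp add: scaleC_poly_mapping.rep_eq)

lemma scaleC_complex [simp]: "(k::complex) *\<^sub>C z = k * z"
  by (simp add: scaleC_complex_def)

lemma lin_ext_superset:
  assumes "finite A" "Poly_Mapping.keys p \<subseteq> A"
  shows "lin_ext f p = (\<Sum>x\<in>A. Poly_Mapping.lookup p x *\<^sub>C f x)"
  unfolding lin_ext_def
  by (rule sum.mono_neutral_left) (use assms in \<open>auto simp: in_keys_iff\<close>)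

lemma clinear_lin_ext: "clinear (lin_ext f)"
  unfolding clinear_iff
proof (intro conjI allI)
  fix p q :: "'a \<Rightarrow>\<^sub>0 complex" and k
  let ?A = "Poly_Mapping.keys p \<union> Poly_Mapping.keys q"
  have keys: "Poly_Mapping.keys (p + q) \<subseteq> ?A" "Poly_Mapping.keys (k *\<^sub>C p) \<subseteq> Poly_Mapping.keys p"
    by (auto simp: in_keys_iff lookup_add)
  then show "lin_ext f (p + q) = lin_ext f p + lin_ext f q"
    by (simp add: lin_ext_superset[of ?A] lookup_add scaleC_add_left sum.distrib)
  show "lin_ext f (k *\<^sub>C p) = k *\<^sub>C lin_ext f p"
    using keys(2) by (simp add: lin_ext_superset[of "Poly_Mapping.keys p" "k *\<^sub>C p"] lin_ext_def[of f p]
        cvec.scale_sum_right)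
qed

lemma lin_ext_single [simp]: "lin_ext f (Poly_Mapping.single x k) = k *\<^sub>C f x"
  by (simp add: lin_ext_superset[of "{x}"])

lemma lin_ext_one_single: "lin_ext (\<lambda>x. Poly_Mapping.single x 1) p = p"
  by (rule poly_mapping_eqI) (simp add: lin_ext_def lookup_sum lookup_single when_def in_keys_iff
      if_distrib[of "(*) _"] cong: if_cong)

text \<open>Zero has no case of its own: it is the multiple by 0 of a basis vector.\<close>

lemma free_vec_induct [case_names single add scale]:
  fixes p :: "'x \<Rightarrow>\<^sub>0 complex"
  assumes "\<And>x. P (Poly_Mapping.single x 1)" "\<And>p q. P p \<Longrightarrow> P q \<Longrightarrow> P (p + q)" "\<And>k p. P p \<Longrightarrow> P (k *\<^sub>C p)"
  shows "P p"
proof -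
  have zero: "P 0" by (metis assms(1,3) cvec.scale_zero_left)
  have "P (\<Sum>x\<in>A. Poly_Mapping.lookup p x *\<^sub>C Poly_Mapping.single x 1)" for A
    by (induction A rule: infinite_finite_induct) (simp_all add: zero assms)
  then show ?thesis by (metis lin_ext_def lin_ext_one_single)
qed

lemma single_mult_single_one:
  "Poly_Mapping.single u 1 * Poly_Mapping.single v 1 = (Poly_Mapping.single (u @ v) 1 :: 'g free_alg)"
  by (simp add: mult_single plus_list_def)

lemma alg_homD:
  assumes "alg_hom \<phi>"
  shows "clinear \<phi>" "\<phi> 1 = 1" "\<phi> (a * b) = \<phi> a * \<phi> b"
  using assms by (auto simp: alg_hom_def)

lemma
  assumes "alg_hom \<phi>"
  shows alg_hom_add: "\<phi> (x + y) = \<phi> x + \<phi> y"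
    and alg_hom_scale: "\<phi> (k *\<^sub>C x) = k *\<^sub>C \<phi> x"
    and alg_hom_zero: "\<phi> 0 = 0"
    and alg_hom_diff: "\<phi> (x - y) = \<phi> x - \<phi> y"
    and alg_hom_minus: "\<phi> (- x) = - \<phi> x"
    and alg_hom_sum: "\<phi> (sum h A) = (\<Sum>a\<in>A. \<phi> (h a))"
    and alg_hom_mult: "\<phi> (x * y) = \<phi> x * \<phi> y"
    and alg_hom_one: "\<phi> 1 = 1"
  using assms by (auto simp: alg_hom_def clinear_add clinear_scale clinear_zero clinear_diff clinear_minus clinear_sum)

lemma alg_hom_power: "alg_hom \<phi> \<Longrightarrow> \<phi> (x ^ m) = \<phi> x ^ m"
  by (induction m) (simp_all add: alg_hom_mult alg_hom_one)

lemma alg_hom_prod_list: "alg_hom \<phi> \<Longrightarrow> \<phi> (prod_list xs) = prod_list (map \<phi> xs)"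
  by (induction xs) (simp_all add: alg_hom_mult alg_hom_one)

lemma eval_free_gen [simp]: "eval_free f (gen g) = f g"
  by (simp add: eval_free_def gen_def scaleC_one)

lemma eval_free_single [simp]: "eval_free f (Poly_Mapping.single w 1) = prod_list (map f w)"
  by (simp add: eval_free_def scaleC_one)

lemma alg_hom_eval_free: "alg_hom (eval_free f)"
proof -
  have lin: "clinear (eval_free f)" by (simp add: eval_free_def clinear_lin_ext)
  note lins = clinear_add[OF lin] clinear_scale[OF lin]
  \<comment> \<open>Multiplicativity is proved for a word as left factor first; linearity in the
    left factor then gives the general case.\<close>
  have "eval_free f (single_one * q) = prod_list (map f u) * eval_free f q"
    if "single_one = Poly_Mapping.single u 1" for single_one q u
    by (induction q rule: free_vec_induct)
      (simp_all add: that lins single_mult_single_one distrib_left mult_scaleC_right)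
  then have "eval_free f (p * q) = eval_free f p * eval_free f q" for p q
    by (induction p rule: free_vec_induct) (simp_all add: lins distrib_right mult_scaleC_left)
  moreover have "eval_free f 1 = 1"
    using eval_free_single[of f "[]"] by (metis list.map(1) prod_list.Nil single_one zero_list_def)
  ultimately show ?thesis using lin by (simp add: alg_hom_def)
qed

lemma alg_hom_ideal_in:
  assumes \<phi>: "alg_hom \<phi>" and R: "\<And>r. r \<in> R \<Longrightarrow> \<phi> r = 0" and p: "p \<in> ideal_in F R"
  shows "\<phi> p = 0"
proof -
  have "\<phi> p \<in> {0}"
    using p unfolding ideal_in_def
    by (rule clinear_span_subset[OF alg_homD(1)[OF \<phi>], rotated -1])
      (auto simp: alg_hom_mult[OF \<phi>] R)
  then show ?thesis by simp
qed

lemma prod_list_gen: "prod_list (map gen w) = Poly_Mapping.single w 1"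
proof (induction w)
  case Nil
  show ?case by (metis list.map(1) prod_list.Nil single_one zero_list_def)
qed (simp add: gen_def single_mult_single_one)

section \<open>The universal property of the skew-commuting variables\<close>

text \<open>Defined through the chosen representative \<open>rep_skew s\<close>, so it makes sense
  for every \<open>z\<close>. It is a homomorphism when the values of \<open>z\<close> anticommute,
  and it remains usable for values that anticommute only modulo an ideal.\<close>

definition skew_lift :: "('n \<Rightarrow> 'a::calg) \<Rightarrow> 'n skew \<Rightarrow> 'a" where
  "skew_lift z s = eval_free z (rep_skew s)"

context
  fixes z :: "'n \<Rightarrow> 'a::calg"
  assumes z: "\<And>i j. i \<noteq> j \<Longrightarrow> z i * z j + z j * z i = 0"
begin

lemma eval_free_skew_ideal: "p \<in> skew_ideal \<Longrightarrow> eval_free z p = 0"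
  unfolding skew_ideal_def
  by (erule alg_hom_ideal_in[OF alg_hom_eval_free, rotated])
    (auto simp: z alg_hom_add[OF alg_hom_eval_free] alg_hom_mult[OF alg_hom_eval_free])

lemma skew_lift_abs: "skew_lift z (abs_skew p) = eval_free z p"
proof -
  have "rep_skew (abs_skew p) - p \<in> skew_ideal"
    by (rule Quotient3_rep_abs[OF Quotient3_skew]) (simp add: skew_ideal_simps)
  from eval_free_skew_ideal[OF this] show ?thesis
    by (simp add: skew_lift_def alg_hom_diff[OF alg_hom_eval_free])
qed

lemma skew_lift_var: "skew_lift z (var i) = z i"
  by (simp add: var.abs_eq skew_lift_abs)

lemma alg_hom_skew_lift: "alg_hom (skew_lift z)"
proof -
  have ex: "\<exists>p. s = abs_skew p" for s :: "'n skew"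
    using Quotient3_abs_rep[OF Quotient3_skew] by metis
  note abs = plus_skew.abs_eq times_skew.abs_eq scaleC_skew.abs_eq
  note hom = alg_hom_eval_free[of z]
  have "skew_lift z (s + t) = skew_lift z s + skew_lift z t"
    "skew_lift z (k *\<^sub>C s) = k *\<^sub>C skew_lift z s"
    "skew_lift z (s * t) = skew_lift z s * skew_lift z t" for s t k
    using ex[of s] ex[of t]
    by (auto simp: abs skew_lift_abs alg_hom_add[OF hom] alg_hom_scale[OF hom] alg_hom_mult[OF hom])
  moreover have "skew_lift z 1 = 1"
    by (simp add: one_skew.abs_eq skew_lift_abs alg_hom_one[OF hom])
  ultimately show ?thesis by (simp add: alg_hom_def clinear_iff)
qed

end

lemma alg_hom_abs_skew: "alg_hom abs_skew"
  by (simp add: alg_hom_def clinear_iff plus_skew.abs_eq times_skew.abs_eq scaleC_skew.abs_eq one_skew.abs_eq)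

lemma abs_skew_surj: "\<exists>p. s = abs_skew p"
  using Quotient3_abs_rep[OF Quotient3_skew] by metis

lemma abs_skew_single: "abs_skew (Poly_Mapping.single w 1) = prod_list (map var w)"
  by (simp add: alg_hom_prod_list[OF alg_hom_abs_skew] o_def var.abs_eq[abs_def] flip: prod_list_gen)

text \<open>Left multiplication by a variable is the only product case, which suits operators that
  are known by their commutation with the \<open>var i\<close>.\<close>

lemma skew_induct [case_names one add scale mult]:
  assumes one: "P 1" and add: "\<And>p q. P p \<Longrightarrow> P q \<Longrightarrow> P (p + q)" and scale: "\<And>k p. P p \<Longrightarrow> P (k *\<^sub>C p)"
    and mult: "\<And>i p. P p \<Longrightarrow> P (var i * p)"
  shows "P s"
proof -
  obtain p where s: "s = abs_skew p" using abs_skew_surj by blast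
  have "P (prod_list (map var w))" for w
    by (induction w) (simp_all add: one mult)
  then show ?thesis unfolding s
    by (induction p rule: free_vec_induct)
      (simp_all add: abs_skew_single alg_hom_add[OF alg_hom_abs_skew] alg_hom_scale[OF alg_hom_abs_skew] add scale)
qed

lemma alg_hom_skew_eqI:
  assumes "alg_hom \<phi>" "alg_hom \<psi>" "\<And>i. \<phi> (var i) = \<psi> (var i)"
  shows "\<phi> = \<psi>"
proof
  show "\<phi> s = \<psi> s" for s
    by (induction s rule: skew_induct)
      (simp_all add: assms(3) alg_hom_add[OF assms(1)] alg_hom_add[OF assms(2)]
        alg_hom_scale[OF assms(1)] alg_hom_scale[OF assms(2)] alg_hom_mult[OF assms(1)]
        alg_hom_mult[OF assms(2)] alg_hom_one[OF assms(1)] alg_hom_one[OF assms(2)])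
qed

lemma var_anticommute:
  assumes "i \<noteq> j" shows "var i * var j = - (var j * var i)"
proof -
  have "gen i * gen j + gen j * gen i \<in> skew_ideal"
    unfolding skew_ideal_def ideal_in_def
    using assms by (intro cvec.span_base CollectI exI[of _ 1] exI[of _ "gen i * gen j + gen j * gen i"]) auto
  then have "var i * var j + var j * var i = 0"
    by (simp add: var.abs_eq times_skew.abs_eq plus_skew.abs_eq zero_skew.abs_eq skew.abs_eq_iff)
  then show ?thesis by (simp add: eq_neg_iff_add_eq_0)
qed

section \<open>Ordered monomials\<close>

text \<open>The sign picked up by x_k on its way from the left end of the ordered monomial to its
  own place.\<close>

definition monomial_sign :: "('n::{finite,linorder} \<Rightarrow> nat) \<Rightarrow> 'n \<Rightarrow> complex" where
  "monomial_sign a k = (-1) ^ (\<Sum>j | j < k. a j)"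

lemma monomial_sign_sq [simp]: "monomial_sign a k * monomial_sign a k = 1"
  by (simp add: monomial_sign_def flip: power_mult_distrib)

lemma monomial_sign_upd [simp]: "\<not> j < k \<Longrightarrow> monomial_sign (a(j := m)) k = monomial_sign a k"
  unfolding monomial_sign_def by (intro arg_cong[where f = "(^) _"] sum.cong) auto

lemma monomial_sign_Suc [simp]:
  assumes "j < k" shows "monomial_sign (a(j := Suc (a j))) k = - monomial_sign a k"
proof -
  have "(\<Sum>i | i < k. (a(j := Suc (a j))) i) = Suc (a j) + (\<Sum>i\<in>{i. i < k} - {j}. (a(j := Suc (a j))) i)"
    by (subst sum.remove[of _ j]) (use assms in auto)
  also have "(\<Sum>i\<in>{i. i < k} - {j}. (a(j := Suc (a j))) i) = (\<Sum>i\<in>{i. i < k} - {j}. a i)"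
    by (rule sum.cong) auto
  also have "Suc (a j) + (\<Sum>i\<in>{i. i < k} - {j}. a i) = Suc (\<Sum>i | i < k. a i)"
    by (subst sum.remove[of "{i. i < k}" j]) (use assms in auto)
  finally show ?thesis by (simp add: monomial_sign_def)
qed

lemma monomial_sign_pred:
  assumes "j < k" "a j > 0" shows "monomial_sign (a(j := a j - 1)) k = - monomial_sign a k"
  using monomial_sign_Suc[OF assms(1), of "a(j := a j - 1)"] assms(2) by (simp add: fun_upd_idem)

lemma var_mult_power:
  assumes "i \<noteq> j" shows "var j * var i ^ m = (-1) ^ m *\<^sub>C (var i ^ m * var j)"
proof (induction m)
  case (Suc m)
  have "var j * var i ^ Suc m = - (var i * (var j * var i ^ m))"
    using var_anticommute[OF assms[symmetric]] by (simp flip: mult.assoc)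
  also have "\<dots> = (-1) ^ Suc m *\<^sub>C (var i ^ Suc m * var j)"
    by (simp add: Suc mult_scaleC_right mult.assoc flip: cvec.scale_minus_left)
  finally show ?case .
qed (simp add: scaleC_one)

text \<open>Stated for any strictly sorted list, since the induction peels off one factor; the sign
  therefore counts only the exponents of those smaller letters that occur in
  \<open>xs\<close>.\<close>

lemma var_mult_prod_list:
  fixes k :: "'n::linorder"
  assumes "sorted_wrt (<) xs" "k \<in> set xs"
  shows "var k * prod_list (map (\<lambda>i. var i ^ a i) xs) =
    (-1) ^ (\<Sum>j | j \<in> set xs \<and> j < k. a j) *\<^sub>C prod_list (map (\<lambda>i. var i ^ (a(k := Suc (a k))) i) xs)"
  using assms
proof (induction xs)
  case (Cons x xs)
  show ?case
  proof (cases "x = k")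
    case True
    have "{j. j \<in> set (x # xs) \<and> j < k} = {}" "k \<notin> set xs" using Cons.prems True
      by auto
    then have 0: "(\<Sum>j | j \<in> set (x # xs) \<and> j < k. a j) = 0"
      and eq: "prod_list (map (\<lambda>i. var i ^ (a(k := Suc (a k))) i) xs) = prod_list (map (\<lambda>i. var i ^ a i) xs)"
      by (auto intro!: arg_cong[where f = prod_list])
    show ?thesis unfolding 0 list.map prod_list.Cons eq by (simp add: True scaleC_one mult.assoc)
  next
    case False
    then have x: "x < k" and k: "k \<in> set xs" and xs: "x \<notin> set xs" using Cons.prems by auto
    have "{j. j \<in> set (x # xs) \<and> j < k} = insert x {j. j \<in> set xs \<and> j < k}" using x by auto
    then have e: "(\<Sum>j | j \<in> set (x # xs) \<and> j < k. a j) = a x + (\<Sum>j | j \<in> set xs \<and> j < k. a j)"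
      using xs by simp
    have "var k * prod_list (map (\<lambda>i. var i ^ a i) (x # xs)) =
        (-1) ^ a x *\<^sub>C (var x ^ a x * (var k * prod_list (map (\<lambda>i. var i ^ a i) xs)))"
      using var_mult_power[of x k "a x"] x by (simp add: mult_scaleC_left flip: mult.assoc)
    also have "\<dots> = (-1) ^ (a x + (\<Sum>j | j \<in> set xs \<and> j < k. a j)) *\<^sub>C
        (var x ^ a x * prod_list (map (\<lambda>i. var i ^ (a(k := Suc (a k))) i) xs))"
      using Cons k by (simp add: mult_scaleC_right scaleC_scaleC power_add)
    finally show ?thesis using e False by simp
  qed
qed simp

lemma var_mult_monomial: "var k * monomial a = monomial_sign a k *\<^sub>C monomial (a(k := Suc (a k)))"
  unfolding monomial_def by (subst var_mult_prod_list) (auto simp: strict_sorted_iff monomial_sign_def)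

lemma monomial_zero [simp]: "monomial (\<lambda>_. 0) = (1 :: 'n::{finite,linorder} skew)"
proof -
  have "prod_list (map (\<lambda>i. 1) xs) = (1 :: 'n skew)" for xs :: "'n list" by (induction xs) simp_all
  then show ?thesis by (simp add: monomial_def)
qed

lemma clinear_mult_left: "clinear (\<lambda>p. q * p)" for q :: "'a::calg"
  by (simp add: clinear_iff distrib_left mult_scaleC_right)

lemma clinear_mult_right: "clinear (\<lambda>p. p * q)" for q :: "'a::calg"
  by (simp add: clinear_iff distrib_right mult_scaleC_left)

section \<open>The algebra of linear endomorphisms\<close>

lemma clinear_app_endo: "clinear (app_endo L)"
  using app_endo[of L] by simp

lemma app_endo_Endo: "clinear f \<Longrightarrow> app_endo (Endo f) = f"
  by (simp add: Endo_inverse)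

lemma endo_eqI: "(\<And>x. app_endo L x = app_endo M x) \<Longrightarrow> L = M"
  by (metis app_endo_inject ext)

lemmas app_endo_simps = zero_endo.rep_eq one_endo.rep_eq plus_endo.rep_eq minus_endo.rep_eq
  uminus_endo.rep_eq times_endo.rep_eq scaleC_endo.rep_eq

lemma app_endo_sum: "app_endo (sum h A) x = (\<Sum>a\<in>A. app_endo (h a) x)"
  by (induction A rule: infinite_finite_induct) (simp_all add: app_endo_simps)

lemmas app_endo_linear = clinear_add[OF clinear_app_endo] clinear_scale[OF clinear_app_endo]
  clinear_zero[OF clinear_app_endo] clinear_diff[OF clinear_app_endo] clinear_minus[OF clinear_app_endo]
  clinear_sum[OF clinear_app_endo]

subsection \<open>Linear independence of the ordered monomials\<close>

text \<open>Multiplication by \<open>x\<^sub>k\<close> in the candidate basis; the resulting representation of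
  the algebra on exponent vectors shows that the ordered monomials are linearly independent.\<close>

definition mult_exponents :: "'n::{finite,linorder} \<Rightarrow> (('n \<Rightarrow> nat) \<Rightarrow>\<^sub>0 complex) endo" where
  "mult_exponents k =
    Endo (lin_ext (\<lambda>a. monomial_sign a k *\<^sub>C Poly_Mapping.single (a(k := Suc (a k))) 1))"

lemma mult_exponents_single:
  "app_endo (mult_exponents k) (Poly_Mapping.single a 1) =
    monomial_sign a k *\<^sub>C Poly_Mapping.single (a(k := Suc (a k))) 1"
  by (simp add: mult_exponents_def app_endo_Endo clinear_lin_ext scaleC_one)

text \<open>The two orders differ by exactly one sign: raising the exponent of the smaller index
  flips the sign of the larger one, but not conversely.\<close>

lemma mult_exponents_anticommute:
  assumes "i \<noteq> j"
  shows "mult_exponents i * mult_exponents j + mult_exponents j * mult_exponents i = 0"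
proof (rule endo_eqI)
  have "monomial_sign a i * monomial_sign (a(i := Suc (a i))) j =
      - (monomial_sign a j * monomial_sign (a(j := Suc (a j))) i)" for a
    using assms by (cases i j rule: linorder_cases) simp_all
  then have *: "app_endo (mult_exponents i * mult_exponents j + mult_exponents j * mult_exponents i) (Poly_Mapping.single a 1) = 0" for a
    using assms by (simp add: app_endo_simps mult_exponents_single app_endo_linear scaleC_scaleC fun_upd_twist
        flip: cvec.scale_left_distrib)
  show "app_endo (mult_exponents i * mult_exponents j + mult_exponents j * mult_exponents i) x = app_endo 0 x" for x
    by (induction x rule: free_vec_induct) (use * in \<open>simp_all add: app_endo_linear zero_endo.rep_eq cvec.scale_zero_right\<close>)
qed

text \<open>The image of the vacuum vector (exponent zero) under the representation; it turns out to
  be the coordinate vector in the basis of ordered monomials.\<close>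

definition coeffs :: "'n::{finite,linorder} skew \<Rightarrow> (('n \<Rightarrow> nat) \<Rightarrow>\<^sub>0 complex)" where
  "coeffs p = app_endo (skew_lift mult_exponents p) (Poly_Mapping.single (\<lambda>_. 0) 1)"

lemmas alg_hom_mult_exponents = alg_hom_skew_lift[of mult_exponents, OF mult_exponents_anticommute]

lemma clinear_coeffs: "clinear coeffs"
  by (simp add: clinear_iff coeffs_def alg_hom_add[OF alg_hom_mult_exponents]
      alg_hom_scale[OF alg_hom_mult_exponents] app_endo_simps)

lemma coeffs_one: "coeffs 1 = Poly_Mapping.single (\<lambda>_. 0) 1"
  by (simp add: coeffs_def alg_hom_one[OF alg_hom_mult_exponents] app_endo_simps)

lemma coeffs_var_mult: "coeffs (var k * p) = app_endo (mult_exponents k) (coeffs p)"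
  by (simp add: coeffs_def alg_hom_mult[OF alg_hom_mult_exponents] app_endo_simps
      skew_lift_var[of mult_exponents, OF mult_exponents_anticommute])

lemma coeffs_monomial [simp]: "coeffs (monomial a) = Poly_Mapping.single a 1"
proof (induction "sum a UNIV" arbitrary: a)
  case 0
  then have "a = (\<lambda>_. 0)" by auto
  then show ?case by (simp add: coeffs_one)
next
  case (Suc n)
  obtain k where k: "a k > 0" using Suc.hyps(2) by (metis gr0I sum.neutral nat.distinct(1))
  \<comment> \<open>One variable that occurs in the monomial is stripped off; the sign that this
    costs is cancelled at the end.\<close>
  define a' where "a' = a(k := a k - 1)"
  have a: "a = a'(k := Suc (a' k))" using k by (auto simp: a'_def)
  have "sum a UNIV = a k + sum a (UNIV - {k})" "sum a' UNIV = a' k + sum a' (UNIV - {k})"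
    by (rule sum.remove; simp)+
  moreover have "sum a' (UNIV - {k}) = sum a (UNIV - {k})" by (rule sum.cong) (auto simp: a'_def)
  ultimately have "n = sum a' UNIV" using Suc.hyps(2) k by (simp add: a'_def)
  then have IH: "coeffs (monomial a') = Poly_Mapping.single a' 1" by (rule Suc.hyps(1))
  have "monomial_sign a' k *\<^sub>C coeffs (monomial a) = monomial_sign a' k *\<^sub>C Poly_Mapping.single a 1"
    using arg_cong[OF var_mult_monomial, of coeffs k a', symmetric]
    unfolding coeffs_var_mult IH mult_exponents_single clinear_scale[OF clinear_coeffs] a[symmetric] .
  moreover have "monomial_sign a' k \<noteq> 0" by (simp add: monomial_sign_def)
  ultimately show ?case by (metis cvec.scale_cancel_left)
qed

text \<open>The map from exponent vectors to monomials intertwines \<open>mult_exponents k\<close>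
  with multiplication by x_k; this is the statement that the ordered monomials span.\<close>

lemma lin_ext_monomial_coeffs: "lin_ext monomial (coeffs p) = p"
proof -
  note [simp] = clinear_add[OF clinear_lin_ext] clinear_scale[OF clinear_lin_ext]
  have *: "lin_ext monomial (app_endo (mult_exponents k) v) = var k * lin_ext monomial v"
    for v and k :: 'a
    by (induction v rule: free_vec_induct)
      (simp_all add: mult_exponents_single scaleC_one var_mult_monomial app_endo_linear distrib_left mult_scaleC_right)
  show ?thesis
    by (induction p rule: skew_induct)
      (simp_all add: coeffs_one scaleC_one clinear_add[OF clinear_coeffs] clinear_scale[OF clinear_coeffs] coeffs_var_mult *)
qed

lemma coeffs_eq_iff: "coeffs p = coeffs q \<longleftrightarrow> p = q"
  by (metis lin_ext_monomial_coeffs)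

lemma monomial_induct [case_names monomial add scale]:
  assumes "\<And>a. P (monomial a)" "\<And>p q. P p \<Longrightarrow> P q \<Longrightarrow> P (p + q)" "\<And>k p. P p \<Longrightarrow> P (k *\<^sub>C p)"
  shows "P p"
proof -
  have "P (lin_ext monomial v)" for v
    by (induction v rule: free_vec_induct)
      (simp_all add: assms scaleC_one clinear_add[OF clinear_lin_ext] clinear_scale[OF clinear_lin_ext])
  then show ?thesis by (metis lin_ext_monomial_coeffs)
qed

lemma clinear_monomial_eqI:
  assumes "clinear f" "clinear g" "\<And>a. f (monomial a) = g (monomial a)"
  shows "f = g"
proof
  show "f p = g p" for p
    by (induction p rule: monomial_induct)
      (simp_all add: assms(3) clinear_add[OF assms(1)] clinear_scale[OF assms(1)]
        clinear_add[OF assms(2)] clinear_scale[OF assms(2)])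
qed

subsection \<open>The braided partial derivatives\<close>

text \<open>The monomial basis justifies the definite description: the witness prescribes values on
  basis vectors and is composed with \<open>coeffs\<close>.\<close>

lemma braided_partial:
  shows clinear_braided_partial: "clinear (braided_partial i)"
    and braided_partial_monomial: "braided_partial i (monomial a) =
      (of_nat (a i) * monomial_sign a i) *\<^sub>C monomial (a(i := a i - 1))"
proof -
  let ?P = "\<lambda>D. clinear D \<and> (\<forall>a. D (monomial a) =
        (of_nat (a i) * monomial_sign a i) *\<^sub>C monomial (a(i := a i - 1)))"
  let ?D = "\<lambda>p. lin_ext (\<lambda>a. (of_nat (a i) * monomial_sign a i) *\<^sub>C monomial (a(i := a i - 1))) (coeffs p)"
  have "?P ?D"
    by (auto intro!: clinear_compose[OF clinear_coeffs clinear_lin_ext] simp: scaleC_one)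
  moreover have "D = ?D" if "?P D" for D
    by (rule clinear_monomial_eqI) (use that \<open>?P ?D\<close> in simp_all)
  ultimately have "?P (braided_partial i)"
    unfolding braided_partial_def monomial_sign_def by (rule theI)
  then show "clinear (braided_partial i)"
    "braided_partial i (monomial a) = (of_nat (a i) * monomial_sign a i) *\<^sub>C monomial (a(i := a i - 1))"
    by auto
qed

lemma braided_partial_one [simp]: "braided_partial i 1 = 0"
  using braided_partial_monomial[of i "\<lambda>_. 0"] by simp

lemmas braided_partial_linear = clinear_add[OF clinear_braided_partial] clinear_scale[OF clinear_braided_partial]

lemma braided_partial_var_mult_same: "braided_partial i (var i * p) = p + var i * braided_partial i p"
proof (induction p rule: monomial_induct)
  case (monomial a)
  have "braided_partial i (var i * monomial a) = (1 + of_nat (a i)) *\<^sub>C monomial a"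
    by (simp add: var_mult_monomial braided_partial_linear braided_partial_monomial scaleC_scaleC algebra_simps)
  moreover have "var i * braided_partial i (monomial a) = of_nat (a i) *\<^sub>C monomial a"
    by (cases "a i") (simp_all add: braided_partial_monomial mult_scaleC_right var_mult_monomial scaleC_scaleC
       mult.assoc fun_upd_idem cvec.scale_zero_left)
  ultimately show ?case by (simp add: scaleC_add_left scaleC_one)
qed (simp_all add: distrib_left mult_scaleC_right braided_partial_linear scaleC_add_right)

lemma braided_partial_var_mult:
  assumes "k \<noteq> i" shows "braided_partial i (var k * p) = - (var k * braided_partial i p)"
proof (induction p rule: monomial_induct)
  case (monomial a)
  \<comment> \<open>If x_i occurs, exactly one sign flips: for i < k that of x_k when a_i drops, for
    k < i that of x_i when a_k grows. If x_i does not occur, both sides vanish.\<close>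
  consider "a i = 0" | "a i > 0" "i < k" | "a i > 0" "k < i" using assms by force
  then show ?case
    by cases (use assms in \<open>simp_all add: var_mult_monomial braided_partial_linear braided_partial_monomial
      mult_scaleC_right scaleC_scaleC monomial_sign_pred fun_upd_twist mult_ac flip: cvec.scale_minus_left
      del: One_nat_def\<close>)
qed (simp_all add: distrib_left mult_scaleC_right braided_partial_linear)

subsection \<open>Central regular elements\<close>

lemma var_even_power_central:
  assumes "even m" shows "var i ^ m * p = p * var i ^ m"
proof (induction p rule: skew_induct)
  case (mult j p)
  have "var i ^ m * var j = var j * var i ^ m"
    by (cases "i = j") (use assms in \<open>simp_all add: power_commutes var_mult_power[of i j] scaleC_one\<close>)
  then show ?case using mult by (metis mult.assoc)
qed (simp_all add: distrib_left distrib_right mult_scaleC_left mult_scaleC_right)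

lemma var_even_power_monomial:
  assumes "even m" shows "var i ^ m * monomial a = monomial (a(i := a i + m))"
proof -
  obtain n where m: "m = 2 * n" using assms by blast
  have "var i ^ (2 * n) * monomial a = monomial (a(i := a i + 2 * n))"
  proof (induction n)
    case (Suc n)
    have "var i ^ (2 * Suc n) * monomial a = var i * (var i * (var i ^ (2 * n) * monomial a))"
      by (simp add: mult.assoc)
    also have "\<dots> = monomial (a(i := a i + 2 * Suc n))"
      unfolding Suc by (simp add: var_mult_monomial mult_scaleC_right scaleC_scaleC scaleC_one)
    finally show ?case .
  qed simp
  then show ?thesis by (simp add: m)
qed

text \<open>An even power acts on coordinates as a plain shift, without signs; this turns regularity
  into a comparison of coefficients.\<close>

lemma lookup_coeffs_var_even_power_mult:
  assumes "even m"
  shows "Poly_Mapping.lookup (coeffs (var i ^ m * p)) d =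
    (if m \<le> d i then Poly_Mapping.lookup (coeffs p) (d(i := d i - m)) else 0)"
proof -
  \<comment> \<open>The subtraction is truncated; \<open>e\<close> is meaningful only when m \<le> d
    i.\<close>
  define e where "e = d(i := d i - m)"
  have "Poly_Mapping.lookup (coeffs (var i ^ m * p)) d = (if m \<le> d i then Poly_Mapping.lookup (coeffs p) e else 0)"
  proof (induction p rule: monomial_induct)
    case (monomial a)
    have "a(i := a i + m) = d \<longleftrightarrow> m \<le> d i \<and> a = e"
      by (auto simp: fun_eq_iff e_def)
    then show ?case by (auto simp: var_even_power_monomial assms lookup_single when_def)
  qed (simp_all add: distrib_left mult_scaleC_right clinear_add[OF clinear_coeffs] clinear_scale[OF clinear_coeffs]
     lookup_add)
  then show ?thesis by (simp add: e_def)
qed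

lemma coeffs_zero_iff: "coeffs p = 0 \<longleftrightarrow> p = 0"
  by (metis clinear_zero[OF clinear_coeffs] coeffs_eq_iff)

lemma central_regular_var_power:
  fixes i :: "'n::{finite,linorder}"
  assumes "even m" shows "central_regular (var i ^ m)"
  unfolding central_regular_def
proof (intro conjI allI impI)
  fix p :: "'n skew" assume "var i ^ m * p = 0"
  then have "Poly_Mapping.lookup (coeffs (var i ^ m * p)) (d(i := d i + m)) = 0" for d
    by (simp add: clinear_zero[OF clinear_coeffs])
  then have "coeffs p = 0"
    by (intro poly_mapping_eqI) (simp add: lookup_coeffs_var_even_power_mult assms)
  then show "p = 0" by (simp add: coeffs_zero_iff)
qed (rule var_even_power_central[OF assms])

text \<open>Comparing coefficients expresses the coefficient of \<open>p\<close> at \<open>d\<close>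
  by one whose exponent of x_j is smaller by m; the descent stops once that exponent is below
  m.\<close>

lemma central_regular_binomial:
  fixes i j :: "'n::{finite,linorder}"
  assumes "even m" "m > 0" "i \<noteq> j" "\<alpha> \<noteq> 0"
  shows "central_regular (\<alpha> *\<^sub>C var i ^ m + \<beta> *\<^sub>C var j ^ m)"
  unfolding central_regular_def
proof (intro conjI allI impI)
  fix p :: "'n skew" assume 0: "(\<alpha> *\<^sub>C var i ^ m + \<beta> *\<^sub>C var j ^ m) * p = 0"
  let ?c = "Poly_Mapping.lookup (coeffs p)"
  have rec: "\<alpha> * ?c d = - \<beta> * (if m \<le> d j then ?c (d(i := d i + m, j := d j - m)) else 0)" for d
  proof -
    \<comment> \<open>Raising the exponent of x_i by m makes the first summand contribute the
      coefficient of \<open>p\<close> at \<open>d\<close> itself.\<close>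
    have "Poly_Mapping.lookup (coeffs ((\<alpha> *\<^sub>C var i ^ m + \<beta> *\<^sub>C var j ^ m) * p)) (d(i := d i + m)) = 0"
      by (simp add: 0 clinear_zero[OF clinear_coeffs])
    then show ?thesis using assms
      by (simp add: distrib_right mult_scaleC_left clinear_add[OF clinear_coeffs] clinear_scale[OF clinear_coeffs]
        lookup_add lookup_coeffs_var_even_power_mult eq_neg_iff_add_eq_0 fun_upd_twist split: if_splits)
  qed
  have "?c d = 0" for d
  proof (induction "d j" arbitrary: d rule: less_induct)
    case less
    have "?c (d(i := d i + m, j := d j - m)) = 0" if "m \<le> d j"
      by (rule less) (use assms that in auto)
    then show ?case using rec[of d] assms(4) by (auto split: if_splits)
  qed
  then have "coeffs p = 0" by (intro poly_mapping_eqI) simp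
  then show "p = 0" by (simp add: coeffs_zero_iff)
qed (simp add: distrib_left distrib_right mult_scaleC_left mult_scaleC_right var_even_power_central[OF assms(1)])

text \<open>A variable need not be central, but its square is central and regular.\<close>

lemma mult_var_eq_0: "p * var i = 0 \<Longrightarrow> p = 0" for i :: "'n::{finite,linorder}"
  using central_regular_cancel[OF central_regular_var_power[of 2 i], of p] var_even_power_central[of 2 i p]
  by (simp add: power2_eq_square flip: mult.assoc)

section \<open>Monomial groups and their action\<close>

lemma GL_simps [simp]:
  "carrier GL = {w. Vector_Spaces.linear (*s) (*s) w \<and> bij w}" "v \<otimes>\<^bsub>GL\<^esub> w = v \<circ> w" "\<one>\<^bsub>GL\<^esub> = id"
  by (simp_all add: GL_def)

lemma linear_vec_iff:
  "Vector_Spaces.linear (*s) (*s) w \<longleftrightarrow> (\<forall>x y. w (x + y) = w x + w y) \<and> (\<forall>k x. w (k *s x) = k *s w x)"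
  for w :: "complex ^ 'n \<Rightarrow> complex ^ 'm"
  by (simp add: Vector_Spaces.linear_iff vec.vector_space_axioms)

lemma group_GL: "group (GL :: 'n::finite lmap monoid)"
proof (rule groupI)
  fix w :: "'n lmap" assume "w \<in> carrier GL"
  then have w: "Vector_Spaces.linear (*s) (*s) w" "bij w" by auto
  have "inv_into UNIV w (x + y) = inv_into UNIV w x + inv_into UNIV w y" "inv_into UNIV w (k *s x) = k *s inv_into UNIV w x" for x y k
    using w by (simp_all add: linear_vec_iff bij_is_surj surj_f_inv_f inv_f_eq bij_is_inj)
  then have "Vector_Spaces.linear (*s) (*s) (inv_into UNIV w)" by (simp add: linear_vec_iff)
  moreover have "inv_into UNIV w \<circ> w = id" using w by (simp add: bij_is_inj)
  ultimately show "\<exists>v\<in>carrier GL. v \<otimes>\<^bsub>GL\<^esub> w = \<one>\<^bsub>GL\<^esub>"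
    using w by (intro bexI[of _ "inv_into UNIV w"]) (auto simp: bij_imp_bij_inv)
qed (auto simp: linear_vec_iff bij_comp comp_assoc)

lemma group_complex_units: "group complex_units"
  unfolding complex_units_def by (rule groupI) (auto intro!: bexI[of _ "inverse _"])

lemma inv_complex_units: "x \<noteq> 0 \<Longrightarrow> inv\<^bsub>complex_units\<^esub> x = inverse x"
  by (rule group.inv_equality[OF group_complex_units]) (simp_all add: complex_units_def)

text \<open>Invertible monomial matrices with entries in \<open>C\<close>. Permutation and scalars
  are carried along as data, because they determine the matrix and all conjugation formulas are
  expressed in them.\<close>

definition monomial_map :: "complex set \<Rightarrow> 'n::finite lmap \<Rightarrow> ('n \<Rightarrow> 'n) \<Rightarrow> ('n \<Rightarrow> complex) \<Rightarrow> bool" where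
  "monomial_map C w p l \<longleftrightarrow> w \<in> carrier GL \<and> bij p \<and> (\<forall>i. l i \<in> C) \<and> (\<forall>i. w (axis i 1) = l i *s axis (p i) 1)"

lemma linear_vec_expansion:
  fixes w :: "'n::finite lmap"
  assumes "Vector_Spaces.linear (*s) (*s) w"
  shows "w v = (\<Sum>i\<in>UNIV. v $ i *s w (axis i 1))"
proof -
  interpret Vector_Spaces.linear "(*s) :: complex \<Rightarrow> complex ^ 'n \<Rightarrow> _" "(*s)" w by (rule assms)
  show ?thesis by (subst basis_expansion[symmetric]) (simp add: sum scale)
qed

lemma monomial_map_unique:
  assumes "monomial_map C v p l" "monomial_map C' w q m" "p = q" "l = m"
  shows "v = w"
proof
  show "v x = w x" for x
    using assms linear_vec_expansion[of v x] linear_vec_expansion[of w x] by (simp add: monomial_map_def)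
qed

lemma monomial_map_bijD: "monomial_map C w p l \<Longrightarrow> bij p"
  by (simp add: monomial_map_def)

lemma coef_monomial_map: "monomial_map C w p l \<Longrightarrow> coef w i k = (if k = p i then l i else 0)"
  by (simp add: coef_def monomial_map_def axis_def)

lemma sum_if_scaleC: "(\<Sum>k\<in>UNIV. (if k = a then z else 0) *\<^sub>C f k) = z *\<^sub>C (f a :: 'v::cvec)"
  for a :: "'n::finite"
  by (simp add: if_distrib[of "\<lambda>z. z *\<^sub>C _"] cvec.scale_zero_left cong: if_cong)

text \<open>A monomial matrix sends distinct variables to multiples of distinct variables, so their
  images still anticommute. A general linear map need not extend to an algebra homomorphism.\<close>

lemma skew_action_monomial_map:
  assumes w: "monomial_map C w p l"
  shows alg_hom_skew_action: "alg_hom (skew_action w)"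
    and skew_action_var: "skew_action w (var i) = l i *\<^sub>C var (p i)"
proof -
  let ?z = "\<lambda>i. l i *\<^sub>C var (p i)"
  have inj: "p i \<noteq> p j" if "i \<noteq> j" for i j
    using that monomial_map_bijD[OF w] by (auto simp: bij_def inj_def)
  have z: "?z i * ?z j + ?z j * ?z i = 0" if "i \<noteq> j" for i j
    using var_anticommute[OF inj[OF that]]
    by (simp add: mult_scaleC_left mult_scaleC_right scaleC_scaleC mult.commute cvec.scale_minus_right)
  have "\<exists>!\<phi>. alg_hom \<phi> \<and> (\<forall>i. \<phi> (var i) = ?z i)"
  proof (rule ex1I)
    show "alg_hom (skew_lift ?z) \<and> (\<forall>i. skew_lift ?z (var i) = ?z i)"
      using alg_hom_skew_lift[of ?z, OF z] skew_lift_var[of ?z, OF z] by simp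
    show "\<phi> = skew_lift ?z" if "alg_hom \<phi> \<and> (\<forall>i. \<phi> (var i) = ?z i)" for \<phi>
      using that alg_hom_skew_lift[of ?z, OF z] skew_lift_var[of ?z, OF z] by (intro alg_hom_skew_eqI) auto
  qed
  from theI'[OF this] have "alg_hom (skew_action w) \<and> (\<forall>i. skew_action w (var i) = ?z i)"
    by (simp add: skew_action_def coef_monomial_map[OF w] sum_if_scaleC)
  then show "alg_hom (skew_action w)" "skew_action w (var i) = ?z i" by auto
qed

lemma app_op_w: "monomial_map C w p l \<Longrightarrow> app_endo (op_w w) = skew_action w"
  by (simp add: op_w_def app_endo_Endo alg_homD(1)[OF alg_hom_skew_action])

definition mult_op :: "'a::calg \<Rightarrow> 'a endo" where
  "mult_op p = Endo (\<lambda>q. p * q)"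

lemma app_mult_op [simp]: "app_endo (mult_op p) q = p * q"
  by (simp add: mult_op_def app_endo_Endo clinear_mult_left)

lemma alg_hom_mult_op: "alg_hom mult_op"
  by (auto simp: alg_hom_def clinear_iff app_endo_simps distrib_right mult_scaleC_left mult.assoc intro!: endo_eqI)

lemma op_x_eq: "op_x i = mult_op (var i)"
  by (rule endo_eqI) (simp add: op_x.rep_eq)

lemma op_w_mult_op:
  assumes "monomial_map C w p l" shows "op_w w * mult_op q = mult_op (skew_action w q) * op_w w"
  by (rule endo_eqI) (simp add: app_endo_simps app_op_w[OF assms] alg_hom_mult[OF alg_hom_skew_action[OF assms]])

section \<open>Monomial matrices with entries in C and the reflection group\<close>

locale braided_data =
  fixes C C' :: "complex set" and c :: "complex \<Rightarrow> complex"
  assumes C: "subgroup C complex_units" and finC: "finite C"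
    and C': "subgroup C' complex_units" and finC': "finite C'"
    and C'C: "C' \<subseteq> C" and neg1: "-1 \<in> C"
begin

lemma C_nonzero: "z \<in> C \<Longrightarrow> z \<noteq> 0"
  using subgroup.subset[OF C] by (auto simp: complex_units_def)

lemma C_one: "1 \<in> C"
  using subgroup.one_closed[OF C] by (simp add: complex_units_def)

lemma C_mult: "y \<in> C \<Longrightarrow> z \<in> C \<Longrightarrow> y * z \<in> C"
  using subgroup.m_closed[OF C, of y z] by (simp add: complex_units_def)

lemma C_inverse: "z \<in> C \<Longrightarrow> inverse z \<in> C"
  using subgroup.m_inv_closed[OF C, of z] by (simp add: inv_complex_units C_nonzero)

lemma C_minus: "z \<in> C \<Longrightarrow> - z \<in> C"
  using C_mult[OF neg1, of z] by simp

lemma monomial_map_comp: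
  assumes v: "monomial_map C v p l" and w: "monomial_map C w q m"
  shows "monomial_map C (v \<circ> w) (p \<circ> q) (\<lambda>i. m i * l (q i))"
  using v w by (auto simp: monomial_map_def linear_vec_iff bij_comp C_mult)

lemma monomial_map_inv:
  assumes w: "monomial_map C w p l"
  shows "monomial_map C (inv\<^bsub>GL\<^esub> w) (inv_into UNIV p) (\<lambda>i. inverse (l (inv_into UNIV p i)))"
proof -
  have wG: "w \<in> carrier GL" using w by (simp add: monomial_map_def)
  define v where "v = inv\<^bsub>GL\<^esub> w"
  have v: "v \<in> carrier GL" "v \<circ> w = id"
    using group.inv_closed[OF group_GL wG] group.l_inv[OF group_GL wG] by (simp_all add: v_def)
  have "v (axis i 1) = inverse (l (inv_into UNIV p i)) *s axis (inv_into UNIV p i) 1" for i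
  proof -
    have nz: "l (inv_into UNIV p i) \<noteq> 0" using w by (auto simp: monomial_map_def C_nonzero)
    have "p (inv_into UNIV p i) = i" using monomial_map_bijD[OF w] by (simp add: bij_is_surj surj_f_inv_f)
    then have "w (axis (inv_into UNIV p i) 1) = l (inv_into UNIV p i) *s axis i 1" using w by (simp add: monomial_map_def)
    then have "v (l (inv_into UNIV p i) *s axis i 1) = axis (inv_into UNIV p i) 1" using v(2) by (metis comp_apply id_apply)
    then have "l (inv_into UNIV p i) *s v (axis i 1) = axis (inv_into UNIV p i) 1" using v(1) by (simp add: linear_vec_iff)
    then show ?thesis using nz by (metis vector_smult_assoc vector_smult_lid left_inverse)
  qed
  then show ?thesis
    using w v(1) unfolding v_def[symmetric]
    by (auto simp: monomial_map_def bij_imp_bij_inv C_inverse)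
qed

lemma monomial_map_id: "monomial_map C id id (\<lambda>_. 1)"
  by (auto simp: monomial_map_def linear_vec_iff C_one)

definition sigma_coeff :: "'n \<Rightarrow> 'n \<Rightarrow> complex \<Rightarrow> 'n \<Rightarrow> complex" where
  "sigma_coeff i j \<epsilon> = (\<lambda>_. 1)(i := \<epsilon>, j := - inverse \<epsilon>)"

text \<open>On the plane of x_i and x_j the map squares to -1, so its inverse there is its negative,
  which is the map with parameter -\<epsilon>.\<close>

lemma sigma_map_sigma_map:
  assumes "i \<noteq> j" "\<epsilon> \<noteq> 0" shows "sigma_map i j \<epsilon> (sigma_map i j (- \<epsilon>) v) = v"
  using assms by (simp add: sigma_map_def vec_eq_iff)

lemma monomial_map_sigma:
  assumes "i \<noteq> j" "\<epsilon> \<in> C"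
  shows "monomial_map C (sigma_map i j \<epsilon>) (Transposition.transpose i j) (sigma_coeff i j \<epsilon>)"
proof -
  have nz: "\<epsilon> \<noteq> 0" using assms by (simp add: C_nonzero)
  have "bij (sigma_map i j \<epsilon>)"
    by (rule o_bij[of "sigma_map i j (- \<epsilon>)"])
      (use sigma_map_sigma_map[OF assms(1) nz] sigma_map_sigma_map[OF assms(1), of "-\<epsilon>"] nz in \<open>auto simp: fun_eq_iff\<close>)
  moreover have "Vector_Spaces.linear (*s) (*s) (sigma_map i j \<epsilon>)"
    unfolding linear_vec_iff by (simp add: sigma_map_def vec_eq_iff algebra_simps)
  moreover have "sigma_map i j \<epsilon> (axis k 1) = sigma_coeff i j \<epsilon> k *s axis (Transposition.transpose i j k) 1" for k
    using assms(1) by (auto simp: sigma_map_def sigma_coeff_def vec_eq_iff axis_def Transposition.transpose_def)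
  moreover have "sigma_coeff i j \<epsilon> k \<in> C" for k
    using assms(2) by (simp add: sigma_coeff_def C_one C_minus C_inverse)
  ultimately show ?thesis by (simp add: monomial_map_def)
qed

lemma monomial_map_t:
  assumes "\<epsilon> \<in> C"
  shows "monomial_map C (t_map i \<epsilon>) id ((\<lambda>_. 1)(i := \<epsilon>))"
proof -
  have nz: "\<epsilon> \<noteq> 0" using assms by (simp add: C_nonzero)
  have "t_map i \<epsilon> (t_map i (inverse \<epsilon>) v) = v" "t_map i (inverse \<epsilon>) (t_map i \<epsilon> v) = v" for v :: "complex ^ 'a"
    using nz by (simp_all add: t_map_def vec_eq_iff)
  then have "bij (t_map i \<epsilon> :: 'a lmap)"
    by (intro o_bij[of "t_map i (inverse \<epsilon>)"]) (auto simp: fun_eq_iff)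
  moreover have "Vector_Spaces.linear (*s) (*s) (t_map i \<epsilon> :: 'a lmap)"
    unfolding linear_vec_iff by (simp add: t_map_def vec_eq_iff algebra_simps)
  moreover have "t_map i \<epsilon> (axis k 1) = ((\<lambda>_. 1)(i := \<epsilon>)) k *s axis k 1" for k
    by (auto simp: t_map_def vec_eq_iff axis_def)
  ultimately show ?thesis using assms by (auto simp: monomial_map_def C_one)
qed

abbreviation "W \<equiv> refl_group C C'"

lemma sigma_in_W: "i \<noteq> j \<Longrightarrow> \<epsilon> \<in> C \<Longrightarrow> sigma_map i j \<epsilon> \<in> W"
  unfolding refl_group_def by (rule generate.incl) auto

lemma t_in_W: "\<epsilon> \<in> C' \<Longrightarrow> t_map i \<epsilon> \<in> W"
  unfolding refl_group_def by (rule generate.incl) auto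

lemma W_one: "id \<in> W"
  using generate.one[of GL] by (simp add: refl_group_def)

lemma W_mult: "v \<in> W \<Longrightarrow> w \<in> W \<Longrightarrow> v \<circ> w \<in> W"
  using generate.eng[of v GL] by (simp add: refl_group_def)

lemma monomial_map_generators:
  assumes "w \<in> {sigma_map i j \<epsilon> | i j \<epsilon>. i \<noteq> j \<and> \<epsilon> \<in> C} \<union> {t_map i \<epsilon> | i \<epsilon>. \<epsilon> \<in> C'}"
  shows "\<exists>p l. monomial_map C w p l"
  using assms
proof
  assume "w \<in> {sigma_map i j \<epsilon> | i j \<epsilon>. i \<noteq> j \<and> \<epsilon> \<in> C}"
  then obtain i j \<epsilon> where "w = sigma_map i j \<epsilon>" "i \<noteq> j" "\<epsilon> \<in> C" by auto
  then show ?thesis using monomial_map_sigma[of i j \<epsilon>] by blast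
next
  assume "w \<in> {t_map i \<epsilon> | i \<epsilon>. \<epsilon> \<in> C'}"
  then obtain i \<epsilon> where "w = t_map i \<epsilon>" "\<epsilon> \<in> C" using C'C by auto
  then show ?thesis using monomial_map_t[of \<epsilon> i] by blast
qed

lemma W_monomial_map: "w \<in> W \<Longrightarrow> \<exists>p l. monomial_map C w p l"
  unfolding refl_group_def
proof (induction rule: generate.induct)
  case one
  show ?case unfolding GL_simps by (intro exI) (rule monomial_map_id)
next
  case (incl h)
  then show ?case by (rule monomial_map_generators)
next
  case (inv h)
  then obtain p l where "monomial_map C h p l" using monomial_map_generators by blast
  then show ?case by (intro exI) (rule monomial_map_inv)
next
  case (eng v w)
  then obtain p l q m where "monomial_map C v p l" "monomial_map C w q m" by blast
  then show ?case unfolding GL_simps by (intro exI) (rule monomial_map_comp)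
qed

lemma W_carrier: "w \<in> W \<Longrightarrow> w \<in> carrier GL"
  using W_monomial_map[of w] unfolding monomial_map_def by blast

lemma W_inv:
  fixes w :: "'n::finite lmap"
  assumes "w \<in> W" shows "inv\<^bsub>GL\<^esub> w \<in> W"
proof -
  \<comment> \<open>The generating set is reached through \<open>W\<close>: each of its elements
    lies in \<open>W\<close>, hence in the general linear group.\<close>
  have "S \<subseteq> carrier GL" if "W = generate GL S" for S :: "'n lmap set"
  proof
    fix w assume "w \<in> S"
    then have "w \<in> W" unfolding that by (rule generate.incl)
    then show "w \<in> carrier GL" by (rule W_carrier)
  qed
  from group.generate_m_inv_closed[OF group_GL this[OF refl_group_def] assms[unfolded refl_group_def]]
  show ?thesis by (simp only: refl_group_def)
qed

lemma W_inv_comp: "w \<in> W \<Longrightarrow> inv\<^bsub>GL\<^esub> w \<circ> w = id" "w \<in> W \<Longrightarrow> w \<circ> inv\<^bsub>GL\<^esub> w = id"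
  using group.l_inv[OF group_GL, of w] group.r_inv[OF group_GL, of w] W_carrier[of w] by simp_all

lemma skew_action_comp:
  assumes "v \<in> W" "w \<in> W" shows "skew_action (v \<circ> w) = skew_action v \<circ> skew_action w"
proof -
  obtain p l q m where v: "monomial_map C v p l" and w: "monomial_map C w q m"
    using assms W_monomial_map by blast
  note vw = monomial_map_comp[OF v w]
  note hom = alg_hom_skew_action[OF v] alg_hom_skew_action[OF w]
  have "alg_hom (skew_action v \<circ> skew_action w)"
    using hom by (auto simp: alg_hom_def clinear_iff)
  then show ?thesis
    by (intro alg_hom_skew_eqI alg_hom_skew_action[OF vw])
      (simp_all add: skew_action_var[OF vw] skew_action_var[OF v] skew_action_var[OF w] alg_hom_scale[OF hom(1)] scaleC_scaleC)
qed

lemma skew_action_id: "skew_action (id :: 'n::{finite,linorder} lmap) = (\<lambda>x. x)"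
proof (rule alg_hom_skew_eqI)
  show "alg_hom (\<lambda>x :: 'n skew. x)" by (simp add: alg_hom_def clinear_iff)
qed (simp_all add: alg_hom_skew_action[OF monomial_map_id] scaleC_one skew_action_var[OF monomial_map_id])

lemma app_op_w_W: "w \<in> W \<Longrightarrow> app_endo (op_w w) = skew_action w"
  using W_monomial_map app_op_w by blast

lemma op_w_comp: "v \<in> W \<Longrightarrow> w \<in> W \<Longrightarrow> op_w (v \<circ> w) = op_w v * op_w w"
  by (rule endo_eqI) (simp add: app_op_w_W W_mult skew_action_comp app_endo_simps)

lemma op_w_id: "op_w (id :: 'n::{finite,linorder} lmap) = 1"
  by (rule endo_eqI) (simp add: app_op_w_W W_one skew_action_id app_endo_simps)

lemma op_w_inv: "w \<in> W \<Longrightarrow> op_w w * op_w (inv\<^bsub>GL\<^esub> w) = 1" "w \<in> W \<Longrightarrow> op_w (inv\<^bsub>GL\<^esub> w) * op_w w = 1"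
  for w :: "'n::{finite,linorder} lmap"
  by (simp_all add: W_inv W_inv_comp op_w_id flip: op_w_comp)

lemma sigma_map_swap: "i \<noteq> j \<Longrightarrow> sigma_map j i \<epsilon> = sigma_map i j (- inverse \<epsilon>)"
  by (auto simp: fun_eq_iff sigma_map_def vec_eq_iff)

lemma dual_coef_monomial_map:
  assumes w: "monomial_map C w p l" shows "dual_coef w i k = (if k = p i then inverse (l i) else 0)"
proof -
  have "i = inv_into UNIV p k \<longleftrightarrow> k = p i"
    using monomial_map_bijD[OF w] by (metis bij_inv_eq_iff)
  then show ?thesis using monomial_map_inv[OF w]
    by (auto simp: dual_coef_def monomial_map_def axis_def)
qed

text \<open>The parameter on the right comes from following x_{p i} under conjugation: it goes to
  l_i^{-1} x_i, then to l_i^{-1} \<epsilon> x_j, then to l_i^{-1} \<epsilon> l_j x_{p j}.\<close>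

lemma conj_sigma:
  assumes w: "w \<in> W" "monomial_map C w p l" and "i \<noteq> j" "\<epsilon> \<in> C"
  shows "op_w w * op_w (sigma_map i j \<epsilon>) = op_w (sigma_map (p i) (p j) (\<epsilon> * l j * inverse (l i))) * op_w w"
proof -
  let ?e = "\<epsilon> * l j * inverse (l i)"
  have l: "l k \<in> C" for k using w(2) by (simp add: monomial_map_def)
  then have e: "?e \<in> C" using assms by (intro C_mult C_inverse)
  have nz: "l k \<noteq> 0" "\<epsilon> \<noteq> 0" for k using l assms by (auto simp: C_nonzero)
  have inj: "p a = p b \<longleftrightarrow> a = b" for a b using monomial_map_bijD[OF w(2)] by (auto simp: bij_def inj_def)
  have "w \<circ> sigma_map i j \<epsilon> = sigma_map (p i) (p j) ?e \<circ> w"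
    by (rule monomial_map_unique[OF monomial_map_comp[OF w(2) monomial_map_sigma] monomial_map_comp[OF monomial_map_sigma w(2)]])
      (use assms e inj nz in \<open>auto simp: fun_eq_iff Transposition.transpose_def sigma_coeff_def\<close>)
  moreover have "sigma_map i j \<epsilon> \<in> W" "sigma_map (p i) (p j) ?e \<in> W"
    using assms e inj by (auto intro!: sigma_in_W)
  ultimately show ?thesis using w(1) by (metis op_w_comp)
qed

lemma conj_t:
  assumes w: "w \<in> W" "monomial_map C w p l" and "\<epsilon> \<in> C'"
  shows "op_w w * op_w (t_map i \<epsilon>) = op_w (t_map (p i) \<epsilon>) * op_w w"
proof -
  have inj: "p a = p b \<longleftrightarrow> a = b" for a b using monomial_map_bijD[OF w(2)] by (auto simp: bij_def inj_def)
  have "w \<circ> t_map i \<epsilon> = t_map (p i) \<epsilon> \<circ> w"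
    by (rule monomial_map_unique[OF monomial_map_comp[OF w(2) monomial_map_t] monomial_map_comp[OF monomial_map_t w(2)]])
      (use assms C'C inj in \<open>auto simp: fun_eq_iff\<close>)
  then show ?thesis using w(1) t_in_W[OF assms(3)] by (metis op_w_comp)
qed

end

section \<open>Fractions\<close>

lemma frac_rel_refl: "central_regular z \<Longrightarrow> frac_rel (a, z) (a, z)"
  by (simp add: frac_rel_def)

lemma abs_frac_eq_iff:
  "central_regular z \<Longrightarrow> central_regular w \<Longrightarrow> abs_frac (a, z) = abs_frac (b, w) \<longleftrightarrow> a * w = b * z"
  using Quotient3_rel[OF Quotient3_frac, of "(a, z)" "(b, w)"] frac_rel_refl
  by (auto simp: frac_rel_def)

lemma Fract_mult_to_frac: "Fract a z * to_frac b = Fract (a * b) z"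
proof (cases "central_regular z")
  case True
  then show ?thesis
    by (simp add: Fract_def central_regular_one times_frac.abs_eq frac_rel_refl)
qed (simp add: Fract_def)

lemma to_frac_mult_Fract: "to_frac b * Fract a z = Fract (b * a) z"
proof (cases "central_regular z")
  case True
  then show ?thesis
    by (simp add: Fract_def central_regular_one times_frac.abs_eq frac_rel_refl)
qed (simp add: Fract_def)

lemma Fract_scale: "Fract (k *\<^sub>C a) z = k *\<^sub>C Fract a z"
proof (cases "central_regular z")
  case True
  then show ?thesis
    by (simp add: Fract_def scaleC_frac.abs_eq frac_rel_refl)
qed (simp add: Fract_def cvec.scale_zero_right)

lemma Fract_add: "Fract (a + b) z = Fract a z + Fract b z"
proof (cases "central_regular z")
  case True
  then have "(a + b) * (z * z) = (a * z + b * z) * z"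
    by (simp add: algebra_simps)
  then show ?thesis using True
    by (simp add: Fract_def plus_frac.abs_eq frac_rel_refl abs_frac_eq_iff central_regular_mult)
qed (simp add: Fract_def)

text \<open>Each Dunkl summand keeps its denominator throughout, so linearity in the numerator
  replaces cross-multiplication.\<close>

lemma clinear_Fract: "clinear (\<lambda>a. Fract a z)"
  by (simp add: clinear_iff Fract_add Fract_scale)

lemmas Fract_linear = clinear_add[OF clinear_Fract] clinear_scale[OF clinear_Fract]
  clinear_zero[OF clinear_Fract] clinear_diff[OF clinear_Fract] clinear_minus[OF clinear_Fract]
  clinear_sum[OF clinear_Fract]

lemma Fract_cancel: "central_regular z \<Longrightarrow> Fract (z * a) z = to_frac a"
  by (simp add: Fract_def central_regular_one abs_frac_eq_iff central_regularD)

lemma to_frac_eq_iff: "to_frac a = to_frac b \<longleftrightarrow> a = b"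
  by (simp add: Fract_def central_regular_one abs_frac_eq_iff)

lemma clinear_ident: "clinear (\<lambda>x. x)"
  by (simp add: clinear_iff)

lemma clinear_add_fun: "clinear f \<Longrightarrow> clinear g \<Longrightarrow> clinear (\<lambda>x. f x + g x)"
  by (simp add: clinear_iff scaleC_add_right)

lemma clinear_diff_fun: "clinear f \<Longrightarrow> clinear g \<Longrightarrow> clinear (\<lambda>x. f x - g x)"
  by (simp add: clinear_iff cvec.scale_right_diff_distrib)

lemma clinear_scale_fun: "clinear f \<Longrightarrow> clinear (\<lambda>x. k *\<^sub>C f x)"
  by (simp add: clinear_iff scaleC_add_right scaleC_scaleC mult.commute)

lemma clinear_sum_fun: "(\<And>a. a \<in> A \<Longrightarrow> clinear (f a)) \<Longrightarrow> clinear (\<lambda>x. \<Sum>a\<in>A. f a x)"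
  by (simp add: clinear_iff sum.distrib cvec.scale_sum_right)

section \<open>Braided Dunkl operators\<close>

context braided_data
begin

definition sigma_term :: "'n \<Rightarrow> 'n \<Rightarrow> complex \<Rightarrow> 'n::{finite,linorder} skew \<Rightarrow> 'n skew frac" where
  "sigma_term i j \<epsilon> f = Fract (var i + \<epsilon> *\<^sub>C var j) (var i ^ 2 - \<epsilon>\<^sup>2 *\<^sub>C var j ^ 2)
     * to_frac (f - skew_action (sigma_map i j \<epsilon>) f)"

definition t_term :: "'n \<Rightarrow> complex \<Rightarrow> 'n::{finite,linorder} skew \<Rightarrow> 'n skew frac" where
  "t_term i \<epsilon> f = (c \<epsilon> / (1 - \<epsilon>)) *\<^sub>C (Fract (var i) (var i ^ 2) * to_frac (f - skew_action (t_map i \<epsilon>) f))"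

lemma sigma_term_eq:
  "sigma_term i j \<epsilon> f = Fract ((var i + \<epsilon> *\<^sub>C var j) * (f - skew_action (sigma_map i j \<epsilon>) f))
     (var i ^ 2 - \<epsilon>\<^sup>2 *\<^sub>C var j ^ 2)"
  by (simp add: sigma_term_def Fract_mult_to_frac)

lemma t_term_eq:
  "t_term i \<epsilon> f = (c \<epsilon> / (1 - \<epsilon>)) *\<^sub>C Fract (var i * (f - skew_action (t_map i \<epsilon>) f)) (var i ^ 2)"
  by (simp add: t_term_def Fract_mult_to_frac)

lemma dunkl_frac_eq:
  "dunkl_frac C C' c i f = to_frac (braided_partial i f)
     + c 1 *\<^sub>C (\<Sum>j\<in>UNIV - {i}. \<Sum>\<epsilon>\<in>C. sigma_term i j \<epsilon> f) + (\<Sum>\<epsilon>\<in>C' - {1}. t_term i \<epsilon> f)"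
  by (simp add: dunkl_frac_def sigma_term_def t_term_def)

lemma central_regular_denominator:
  fixes i j :: "'n::{finite,linorder}"
  assumes "i \<noteq> j" shows "central_regular (var i ^ 2 - \<epsilon>\<^sup>2 *\<^sub>C var j ^ 2)"
  using central_regular_binomial[of 2 i j 1 "- (\<epsilon>\<^sup>2)"] assms by (simp add: scaleC_one)

section \<open>Commutation of the divided differences with the variables\<close>

context
  fixes i j :: "'n::{finite,linorder}" and \<epsilon> :: complex
  assumes ij: "i \<noteq> j" and \<epsilon>: "\<epsilon> \<in> C"
begin

lemma sigma_hom: "alg_hom (skew_action (sigma_map i j \<epsilon>))"
  by (rule alg_hom_skew_action[OF monomial_map_sigma[OF ij \<epsilon>]])

lemma sigma_var:
  "skew_action (sigma_map i j \<epsilon>) (var i) = \<epsilon> *\<^sub>C var j"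
  "skew_action (sigma_map i j \<epsilon>) (var j) = - inverse \<epsilon> *\<^sub>C var i"
  "k \<noteq> i \<Longrightarrow> k \<noteq> j \<Longrightarrow> skew_action (sigma_map i j \<epsilon>) (var k) = var k"
  using ij by (simp_all add: skew_action_var[OF monomial_map_sigma[OF ij \<epsilon>]] sigma_coeff_def scaleC_one)

lemma var_commute_numerator:
  assumes "k \<noteq> i" "k \<noteq> j"
  shows "(var i + \<epsilon> *\<^sub>C var j) * var k = - (var k * (var i + \<epsilon> *\<^sub>C var j))"
  using assms by (simp add: distrib_left distrib_right mult_scaleC_left mult_scaleC_right
      var_anticommute[of i k] var_anticommute[of j k] cvec.scale_minus_right)

lemma sigma_term_other:
  assumes "k \<noteq> i" "k \<noteq> j"
  shows "sigma_term i j \<epsilon> (var k * f) = - (to_frac (var k) * sigma_term i j \<epsilon> f)"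
proof -
  let ?s = "skew_action (sigma_map i j \<epsilon>)"
  have "(var i + \<epsilon> *\<^sub>C var j) * (var k * f - ?s (var k * f)) = ((var i + \<epsilon> *\<^sub>C var j) * var k) * (f - ?s f)"
    by (simp add: alg_hom_mult[OF sigma_hom] sigma_var assms right_diff_distrib mult.assoc)
  also have "\<dots> = - (var k * ((var i + \<epsilon> *\<^sub>C var j) * (f - ?s f)))"
    by (simp add: var_commute_numerator assms mult.assoc)
  finally show ?thesis
    by (simp only: sigma_term_eq to_frac_mult_Fract clinear_minus[OF clinear_Fract])
qed

text \<open>The numerator x_i + \<epsilon> x_j anticommutes with x_j only up to 2 \<epsilon> x_j^2,
  which causes the last fraction. That fraction need not lie in the algebra, but apart from its
  factor \<epsilon> it depends on \<epsilon>^2 only.\<close>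

lemma sigma_term_second:
  "sigma_term i j \<epsilon> (var j * f) = - (to_frac (var j) * sigma_term i j \<epsilon> f)
    + to_frac (inverse \<epsilon> *\<^sub>C skew_action (sigma_map i j \<epsilon>) f)
    + \<epsilon> *\<^sub>C Fract (2 *\<^sub>C (var j ^ 2 * f)) (var i ^ 2 - \<epsilon>\<^sup>2 *\<^sub>C var j ^ 2)"
proof -
  let ?s = "skew_action (sigma_map i j \<epsilon>)" and ?D = "var i ^ 2 - \<epsilon>\<^sup>2 *\<^sub>C var j ^ 2"
  let ?F = "var i + \<epsilon> *\<^sub>C var j"
  have nz: "\<epsilon> \<noteq> 0" using \<epsilon> by (rule C_nonzero)
  have ji: "var j * (var i * q) = - (var i * (var j * q))" for q :: "'n skew"
    using var_anticommute[OF ij] by (simp flip: mult.assoc)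
  \<comment> \<open>The terms in s f combine to \<epsilon>^{-1} (x_i + \<epsilon> x_j) x_i - x_j
    (x_i + \<epsilon> x_j) = \<epsilon>^{-1} D, so this part cancels the denominator.\<close>
  have "?F * (var j * f - ?s (var j * f)) + var j * (?F * (f - ?s f)) =
    ?D * (inverse \<epsilon> *\<^sub>C ?s f) + \<epsilon> *\<^sub>C 2 *\<^sub>C (var j ^ 2 * f)"
    using nz
    by (simp add: alg_hom_mult[OF sigma_hom] sigma_var power2_eq_square algebra_simps ji
        mult_scaleC_left mult_scaleC_right scaleC_scaleC scaleC_add_right cvec.scale_right_diff_distrib
        scaleC_one cvec.scale_minus_right cvec.scale_minus_left)
      (simp flip: scaleC_add_left add.assoc)
  then have "?F * (var j * f - ?s (var j * f)) = - (var j * (?F * (f - ?s f))) +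
    ?D * (inverse \<epsilon> *\<^sub>C ?s f) + \<epsilon> *\<^sub>C 2 *\<^sub>C (var j ^ 2 * f)"
    by (simp add: algebra_simps eq_diff_eq)
  then show ?thesis
    by (simp only: sigma_term_eq to_frac_mult_Fract Fract_add Fract_scale clinear_minus[OF clinear_Fract]
        Fract_cancel[OF central_regular_denominator[OF ij]])
qed

text \<open>Here the numerator commutes with x_i up to -2 \<epsilon> x_i x_j, with the same effect:
  the last fraction is odd in \<epsilon>.\<close>

lemma sigma_term_first:
  "sigma_term i j \<epsilon> (var i * f) = to_frac (var i) * sigma_term i j \<epsilon> f
    + to_frac (skew_action (sigma_map i j \<epsilon>) f)
    + \<epsilon> *\<^sub>C Fract (- 2 *\<^sub>C (var i * var j * f)) (var i ^ 2 - \<epsilon>\<^sup>2 *\<^sub>C var j ^ 2)"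
proof -
  let ?s = "skew_action (sigma_map i j \<epsilon>)" and ?D = "var i ^ 2 - \<epsilon>\<^sup>2 *\<^sub>C var j ^ 2"
  let ?F = "var i + \<epsilon> *\<^sub>C var j"
  have nz: "\<epsilon> \<noteq> 0" using \<epsilon> by (rule C_nonzero)
  have ji: "var j * (var i * q) = - (var i * (var j * q))" for q :: "'n skew"
    using var_anticommute[OF ij] by (simp flip: mult.assoc)
  have "?F * (var i * f - ?s (var i * f)) = var i * (?F * (f - ?s f)) +
    ?D * ?s f + \<epsilon> *\<^sub>C - 2 *\<^sub>C (var i * var j * f)"
    using nz
    by (simp add: alg_hom_mult[OF sigma_hom] sigma_var power2_eq_square algebra_simps ji
        mult_scaleC_left mult_scaleC_right scaleC_scaleC scaleC_add_right cvec.scale_right_diff_distrib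
        scaleC_one cvec.scale_minus_right cvec.scale_minus_left)
      (simp flip: scaleC_add_left add.assoc)
  then show ?thesis
    by (simp only: sigma_term_eq to_frac_mult_Fract Fract_add Fract_scale clinear_minus[OF clinear_Fract]
        Fract_cancel[OF central_regular_denominator[OF ij]])
qed

end

text \<open>This cancellation is where \<open>-1 \<in> C\<close> is needed: the denominators only depend on \<open>\<epsilon>\<^sup>2\<close>.\<close>

lemma sum_odd_eq_0:
  fixes h :: "complex \<Rightarrow> 'a::cvec"
  assumes "\<And>\<epsilon>. h (- \<epsilon>) = h \<epsilon>"
  shows "(\<Sum>\<epsilon>\<in>C. \<epsilon> *\<^sub>C h \<epsilon>) = 0"
proof -
  let ?S = "\<Sum>\<epsilon>\<in>C. \<epsilon> *\<^sub>C h \<epsilon>"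
  have "?S = (\<Sum>\<epsilon>\<in>C. (- \<epsilon>) *\<^sub>C h (- \<epsilon>))"
    by (rule sum.reindex_bij_witness[of _ uminus uminus]) (auto simp: C_minus)
  also have "\<dots> = - ?S" by (simp add: assms sum_negf cvec.scale_minus_left)
  finally have "?S + ?S = 0" by (simp add: eq_neg_iff_add_eq_0)
  then have "2 *\<^sub>C ?S = 0" using scaleC_add_left[of 1 1 ?S] by (simp add: scaleC_one)
  then show ?thesis by (simp add: cvec.scale_eq_0_iff)
qed

lemma sum_sigma_term_second:
  assumes "i \<noteq> j"
  shows "(\<Sum>\<epsilon>\<in>C. sigma_term i j \<epsilon> (var j * f)) = - (to_frac (var j) * (\<Sum>\<epsilon>\<in>C. sigma_term i j \<epsilon> f))
    + to_frac (\<Sum>\<epsilon>\<in>C. inverse \<epsilon> *\<^sub>C skew_action (sigma_map i j \<epsilon>) f)"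
proof -
  have "(\<Sum>\<epsilon>\<in>C. \<epsilon> *\<^sub>C Fract (2 *\<^sub>C (var j ^ 2 * f)) (var i ^ 2 - \<epsilon>\<^sup>2 *\<^sub>C var j ^ 2)) = 0"
    by (rule sum_odd_eq_0) simp
  then show ?thesis
    using assms by (simp add: sigma_term_second sum.distrib sum_subtractf sum_distrib_left clinear_sum[OF clinear_Fract])
qed

lemma sum_sigma_term_first:
  assumes "i \<noteq> j"
  shows "(\<Sum>\<epsilon>\<in>C. sigma_term i j \<epsilon> (var i * f)) = to_frac (var i) * (\<Sum>\<epsilon>\<in>C. sigma_term i j \<epsilon> f)
    + to_frac (\<Sum>\<epsilon>\<in>C. skew_action (sigma_map i j \<epsilon>) f)"
proof -
  have "(\<Sum>\<epsilon>\<in>C. \<epsilon> *\<^sub>C Fract (- 2 *\<^sub>C (var i * var j * f)) (var i ^ 2 - \<epsilon>\<^sup>2 *\<^sub>C var j ^ 2)) = 0"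
    by (rule sum_odd_eq_0) simp
  then show ?thesis
    using assms by (simp add: sigma_term_first sum.distrib sum_distrib_left clinear_sum[OF clinear_Fract])
qed

context
  fixes i :: "'n::{finite,linorder}" and \<epsilon> :: complex
  assumes \<epsilon>: "\<epsilon> \<in> C'"
begin

lemma t_hom: "alg_hom (skew_action (t_map i \<epsilon>))"
  by (rule alg_hom_skew_action[OF monomial_map_t]) (use \<epsilon> C'C in auto)

lemma t_var: "skew_action (t_map i \<epsilon>) (var k) = (if k = i then \<epsilon> else 1) *\<^sub>C var k"
  using skew_action_var[OF monomial_map_t, of \<epsilon> i k] \<epsilon> C'C by auto

lemma t_term_other:
  assumes "k \<noteq> i"
  shows "t_term i \<epsilon> (var k * f) = - (to_frac (var k) * t_term i \<epsilon> f)"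
proof -
  let ?s = "skew_action (t_map i \<epsilon>)"
  have "var i * (var k * f - ?s (var k * f)) = - (var k * (var i * (f - ?s f)))"
    using var_anticommute[of i k] assms
    by (simp add: alg_hom_mult[OF t_hom] t_var scaleC_one flip: right_diff_distrib mult.assoc)
  then show ?thesis
    by (simp only: t_term_eq to_frac_mult_Fract clinear_minus[OF clinear_Fract] mult_scaleC_right
       cvec.scale_minus_right)
qed

text \<open>Because t(x_i) = \<epsilon> x_i, the group term acquires the factor 1 - \<epsilon>,
  which the normalisation c / (1 - \<epsilon>) is made to cancel.\<close>

lemma t_term_same:
  assumes "\<epsilon> \<noteq> 1"
  shows "t_term i \<epsilon> (var i * f) = to_frac (var i) * t_term i \<epsilon> f + to_frac (c \<epsilon> *\<^sub>C skew_action (t_map i \<epsilon>) f)"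
proof -
  let ?s = "skew_action (t_map i \<epsilon>)"
  have "var i * (var i * f - ?s (var i * f)) = var i * (var i * (f - ?s f)) + var i ^ 2 * ((1 - \<epsilon>) *\<^sub>C ?s f)"
    by (simp add: alg_hom_mult[OF t_hom] t_var power2_eq_square algebra_simps mult_scaleC_left mult_scaleC_right
        cvec.scale_left_diff_distrib scaleC_one)
  moreover have "central_regular (var i ^ 2)" by (simp add: central_regular_var_power)
  moreover have "c \<epsilon> / (1 - \<epsilon>) * (1 - \<epsilon>) = c \<epsilon>" using assms by simp
  ultimately show ?thesis
    by (simp only: t_term_eq to_frac_mult_Fract Fract_add Fract_scale mult_scaleC_right
       scaleC_add_right Fract_cancel scaleC_scaleC)
qed

end

section \<open>The Dunkl operators and their commutation with the variables\<close>

lemma clinear_dunkl_frac: "clinear (dunkl_frac C C' c i)" for i :: "'n::{finite,linorder}"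
proof -
  have "clinear (sigma_term i j \<epsilon>)" if "i \<noteq> j" "\<epsilon> \<in> C" for j \<epsilon>
    unfolding sigma_term_eq[abs_def]
    by (intro clinear_compose[OF _ clinear_Fract] clinear_compose[OF _ clinear_mult_left] clinear_diff_fun
      clinear_ident alg_homD(1) sigma_hom that)
  moreover have "clinear (t_term i \<epsilon>)" if "\<epsilon> \<in> C'" for \<epsilon>
    unfolding t_term_eq[abs_def]
    by (intro clinear_scale_fun clinear_compose[OF _ clinear_Fract] clinear_compose[OF _ clinear_mult_left] clinear_diff_fun
      clinear_ident alg_homD(1) t_hom that)
  ultimately show ?thesis
    unfolding dunkl_frac_eq[abs_def]
    by (intro clinear_add_fun clinear_scale_fun clinear_sum_fun clinear_compose[OF clinear_braided_partial clinear_Fract]) auto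
qed

lemma dunkl_frac_one: "dunkl_frac C C' c i 1 = 0" for i :: "'n::{finite,linorder}"
proof -
  have "sigma_term i j \<epsilon> 1 = 0" if "i \<noteq> j" "\<epsilon> \<in> C" for j \<epsilon>
    by (simp add: sigma_term_def alg_hom_one[OF sigma_hom[OF that]] Fract_linear)
  moreover have "t_term i \<epsilon> 1 = 0" if "\<epsilon> \<in> C'" for \<epsilon>
    by (simp add: t_term_def alg_hom_one[OF t_hom[OF that]] Fract_linear cvec.scale_zero_right)
  ultimately show ?thesis
    by (simp add: dunkl_frac_eq Fract_linear cvec.scale_zero_right)
qed

lemma dunkl_frac_var_mult:
  fixes i k :: "'n::{finite,linorder}"
  assumes "k \<noteq> i"
  shows "dunkl_frac C C' c i (var k * f) = - (to_frac (var k) * dunkl_frac C C' c i f)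
    + to_frac (c 1 *\<^sub>C (\<Sum>\<epsilon>\<in>C. inverse \<epsilon> *\<^sub>C skew_action (sigma_map i k \<epsilon>) f))"
proof -
  \<comment> \<open>Only the summand j = k has an inhomogeneous part; it is split off before x_k is
    moved through the others.\<close>
  have "(\<Sum>j\<in>UNIV - {i}. \<Sum>\<epsilon>\<in>C. sigma_term i j \<epsilon> (var k * f)) =
     (\<Sum>\<epsilon>\<in>C. sigma_term i k \<epsilon> (var k * f)) + (\<Sum>j\<in>UNIV - {i} - {k}. \<Sum>\<epsilon>\<in>C. sigma_term i j \<epsilon> (var k * f))"
    by (rule sum.remove) (use assms in auto)
  also have "(\<Sum>j\<in>UNIV - {i} - {k}. \<Sum>\<epsilon>\<in>C. sigma_term i j \<epsilon> (var k * f)) =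
     - (to_frac (var k) * (\<Sum>j\<in>UNIV - {i} - {k}. \<Sum>\<epsilon>\<in>C. sigma_term i j \<epsilon> f))"
    unfolding sum_distrib_left sum_negf[symmetric]
    by (intro sum.cong refl sigma_term_other) (use assms in auto)
  also have "(\<Sum>\<epsilon>\<in>C. sigma_term i k \<epsilon> (var k * f)) + \<dots> =
     - (to_frac (var k) * ((\<Sum>\<epsilon>\<in>C. sigma_term i k \<epsilon> f) + (\<Sum>j\<in>UNIV - {i} - {k}. \<Sum>\<epsilon>\<in>C. sigma_term i j \<epsilon> f)))
     + to_frac (\<Sum>\<epsilon>\<in>C. inverse \<epsilon> *\<^sub>C skew_action (sigma_map i k \<epsilon>) f)"
    using assms by (simp add: sum_sigma_term_second distrib_left)
  also have "(\<Sum>\<epsilon>\<in>C. sigma_term i k \<epsilon> f) + (\<Sum>j\<in>UNIV - {i} - {k}. \<Sum>\<epsilon>\<in>C. sigma_term i j \<epsilon> f) =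
     (\<Sum>j\<in>UNIV - {i}. \<Sum>\<epsilon>\<in>C. sigma_term i j \<epsilon> f)"
    by (rule sum.remove[symmetric]) (use assms in auto)
  finally have s: "(\<Sum>j\<in>UNIV - {i}. \<Sum>\<epsilon>\<in>C. sigma_term i j \<epsilon> (var k * f)) =
     - (to_frac (var k) * (\<Sum>j\<in>UNIV - {i}. \<Sum>\<epsilon>\<in>C. sigma_term i j \<epsilon> f))
     + to_frac (\<Sum>\<epsilon>\<in>C. inverse \<epsilon> *\<^sub>C skew_action (sigma_map i k \<epsilon>) f)" .
  have t: "(\<Sum>\<epsilon>\<in>C' - {1}. t_term i \<epsilon> (var k * f)) = - (to_frac (var k) * (\<Sum>\<epsilon>\<in>C' - {1}. t_term i \<epsilon> f))"
    unfolding sum_distrib_left sum_negf[symmetric]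
    by (intro sum.cong refl t_term_other) (use assms in auto)
  show ?thesis
    unfolding dunkl_frac_eq s t
    by (simp add: braided_partial_var_mult assms Fract_linear Fract_mult_to_frac distrib_left mult_scaleC_right
      scaleC_add_right cvec.scale_minus_right cvec.scale_right_diff_distrib)
qed

lemma dunkl_frac_var_mult_same:
  fixes i :: "'n::{finite,linorder}"
  shows "dunkl_frac C C' c i (var i * f) = to_frac (var i) * dunkl_frac C C' c i f
    + to_frac (f + c 1 *\<^sub>C (\<Sum>j\<in>UNIV - {i}. \<Sum>\<epsilon>\<in>C. skew_action (sigma_map i j \<epsilon>) f)
       + (\<Sum>\<epsilon>\<in>C' - {1}. c \<epsilon> *\<^sub>C skew_action (t_map i \<epsilon>) f))"
proof -
  have s: "(\<Sum>j\<in>UNIV - {i}. \<Sum>\<epsilon>\<in>C. sigma_term i j \<epsilon> (var i * f)) =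
     to_frac (var i) * (\<Sum>j\<in>UNIV - {i}. \<Sum>\<epsilon>\<in>C. sigma_term i j \<epsilon> f)
     + to_frac (\<Sum>j\<in>UNIV - {i}. \<Sum>\<epsilon>\<in>C. skew_action (sigma_map i j \<epsilon>) f)"
    by (simp add: sum_sigma_term_first sum.distrib sum_distrib_left clinear_sum[OF clinear_Fract])
  have t: "(\<Sum>\<epsilon>\<in>C' - {1}. t_term i \<epsilon> (var i * f)) = to_frac (var i) * (\<Sum>\<epsilon>\<in>C' - {1}. t_term i \<epsilon> f)
     + to_frac (\<Sum>\<epsilon>\<in>C' - {1}. c \<epsilon> *\<^sub>C skew_action (t_map i \<epsilon>) f)"
    by (simp add: t_term_same sum.distrib sum_distrib_left clinear_sum[OF clinear_Fract])
  show ?thesis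
    unfolding dunkl_frac_eq s t
    by (simp add: braided_partial_var_mult_same Fract_linear Fract_mult_to_frac distrib_left mult_scaleC_right
      scaleC_add_right)
qed

text \<open>Individual summands may leave the algebra, so integrality is claimed only for the whole
  fraction; the recursions in \<open>f\<close> preserve it because their inhomogeneous parts lie in
  the algebra.\<close>

lemma to_frac_dunkl: "to_frac (dunkl C C' c i f) = dunkl_frac C C' c i f" for i :: "'n::{finite,linorder}"
proof -
  have "\<exists>g. to_frac g = dunkl_frac C C' c i f"
  proof (induction f rule: skew_induct)
    case one
    show ?case unfolding dunkl_frac_one by (rule exI[of _ 0]) (simp add: clinear_zero[OF clinear_Fract])
  next
    case (add p q)
    then obtain g h where gh: "dunkl_frac C C' c i p = to_frac g" "dunkl_frac C C' c i q = to_frac h" by metis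
    show ?case unfolding clinear_add[OF clinear_dunkl_frac] gh Fract_add[symmetric] by blast
  next
    case (scale k p)
    then obtain g where g: "dunkl_frac C C' c i p = to_frac g" by metis
    show ?case unfolding clinear_scale[OF clinear_dunkl_frac] g Fract_scale[symmetric] by blast
  next
    case (mult k p)
    then obtain g where g: "dunkl_frac C C' c i p = to_frac g" by metis
    show ?case
    proof (cases "k = i")
      case True
      show ?thesis unfolding True dunkl_frac_var_mult_same g Fract_mult_to_frac Fract_add[symmetric] by blast
    next
      case False
      show ?thesis unfolding dunkl_frac_var_mult[OF False] g Fract_mult_to_frac
          clinear_minus[OF clinear_Fract, symmetric] Fract_add[symmetric] by blast
    qed
  qed
  then obtain g where g: "to_frac g = dunkl_frac C C' c i f" by blast
  have "dunkl C C' c i f = g"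
    unfolding dunkl_def
  proof (rule the_equality)
    show "to_frac g = dunkl_frac C C' c i f" by (rule g)
  next
    fix h assume "to_frac h = dunkl_frac C C' c i f"
    then have "to_frac h = to_frac g" unfolding g .
    then show "h = g" by (rule to_frac_eq_iff[THEN iffD1])
  qed
  then show ?thesis using g by simp
qed

lemma clinear_dunkl: "clinear (dunkl C C' c i)" for i :: "'n::{finite,linorder}"
  unfolding clinear_iff
  by (intro conjI allI; rule to_frac_eq_iff[THEN iffD1])
    (simp_all add: to_frac_dunkl clinear_add[OF clinear_dunkl_frac] clinear_scale[OF clinear_dunkl_frac] Fract_add Fract_scale)

lemma app_op_y: "app_endo (op_y C C' c i) = dunkl C C' c i" for i :: "'n::{finite,linorder}"
  by (simp add: op_y_def app_endo_Endo clinear_dunkl)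

abbreviation "Y \<equiv> op_y C C' c"

lemma op_y_one: "app_endo (Y i) 1 = 0" for i :: "'n::{finite,linorder}"
  unfolding app_op_y
  by (rule to_frac_eq_iff[THEN iffD1]) (simp add: to_frac_dunkl dunkl_frac_one clinear_zero[OF clinear_Fract])

lemma app_op_y_var_mult:
  fixes i k :: "'n::{finite,linorder}"
  assumes "k \<noteq> i"
  shows "app_endo (Y i) (var k * f) = - (var k * app_endo (Y i) f)
    + c 1 *\<^sub>C (\<Sum>\<epsilon>\<in>C. inverse \<epsilon> *\<^sub>C skew_action (sigma_map i k \<epsilon>) f)"
  unfolding app_op_y
  by (rule to_frac_eq_iff[THEN iffD1])
    (simp only: to_frac_dunkl dunkl_frac_var_mult[OF assms] Fract_add clinear_minus[OF clinear_Fract]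
     to_frac_mult_Fract[symmetric])

lemma app_op_y_var_mult_same:
  fixes i :: "'n::{finite,linorder}"
  shows "app_endo (Y i) (var i * f) = var i * app_endo (Y i) f
    + (f + c 1 *\<^sub>C (\<Sum>j\<in>UNIV - {i}. \<Sum>\<epsilon>\<in>C. skew_action (sigma_map i j \<epsilon>) f)
       + (\<Sum>\<epsilon>\<in>C' - {1}. c \<epsilon> *\<^sub>C skew_action (t_map i \<epsilon>) f))"
  unfolding app_op_y
  by (rule to_frac_eq_iff[THEN iffD1])
    (simp only: to_frac_dunkl dunkl_frac_var_mult_same Fract_add to_frac_mult_Fract[symmetric])

text \<open>The anticommutator of y_j and x_i. The minus sign appears because the group elements are
  indexed as \<open>sigma_map i j\<close>, whereas the Dunkl operator y_j involves
  \<open>sigma_map j i\<close>.\<close>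

definition S_op :: "'n::{finite,linorder} \<Rightarrow> 'n \<Rightarrow> 'n skew endo" where
  "S_op j i = - (c 1 *\<^sub>C (\<Sum>\<epsilon>\<in>C. \<epsilon> *\<^sub>C op_w (sigma_map i j \<epsilon>)))"

definition T_op :: "'n::{finite,linorder} \<Rightarrow> 'n skew endo" where
  "T_op i = 1 + c 1 *\<^sub>C (\<Sum>j\<in>UNIV - {i}. \<Sum>\<epsilon>\<in>C. op_w (sigma_map i j \<epsilon>))
          + (\<Sum>\<epsilon>\<in>C' - {1}. c \<epsilon> *\<^sub>C op_w (t_map i \<epsilon>))"

lemma op_y_op_x: "i \<noteq> j \<Longrightarrow> Y j * op_x i + op_x i * Y j = S_op j i" for i j :: "'n::{finite,linorder}"
proof (rule endo_eqI)
  fix f assume ij: "i \<noteq> j"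
  \<comment> \<open>Replacing \<epsilon> by -1/\<epsilon> turns \<open>sigma_map j i\<close> into
    \<open>sigma_map i j\<close> and the weight 1/\<epsilon> into -\<epsilon>.\<close>
  have "(\<Sum>\<epsilon>\<in>C. inverse \<epsilon> *\<^sub>C skew_action (sigma_map j i \<epsilon>) f) = (\<Sum>\<epsilon>\<in>C. (- \<epsilon>) *\<^sub>C skew_action (sigma_map i j \<epsilon>) f)"
    by (rule sum.reindex_bij_witness[of _ "\<lambda>\<epsilon>. - inverse \<epsilon>" "\<lambda>\<epsilon>. - inverse \<epsilon>"])
      (auto simp: C_minus C_inverse C_nonzero sigma_map_swap[OF ij])
  then show "app_endo (Y j * op_x i + op_x i * Y j) f = app_endo (S_op j i) f"
    using ij by (simp add: app_endo_simps op_x_eq S_op_def app_endo_sum app_op_y_var_mult app_op_w_W sigma_in_W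
       cvec.scale_minus_left cvec.scale_minus_right sum_negf)
qed

lemma op_y_op_x_same: "Y i * op_x i - op_x i * Y i = T_op i" for i :: "'n::{finite,linorder}"
proof (rule endo_eqI)
  show "app_endo (Y i * op_x i - op_x i * Y i) f = app_endo (T_op i) f" for f
    by (simp add: app_endo_simps op_x_eq T_op_def app_endo_sum app_op_y_var_mult_same app_op_w_W sigma_in_W t_in_W)
qed

end

section \<open>The defining relations\<close>

text \<open>The kernel of \<open>A\<close> contains 1 and is stable under multiplication by every
  variable. \<open>B\<close> may change with \<open>k\<close>, so different signs for different
  variables are allowed.\<close>

lemma endo_skew_eq_0I:
  assumes one: "app_endo A 1 = 0" and var: "\<And>k. \<exists>B. A * op_x k = B * A"
  shows "A = 0"
proof (rule endo_eqI)
  fix f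
  show "app_endo A f = app_endo 0 f"
  proof (induction f rule: skew_induct)
    case (mult i p)
    obtain B where "A * op_x i = B * A" using var by blast
    then have "app_endo (A * op_x i) p = app_endo (B * A) p" by simp
    then show ?case using mult by (simp add: app_endo_simps op_x_eq app_endo_linear)
  qed (simp_all add: one app_endo_linear app_endo_simps cvec.scale_zero_right)
qed

context braided_data
begin

lemma op_w_op_x:
  assumes w: "monomial_map C w p l"
  shows "op_w w * op_x i = l i *\<^sub>C (op_x (p i) * op_w w)"
  unfolding op_x_eq op_w_mult_op[OF w] skew_action_var[OF w] alg_hom_scale[OF alg_hom_mult_op] mult_scaleC_left ..

text \<open>Conjugation multiplies the parameters by q = l_i / l_m; undoing this by a change of
  summation variable divides the weight \<epsilon> by q, which is the scalar in front.\<close>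

lemma conj_S_op:
  assumes w: "w \<in> W" "monomial_map C w p l" and "i \<noteq> m"
  shows "op_w w * S_op i m = (l m * inverse (l i)) *\<^sub>C (S_op (p i) (p m) * op_w w)"
proof -
  have l: "l k \<in> C" "l k \<noteq> 0" for k using w(2) C_nonzero by (auto simp: monomial_map_def)
  define q where "q = l i * inverse (l m)"
  have q: "q \<in> C" "q \<noteq> 0" "inverse q \<in> C" using l by (auto simp: q_def intro: C_mult C_inverse)
  have "(\<Sum>\<epsilon>\<in>C. \<epsilon> *\<^sub>C (op_w w * op_w (sigma_map m i \<epsilon>))) =
      (\<Sum>\<epsilon>\<in>C. \<epsilon> *\<^sub>C (op_w (sigma_map (p m) (p i) (\<epsilon> * q)) * op_w w))"
    using conj_sigma[OF w assms(3)[symmetric]] by (simp add: q_def mult.assoc)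
  also have "\<dots> = (\<Sum>\<epsilon>\<in>C. (\<epsilon> * inverse q) *\<^sub>C (op_w (sigma_map (p m) (p i) \<epsilon>) * op_w w))"
    by (rule sum.reindex_bij_witness[of _ "\<lambda>\<epsilon>. \<epsilon> * inverse q" "\<lambda>\<epsilon>. \<epsilon> * q"])
      (use q in \<open>auto simp: C_mult\<close>)
  finally have eq: "(\<Sum>\<epsilon>\<in>C. \<epsilon> *\<^sub>C (op_w w * op_w (sigma_map m i \<epsilon>))) =
      (\<Sum>\<epsilon>\<in>C. (\<epsilon> * inverse q) *\<^sub>C (op_w (sigma_map (p m) (p i) \<epsilon>) * op_w w))" .
  have "op_w w * S_op i m = - (c 1 *\<^sub>C (\<Sum>\<epsilon>\<in>C. \<epsilon> *\<^sub>C (op_w w * op_w (sigma_map m i \<epsilon>))))"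
    by (simp add: S_op_def sum_distrib_left mult_scaleC_left mult_scaleC_right)
  also have "\<dots> = inverse q *\<^sub>C (S_op (p i) (p m) * op_w w)"
    unfolding eq by (simp add: S_op_def sum_distrib_right mult_scaleC_left mult_scaleC_right cvec.scale_sum_right scaleC_scaleC
       mult_ac cvec.scale_minus_right)
  finally show ?thesis by (simp add: q_def mult.commute)
qed

text \<open>Here the sum over \<open>C\<close> carries no weight and the parameter of
  \<open>t_map\<close> is fixed by conjugation, so reindexing over \<open>C\<close> and over j
  leaves no scalar.\<close>

lemma conj_T_op:
  assumes w: "w \<in> W" "monomial_map C w p l"
  shows "op_w w * T_op i = T_op (p i) * op_w w"
proof -
  have l: "l k \<in> C" "l k \<noteq> 0" for k using w(2) C_nonzero by (auto simp: monomial_map_def)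
  have p: "p a = p b \<longleftrightarrow> a = b" for a b using monomial_map_bijD[OF w(2)] by (auto simp: bij_def inj_def)
  have "(\<Sum>\<epsilon>\<in>C. op_w w * op_w (sigma_map i j \<epsilon>)) = (\<Sum>\<epsilon>\<in>C. op_w (sigma_map (p i) (p j) \<epsilon>) * op_w w)"
    if "j \<noteq> i" for j
  proof -
    define q where "q = l j * inverse (l i)"
    have q: "q \<in> C" "q \<noteq> 0" "inverse q \<in> C" using l by (auto simp: q_def intro: C_mult C_inverse)
    have "(\<Sum>\<epsilon>\<in>C. op_w w * op_w (sigma_map i j \<epsilon>)) =
        (\<Sum>\<epsilon>\<in>C. op_w (sigma_map (p i) (p j) (\<epsilon> * q)) * op_w w)"
      using conj_sigma[OF w that[symmetric]] by (simp add: q_def mult.assoc)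
    also have "\<dots> = (\<Sum>\<epsilon>\<in>C. op_w (sigma_map (p i) (p j) \<epsilon>) * op_w w)"
      by (rule sum.reindex_bij_witness[of _ "\<lambda>\<epsilon>. \<epsilon> * inverse q" "\<lambda>\<epsilon>. \<epsilon> * q"])
        (use q in \<open>auto simp: C_mult\<close>)
    finally show ?thesis .
  qed
  then have "(\<Sum>j\<in>UNIV - {i}. \<Sum>\<epsilon>\<in>C. op_w w * op_w (sigma_map i j \<epsilon>)) =
      (\<Sum>j\<in>UNIV - {i}. \<Sum>\<epsilon>\<in>C. op_w (sigma_map (p i) (p j) \<epsilon>) * op_w w)"
    by (intro sum.cong[OF refl, of "UNIV - {i}"]) simp
  also have "\<dots> = (\<Sum>j\<in>UNIV - {p i}. \<Sum>\<epsilon>\<in>C. op_w (sigma_map (p i) j \<epsilon>) * op_w w)"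
    by (rule sum.reindex_bij_betw[of p])
      (use monomial_map_bijD[OF w(2)] in \<open>auto simp: bij_betw_def inj_on_def p bij_is_surj image_set_diff\<close>)
  finally have s: "(\<Sum>j\<in>UNIV - {i}. \<Sum>\<epsilon>\<in>C. op_w w * op_w (sigma_map i j \<epsilon>)) =
      (\<Sum>j\<in>UNIV - {p i}. \<Sum>\<epsilon>\<in>C. op_w (sigma_map (p i) j \<epsilon>) * op_w w)" .
  have t: "(\<Sum>\<epsilon>\<in>C' - {1}. c \<epsilon> *\<^sub>C (op_w w * op_w (t_map i \<epsilon>))) =
      (\<Sum>\<epsilon>\<in>C' - {1}. c \<epsilon> *\<^sub>C (op_w (t_map (p i) \<epsilon>) * op_w w))"
    by (intro sum.cong) (auto simp: conj_t[OF w])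
  show ?thesis
    by (simp add: T_op_def distrib_left distrib_right sum_distrib_left sum_distrib_right mult_scaleC_left mult_scaleC_right s t)
qed

lemma op_y_op_x_eq:
  "i \<noteq> j \<Longrightarrow> Y j * op_x i = S_op j i - op_x i * Y j" "Y i * op_x i = T_op i + op_x i * Y i"
  for i j :: "'n::{finite,linorder}"
  using op_y_op_x[of i j] op_y_op_x_same[of i] by (simp_all add: algebra_simps)

lemma op_w_op_y:
  fixes w :: "'n::{finite,linorder} lmap"
  assumes w: "w \<in> W" "monomial_map C w p l"
  shows "op_w w * Y i = inverse (l i) *\<^sub>C (Y (p i) * op_w w)"
proof -
  have l: "l k \<noteq> 0" for k using w(2) C_nonzero by (auto simp: monomial_map_def)
  have p: "p a = p b \<longleftrightarrow> a = b" for a b using monomial_map_bijD[OF w(2)] by (auto simp: bij_def inj_def)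
  define E where "E = op_w w * Y i - inverse (l i) *\<^sub>C (Y (p i) * op_w w)"
  have "E = 0"
  proof (rule endo_skew_eq_0I)
    show "app_endo E 1 = 0"
      using alg_hom_skew_action[OF w(2)]
      by (simp add: E_def app_endo_simps op_y_one app_op_w[OF w(2)] alg_hom_zero alg_hom_one cvec.scale_zero_right)
    show "\<exists>B. E * op_x m = B * E" for m
    proof (cases "m = i")
      case True
      have "E * op_x m = op_w w * (Y i * op_x i) - inverse (l i) *\<^sub>C (Y (p i) * (op_w w * op_x i))"
        by (simp add: E_def True left_diff_distrib mult_scaleC_left mult.assoc)
      also have "\<dots> = (op_w w * op_x i) * Y i - op_x (p i) * Y (p i) * op_w w"
        using l unfolding op_w_op_x[OF w(2)] op_y_op_x_eq distrib_left conj_T_op[OF w]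
        by (simp add: mult_scaleC_left mult_scaleC_right scaleC_scaleC scaleC_one mult.assoc[symmetric] op_y_op_x_eq distrib_right
            op_w_op_x[OF w(2)])
      also have "\<dots> = l i *\<^sub>C (op_x (p i) * E)"
        using l by (simp add: op_w_op_x[OF w(2)] E_def right_diff_distrib mult_scaleC_left mult_scaleC_right scaleC_scaleC scaleC_one mult.assoc
          cvec.scale_right_diff_distrib)
      finally have "E * op_x m = (l i *\<^sub>C op_x (p i)) * E" by (simp add: mult_scaleC_left)
      then show ?thesis ..
    next
      case False
      have "E * op_x m = op_w w * (Y i * op_x m) - inverse (l i) *\<^sub>C (Y (p i) * (op_w w * op_x m))"
        by (simp add: E_def left_diff_distrib mult_scaleC_left mult.assoc)
      also have "Y (p i) * (op_w w * op_x m) = l m *\<^sub>C ((Y (p i) * op_x (p m)) * op_w w)"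
        by (simp add: op_w_op_x[OF w(2)] mult_scaleC_left mult_scaleC_right mult.assoc)
      also have "op_w w * (Y i * op_x m) = op_w w * S_op i m - (op_w w * op_x m) * Y i"
        by (simp add: op_y_op_x_eq(1)[OF False] right_diff_distrib mult.assoc)
      also have "Y (p i) * op_x (p m) = S_op (p i) (p m) - op_x (p m) * Y (p i)"
        by (rule op_y_op_x_eq(1)) (use False p in simp)
      \<comment> \<open>The \<open>S_op\<close> terms cancel: the scalar l_m / l_i of
        \<open>conj_S_op\<close> is exactly the product of the scalars coming from x_m and from
        y_i.\<close>
      finally have "E * op_x m = - l m *\<^sub>C (op_x (p m) * E)"
        using l False by (simp add: conj_S_op[OF w] op_w_op_x[OF w(2)] E_def left_diff_distrib right_diff_distrib
          mult_scaleC_left mult_scaleC_right scaleC_scaleC mult.assoc cvec.scale_right_diff_distrib mult_ac(2) cvec.scale_minus_left)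
      then have "E * op_x m = (- l m *\<^sub>C op_x (p m)) * E" by (simp add: mult_scaleC_left)
      then show ?thesis ..
    qed
  qed
  then show ?thesis by (simp add: E_def)
qed

section \<open>Anticommutativity of the Dunkl operators\<close>

context
  fixes i j :: "'n::{finite,linorder}" assumes ij: "i \<noteq> j"
begin

lemma sigma_op_y:
  assumes "\<epsilon> \<in> C"
  shows "op_w (sigma_map i j \<epsilon>) * Y i = inverse \<epsilon> *\<^sub>C (Y j * op_w (sigma_map i j \<epsilon>))"
    "op_w (sigma_map i j \<epsilon>) * Y j = - \<epsilon> *\<^sub>C (Y i * op_w (sigma_map i j \<epsilon>))"
    "k \<noteq> i \<Longrightarrow> k \<noteq> j \<Longrightarrow> op_w (sigma_map i j \<epsilon>) * Y k = Y k * op_w (sigma_map i j \<epsilon>)"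
  using op_w_op_y[OF sigma_in_W[OF ij assms] monomial_map_sigma[OF ij assms]] ij C_nonzero[OF assms]
  by (simp_all add: sigma_coeff_def scaleC_one inverse_minus_eq)

lemma S_op_op_y:
  "S_op j i * Y i = - (c 1 *\<^sub>C (\<Sum>\<epsilon>\<in>C. Y j * op_w (sigma_map i j \<epsilon>)))"
  "k \<noteq> i \<Longrightarrow> k \<noteq> j \<Longrightarrow> S_op j i * Y k = Y k * S_op j i"
proof -
  show "S_op j i * Y i = - (c 1 *\<^sub>C (\<Sum>\<epsilon>\<in>C. Y j * op_w (sigma_map i j \<epsilon>)))"
    by (simp add: S_op_def sum_distrib_right mult_scaleC_left mult_scaleC_right sigma_op_y scaleC_scaleC C_nonzero scaleC_one)
  show "S_op j i * Y k = Y k * S_op j i" if "k \<noteq> i" "k \<noteq> j"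
    using that by (simp add: S_op_def sum_distrib_right sum_distrib_left mult_scaleC_left mult_scaleC_right sigma_op_y)
qed

end

text \<open>Among the group elements in \<open>T_op i\<close> only the \<open>sigma_map i j\<close>
  move y_j; all others commute with it.\<close>

lemma op_y_T_op:
  fixes i j :: "'n::{finite,linorder}"
  assumes ij: "i \<noteq> j"
  shows "Y j * T_op i - T_op i * Y j = c 1 *\<^sub>C (\<Sum>\<epsilon>\<in>C. Y j * op_w (sigma_map i j \<epsilon>) + \<epsilon> *\<^sub>C (Y i * op_w (sigma_map i j \<epsilon>)))"
proof -
  have t: "(\<Sum>\<epsilon>\<in>C' - {1}. c \<epsilon> *\<^sub>C (op_w (t_map i \<epsilon>) * Y j)) = (\<Sum>\<epsilon>\<in>C' - {1}. c \<epsilon> *\<^sub>C (Y j * op_w (t_map i \<epsilon>)))"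
  proof (intro sum.cong refl arg_cong2[of _ _ _ _ scaleC])
    fix \<epsilon> assume "\<epsilon> \<in> C' - {1}"
    then have "\<epsilon> \<in> C'" "\<epsilon> \<in> C" using C'C by auto
    from op_w_op_y[OF t_in_W[OF this(1)] monomial_map_t[OF this(2)], of i j] ij
    show "op_w (t_map i \<epsilon>) * Y j = Y j * op_w (t_map i \<epsilon>)" by (simp add: scaleC_one)
  qed
  have s: "(\<Sum>k\<in>UNIV - {i} - {j}. \<Sum>\<epsilon>\<in>C. op_w (sigma_map i k \<epsilon>) * Y j) = (\<Sum>k\<in>UNIV - {i} - {j}. \<Sum>\<epsilon>\<in>C. Y j * op_w (sigma_map i k \<epsilon>))"
    by (intro sum.cong refl sigma_op_y(3)) (use ij in auto)
  have r: "(\<Sum>k\<in>UNIV - {i}. f k) = f j + (\<Sum>k\<in>UNIV - {i} - {j}. f k)" for f :: "'n \<Rightarrow> 'n skew endo"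
    by (rule sum.remove) (use ij in auto)
  have "Y j * T_op i - T_op i * Y j = c 1 *\<^sub>C (\<Sum>\<epsilon>\<in>C. Y j * op_w (sigma_map i j \<epsilon>)) - c 1 *\<^sub>C (\<Sum>\<epsilon>\<in>C. op_w (sigma_map i j \<epsilon>) * Y j)"
    unfolding T_op_def distrib_left distrib_right mult_scaleC_left mult_scaleC_right sum_distrib_left sum_distrib_right r t s
    by (simp add: scaleC_add_right)
  also have "\<dots> = c 1 *\<^sub>C (\<Sum>\<epsilon>\<in>C. Y j * op_w (sigma_map i j \<epsilon>) + \<epsilon> *\<^sub>C (Y i * op_w (sigma_map i j \<epsilon>)))"
    by (simp add: sigma_op_y[OF ij] sum.distrib sum_negf scaleC_add_right cvec.scale_minus_left cvec.scale_minus_right)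
  finally show ?thesis .
qed

text \<open>Moving x_i to the left leaves [y_j, T_i] + y_i S + S y_i, where S is the anticommutator
  of y_j and x_i. Once all y are written to the left of the group elements, these terms
  cancel.\<close>

lemma op_y_op_y_op_x:
  fixes i j :: "'n::{finite,linorder}"
  assumes ij: "i \<noteq> j"
  shows "(Y i * Y j + Y j * Y i) * op_x i = - (op_x i * (Y i * Y j + Y j * Y i))"
proof -
  have "Y i * S_op j i = - (c 1 *\<^sub>C (\<Sum>\<epsilon>\<in>C. \<epsilon> *\<^sub>C (Y i * op_w (sigma_map i j \<epsilon>))))"
    by (simp add: S_op_def sum_distrib_left mult_scaleC_left mult_scaleC_right)
  then have cancel: "Y j * T_op i - T_op i * Y j + Y i * S_op j i + S_op j i * Y i = 0"
    by (simp add: op_y_T_op[OF ij] S_op_op_y[OF ij] sum.distrib scaleC_add_right)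
  have "Y i * Y j * op_x i = Y i * S_op j i - (T_op i + op_x i * Y i) * Y j"
    by (simp add: mult.assoc op_y_op_x_eq(1)[OF ij] right_diff_distrib flip: op_y_op_x_eq(2))
  moreover have "Y j * Y i * op_x i = Y j * T_op i + (S_op j i - op_x i * Y j) * Y i"
    by (simp add: mult.assoc op_y_op_x_eq(2) distrib_left flip: op_y_op_x_eq(1)[OF ij])
  ultimately have "(Y i * Y j + Y j * Y i) * op_x i = (Y j * T_op i - T_op i * Y j + Y i * S_op j i + S_op j i * Y i)
      - op_x i * (Y i * Y j + Y j * Y i)"
    by (simp add: algebra_simps)
  then show ?thesis by (simp add: cancel)
qed

lemma op_y_op_y_op_x_other:
  fixes i j k :: "'n::{finite,linorder}"
  assumes "k \<noteq> i" "k \<noteq> j"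
  shows "(Y i * Y j) * op_x k = Y i * S_op j k - S_op i k * Y j + op_x k * (Y i * Y j)"
  by (simp add: mult.assoc op_y_op_x_eq(1)[OF assms(2)] right_diff_distrib)
    (simp add: mult.assoc[symmetric] op_y_op_x_eq(1)[OF assms(1)] left_diff_distrib)

lemma op_y_anticommute:
  fixes i j :: "'n::{finite,linorder}"
  assumes ij: "i \<noteq> j" shows "Y i * Y j + Y j * Y i = 0"
proof (rule endo_skew_eq_0I)
  show "app_endo (Y i * Y j + Y j * Y i) 1 = 0"
    by (simp add: app_endo_simps op_y_one app_endo_linear)
  have "(Y i * Y j + Y j * Y i) * op_x k = op_x k * (Y i * Y j + Y j * Y i)" if k: "k \<noteq> i" "k \<noteq> j" for k
    using op_y_op_y_op_x_other[OF k] op_y_op_y_op_x_other[OF k(2,1)]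
      S_op_op_y(2)[OF k(2), of i] S_op_op_y(2)[OF k(1), of j] ij k
    by (simp add: distrib_left distrib_right)
  moreover have "(Y i * Y j + Y j * Y i) * op_x k = (- op_x k) * (Y i * Y j + Y j * Y i)" if "k = i \<or> k = j" for k
    using op_y_op_y_op_x[OF ij] op_y_op_y_op_x[OF ij[symmetric]] that by (auto simp: add.commute)
  ultimately show "\<exists>B. (Y i * Y j + Y j * Y i) * op_x k = B * (Y i * Y j + Y j * Y i)" for k by blast
qed

definition op_Y :: "'n::{finite,linorder} skew \<Rightarrow> 'n skew endo" where
  "op_Y = skew_lift Y"

lemma alg_hom_op_Y: "alg_hom op_Y"
  unfolding op_Y_def by (rule alg_hom_skew_lift) (rule op_y_anticommute)

lemma op_Y_var: "op_Y (var i) = Y i"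
  unfolding op_Y_def by (rule skew_lift_var) (rule op_y_anticommute)

end

section \<open>Linear independence of the group over the skew-commuting variables\<close>

text \<open>Dedekind's independence of characters for the free monoid of words, with vector-valued
  coefficients; the character of w is the multiplicative extension of \<open>\<kappa> w\<close> from
  letters to words.\<close>

lemma character_independence:
  fixes p :: "'w \<Rightarrow> 'a::cvec"
  assumes "finite T" "inj_on \<kappa> T"
    and "\<And>ws. (\<Sum>w\<in>T. prod_list (map (\<kappa> w) ws) *\<^sub>C p w) = 0"
  shows "\<forall>w\<in>T. p w = 0"
  using assms
proof (induction T arbitrary: p rule: finite_induct)
  case (insert v T)
  have "(\<kappa> w i - \<kappa> v i) *\<^sub>C p w = 0" if "w \<in> T" for w i
  proof -
    have "(\<Sum>w\<in>T. prod_list (map (\<kappa> w) ws) *\<^sub>C ((\<kappa> w i - \<kappa> v i) *\<^sub>C p w)) = 0" for ws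
    proof -
      \<comment> \<open>The relation for the longer word \<open>i # ws\<close> minus
        \<open>\<kappa> v i\<close> times the one for \<open>ws\<close> eliminates v.\<close>
      have "(\<Sum>w\<in>insert v T. prod_list (map (\<kappa> w) (i # ws)) *\<^sub>C p w)
        - \<kappa> v i *\<^sub>C (\<Sum>w\<in>insert v T. prod_list (map (\<kappa> w) ws) *\<^sub>C p w) = 0"
        by (simp only: insert.prems cvec.scale_zero_right diff_zero)
      then show ?thesis using insert.hyps
        by (simp add: cvec.scale_sum_right scaleC_scaleC sum_subtractf[symmetric] cvec.scale_left_diff_distrib
            right_diff_distrib scaleC_add_right mult_ac cvec.scale_right_diff_distrib)
    qed
    then show ?thesis using insert.IH[of "\<lambda>w. (\<kappa> w i - \<kappa> v i) *\<^sub>C p w"] insert.prems(1) that by auto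
  qed
  moreover have "\<exists>i. \<kappa> w i \<noteq> \<kappa> v i" if "w \<in> T" for w
    using insert.prems(1) insert.hyps that by (auto simp: inj_on_def fun_eq_iff)
  ultimately have 0: "p w = 0" if "w \<in> T" for w
    using that by (metis cvec.scale_eq_0_iff eq_iff_diff_eq_0)
  then show ?case using insert.prems(2)[of "[]"] insert.hyps by (auto simp: scaleC_one)
qed simp

lemma mult_prod_list_var_eq_0:
  "p * prod_list (map var ws) = 0 \<Longrightarrow> p = 0" for p :: "'n::{finite,linorder} skew"
  by (induction ws arbitrary: p) (auto dest: mult_var_eq_0 simp flip: mult.assoc)

context braided_data
begin

abbreviation "N \<equiv> 2 * card C"

lemma N_pos: "N > 0"
  using finC C_one by (auto simp: card_gt_0_iff)

text \<open>Multiplication by z permutes \<open>C\<close>, so the product of all elements of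
  \<open>C\<close> absorbs the factor z^|C|.\<close>

lemma C_power_N: "z \<in> C \<Longrightarrow> z ^ N = 1"
proof -
  assume z: "z \<in> C"
  have "(\<Prod>y\<in>C. y) = (\<Prod>y\<in>C. z * y)"
    by (rule prod.reindex_bij_witness[of _ "\<lambda>y. z * y" "\<lambda>y. inverse z * y"])
      (use z in \<open>auto simp: C_mult C_inverse C_nonzero\<close>)
  also have "\<dots> = z ^ card C * (\<Prod>y\<in>C. y)" by (simp add: prod.distrib)
  finally have "z ^ card C = 1" using C_nonzero finC by (auto simp: prod_zero_iff)
  then show ?thesis by (simp add: power_mult mult.commute[of 2])
qed

lemma skew_action_power:
  fixes w :: "'n::{finite,linorder} lmap"
  assumes w: "monomial_map C w p l"
  shows "skew_action w (var i ^ (N * r)) = var (p i) ^ (N * r)"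
proof -
  have "(z *\<^sub>C a) ^ m = z ^ m *\<^sub>C a ^ m" for z and a :: "'n skew" and m
    by (induction m) (simp_all add: scaleC_one mult_scaleC_left mult_scaleC_right scaleC_scaleC mult.commute)
  moreover have "l i ^ N = 1" using w by (intro C_power_N) (simp add: monomial_map_def)
  then have "l i ^ (N * r) = 1" by (simp only: power_mult[of "l i" N r] power_one)
  ultimately show ?thesis
    by (simp only: alg_hom_power[OF alg_hom_skew_action[OF w]] skew_action_var[OF w] scaleC_one)
qed

definition perm_of :: "'n::finite lmap \<Rightarrow> 'n \<Rightarrow> 'n" where
  "perm_of w = (SOME p. \<exists>l. monomial_map C w p l)"

definition scal_of :: "'n::finite lmap \<Rightarrow> 'n \<Rightarrow> complex" where
  "scal_of w = (SOME l. monomial_map C w (perm_of w) l)"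

lemma monomial_map_of:
  assumes "w \<in> W" shows "monomial_map C w (perm_of w) (scal_of w)"
proof -
  have "\<exists>l. monomial_map C w (perm_of w) l"
    unfolding perm_of_def by (rule someI_ex[of "\<lambda>p. \<exists>l. monomial_map C w p l"]) (rule W_monomial_map[OF assms])
  then show ?thesis unfolding scal_of_def by (rule someI_ex)
qed

lemma skew_action_var_W: "w \<in> W \<Longrightarrow> skew_action w (var i) = scal_of w i *\<^sub>C var (perm_of w i)"
  by (rule skew_action_var[OF monomial_map_of])

lemma alg_hom_W: "w \<in> W \<Longrightarrow> alg_hom (skew_action w)"
  by (rule alg_hom_skew_action[OF monomial_map_of])

lemma skew_action_word:
  assumes "w \<in> W"
  shows "skew_action w (prod_list (map var ws)) =
    prod_list (map (scal_of w) ws) *\<^sub>C prod_list (map var (map (perm_of w) ws))"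
  by (induction ws)
    (simp_all add: alg_hom_mult[OF alg_hom_W[OF assms]] alg_hom_one[OF alg_hom_W[OF assms]] scaleC_one
      skew_action_var_W[OF assms] mult_scaleC_left mult_scaleC_right scaleC_scaleC)

text \<open>Artin's argument: the central elements \<open>x\<^sub>i\<^sup>N\<close> separate the underlying permutations, and for equal
  permutations the scalars act on words as distinct characters.\<close>

lemma skew_action_independence:
  fixes T :: "'n::{finite,linorder} lmap set"
  assumes "finite T" "T \<subseteq> W" "\<And>z. (\<Sum>w\<in>T. p w * skew_action w z) = 0"
  shows "\<forall>w\<in>T. p w = 0"
  using assms
proof (induction T arbitrary: p rule: finite_psubset_induct)
  case (psubset T)
  show ?case
  proof (cases "\<exists>v\<in>T. \<exists>w\<in>T. perm_of v \<noteq> perm_of w")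
    case False
    show ?thesis
    proof (cases "T = {}")
      case False
      then obtain v where v: "v \<in> T" by auto
      define q where "q = perm_of v"
      have perm: "perm_of w = q" if "w \<in> T" for w
        using \<open>\<not> (\<exists>v\<in>T. \<exists>w\<in>T. perm_of v \<noteq> perm_of w)\<close> that v unfolding q_def by blast
      show ?thesis
      proof (rule character_independence[of T scal_of])
        show "inj_on scal_of T"
        proof (rule inj_onI)
          fix x y assume xy: "x \<in> T" "y \<in> T" "scal_of x = scal_of y"
          then have "x \<in> W" "y \<in> W" using psubset.prems(1) by auto
          then show "x = y"
            by (rule monomial_map_unique[OF monomial_map_of monomial_map_of]) (simp_all add: perm xy)
        qed
        fix ws
        have "(\<Sum>w\<in>T. prod_list (map (scal_of w) ws) *\<^sub>C p w) * prod_list (map var (map q ws)) =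
          (\<Sum>w\<in>T. p w * skew_action w (prod_list (map var ws)))"
          unfolding sum_distrib_right
        proof (rule sum.cong[OF refl])
          fix w assume w: "w \<in> T"
          then have "w \<in> W" using psubset.prems(1) by auto
          then show "prod_list (map (scal_of w) ws) *\<^sub>C p w * prod_list (map var (map q ws)) =
            p w * skew_action w (prod_list (map var ws))"
            by (simp only: skew_action_word perm[OF w] mult_scaleC_left mult_scaleC_right)
        qed
        then show "(\<Sum>w\<in>T. prod_list (map (scal_of w) ws) *\<^sub>C p w) = 0"
          unfolding psubset.prems(2) by (rule mult_prod_list_var_eq_0)
      qed (fact psubset.hyps)
    qed simp
  next
    case True
    then obtain v w i where vw: "v \<in> T" "w \<in> T" and i: "perm_of w i \<noteq> perm_of v i" by (auto simp: fun_eq_iff)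
    let ?f = "\<lambda>u. (var (perm_of u i) ^ N :: 'n skew)"
    \<comment> \<open>Replacing z by x_i^N z multiplies the summand of u by the central element
      \<open>?f u\<close>; subtracting \<open>?f v\<close> times the original relation eliminates
      v.\<close>
    have "(\<Sum>u\<in>T - {v}. (?f u - ?f v) * p u * skew_action u z) = 0" for z
    proof -
      have "(\<Sum>u\<in>T. ?f u * p u * skew_action u z) = (\<Sum>u\<in>T. p u * skew_action u (var i ^ N * z))"
      proof (rule sum.cong[OF refl])
        fix u assume "u \<in> T"
        then have u: "u \<in> W" using psubset.prems(1) by auto
        have "skew_action u (var i ^ N * z) = ?f u * skew_action u z"
          using skew_action_power[OF monomial_map_of[OF u], of i 1] by (simp add: alg_hom_mult[OF alg_hom_W[OF u]])
        then show "?f u * p u * skew_action u z = p u * skew_action u (var i ^ N * z)"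
          using var_even_power_central[of N "perm_of u i" "p u"] by (simp add: mult.assoc[symmetric])
      qed
      then have "(\<Sum>u\<in>T. ?f u * p u * skew_action u z) = 0"
        using psubset.prems(2) by simp
      moreover have "(\<Sum>u\<in>T. ?f v * p u * skew_action u z) = 0"
        using psubset.prems(2)[of z] by (simp add: mult.assoc flip: sum_distrib_left)
      ultimately have "(\<Sum>u\<in>T. (?f u - ?f v) * p u * skew_action u z) = 0"
        by (simp add: left_diff_distrib sum_subtractf)
      then show ?thesis using sum.remove[OF psubset.hyps vw(1), of "\<lambda>u. (?f u - ?f v) * p u * skew_action u z"] by simp
    qed
    then have "\<forall>u\<in>T - {v}. (?f u - ?f v) * p u = 0"
      using vw(1) psubset.prems(1) by (intro psubset.IH) auto
    then have "(?f w - ?f v) * p w = 0" using vw i by auto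
    \<comment> \<open>By the choice of i the two powers involve different variables, so their
      difference is regular.\<close>
    moreover have "central_regular (?f w - ?f v)"
      using central_regular_binomial[of N "perm_of w i" "perm_of v i" 1 "-1"] i N_pos
      by (simp add: scaleC_one cvec.scale_minus_left)
    ultimately have w0: "p w = 0" by (rule central_regular_cancel[rotated])
    \<comment> \<open>One vanishing coefficient is enough: without \<open>w\<close> the original
      relation runs over a smaller set.\<close>
    have "\<forall>u\<in>T - {w}. p u = 0"
    proof (rule psubset.IH)
      show "(\<Sum>u\<in>T - {w}. p u * skew_action u z) = 0" for z
        using psubset.prems(2)[of z] sum.remove[OF psubset.hyps vw(2), of "\<lambda>u. p u * skew_action u z"] w0 by simp
    qed (use vw psubset.prems(1) in auto)
    then show ?thesis using w0 by auto
  qed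
qed

subsection \<open>The subalgebra generated by the variables and the group\<close>

text \<open>The smash product of the skew polynomials with W, realised by operators: the part of
  order zero in the y_i.\<close>

definition xw_ops :: "'n::{finite,linorder} skew endo set" where
  "xw_ops = cspan {mult_op p * op_w w | p w. w \<in> W}"

lemma xw_ops_subspace: "cvec.subspace xw_ops"
  unfolding xw_ops_def by (rule cvec.subspace_span)

lemmas xw_ops_closed = cvec.subspace_0[OF xw_ops_subspace] cvec.subspace_add[OF xw_ops_subspace]
  cvec.subspace_scale[OF xw_ops_subspace] cvec.subspace_diff[OF xw_ops_subspace]
  cvec.subspace_neg[OF xw_ops_subspace] cvec.subspace_sum[OF xw_ops_subspace]

lemma xw_ops_base: "w \<in> W \<Longrightarrow> mult_op p * op_w w \<in> xw_ops"
  unfolding xw_ops_def by (rule cvec.span_base) auto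

lemma op_w_in_xw_ops: "w \<in> W \<Longrightarrow> op_w w \<in> xw_ops"
  using xw_ops_base[of w 1] by (simp add: alg_hom_one[OF alg_hom_mult_op])

lemma mult_op_in_xw_ops: "mult_op p \<in> xw_ops"
  using xw_ops_base[OF W_one, of p] by (simp add: op_w_id)

lemma clinear_xw_ops_subset:
  assumes u: "u \<in> xw_ops" and f: "clinear f" and V: "cvec.subspace V"
    and "\<And>p w. w \<in> W \<Longrightarrow> f (mult_op p * op_w w) \<in> V"
  shows "f u \<in> V"
  using u[unfolded xw_ops_def] by (rule clinear_span_subset[OF f _ V, rotated]) (use assms(4) in blast)

lemma xw_ops_mult:
  assumes "u \<in> xw_ops" "v \<in> xw_ops" shows "u * v \<in> xw_ops"
proof -
  have *: "mult_op p * op_w w * (mult_op q * op_w w') \<in> xw_ops" if "w \<in> W" "w' \<in> W" for p q w w'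
  proof -
    have "mult_op p * op_w w * (mult_op q * op_w w') = mult_op (p * skew_action w q) * op_w (w \<circ> w')"
      using op_w_mult_op[OF monomial_map_of[OF that(1)], of q] that
      by (simp add: op_w_comp alg_hom_mult[OF alg_hom_mult_op] mult.assoc) (simp flip: mult.assoc)
    then show ?thesis using that by (simp add: xw_ops_base W_mult)
  qed
  have "mult_op p * op_w w * v \<in> xw_ops" if "w \<in> W" for p w
    using assms(2) clinear_mult_left xw_ops_subspace by (rule clinear_xw_ops_subset) (rule *[OF that])
  then show ?thesis
    by (rule clinear_xw_ops_subset[OF assms(1) clinear_mult_right xw_ops_subspace])
qed

lemma xw_ops_normal_form:
  assumes "u \<in> xw_ops"
  shows "\<exists>T p. finite T \<and> T \<subseteq> W \<and> u = (\<Sum>w\<in>T. mult_op (p w) * op_w w)"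
  using assms unfolding xw_ops_def
proof (induction rule: cvec.span_induct_alt)
  case base
  then show ?case by (intro exI[of _ "{}"]) simp
next
  case (step k g h)
  then obtain q v T p where v: "g = mult_op q * op_w v" "v \<in> W"
    and T: "finite T" "T \<subseteq> W" "h = (\<Sum>w\<in>T. mult_op (p w) * op_w w)" by blast
  let ?p = "\<lambda>w. (if w \<in> T then p w else 0) + (if w = v then k *\<^sub>C q else 0)"
  note hom = alg_hom_add[OF alg_hom_mult_op] alg_hom_scale[OF alg_hom_mult_op] alg_hom_zero[OF alg_hom_mult_op]
  have "(\<Sum>w\<in>insert v T. mult_op (?p w) * op_w w) =
    (\<Sum>w\<in>insert v T. if w \<in> T then mult_op (p w) * op_w w else 0) +
    (\<Sum>w\<in>insert v T. if w = v then k *\<^sub>C (mult_op q * op_w w) else 0)"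
    unfolding sum.distrib[symmetric]
    by (rule sum.cong[OF refl]) (simp add: hom distrib_right mult_scaleC_left)
  also have "(\<Sum>w\<in>insert v T. if w \<in> T then mult_op (p w) * op_w w else 0) = h"
    unfolding T(3) by (rule sum.mono_neutral_cong_right) (use T in auto)
  also have "(\<Sum>w\<in>insert v T. if w = v then k *\<^sub>C (mult_op q * op_w w) else 0) = k *\<^sub>C g"
    using T by (simp add: v)
  finally have "k *\<^sub>C g + h = (\<Sum>w\<in>insert v T. mult_op (?p w) * op_w w)" by (simp add: add.commute)
  then show ?case using T v by (intro exI[of _ "insert v T"] exI[of _ ?p]) auto
qed

lemma xw_ops_independence:
  fixes T :: "'n::{finite,linorder} lmap set"
  assumes T: "finite T" "T \<subseteq> W" and 0: "(\<Sum>w\<in>T. mult_op (p w) * op_w w) = 0"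
  shows "\<forall>w\<in>T. p w = 0"
proof (rule skew_action_independence[OF T])
  fix z
  have "app_endo (\<Sum>w\<in>T. mult_op (p w) * op_w w) z = (\<Sum>w\<in>T. p w * skew_action w z)"
    unfolding app_endo_sum by (rule sum.cong[OF refl]) (use T in \<open>auto simp: app_endo_simps app_op_w_W\<close>)
  then show "(\<Sum>w\<in>T. p w * skew_action w z) = 0" by (simp add: 0 zero_endo.rep_eq)
qed

lemma central_regular_skew_action:
  fixes w :: "'n::{finite,linorder} lmap"
  assumes z: "central_regular z" and w: "w \<in> W"
  shows "central_regular (skew_action w z)"
  unfolding central_regular_def
proof (intro conjI allI impI)
  fix a
  let ?v = "inv\<^bsub>GL\<^esub> w"
  have wv: "skew_action w (skew_action ?v b) = b" "skew_action ?v (skew_action w b) = b" for b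
    using skew_action_comp[OF w W_inv[OF w]] skew_action_comp[OF W_inv[OF w] w]
    by (simp_all add: W_inv_comp[OF w] skew_action_id fun_eq_iff)
  note hom = alg_hom_W[OF w] alg_hom_W[OF W_inv[OF w]]
  show "skew_action w z * a = a * skew_action w z"
    using arg_cong[OF central_regularD[OF z, of "skew_action ?v a"], of "skew_action w"]
    by (simp add: alg_hom_mult[OF hom(1)] wv)
  assume "skew_action w z * a = 0"
  from arg_cong[OF this, of "skew_action ?v"] have "z * skew_action ?v a = 0"
    by (simp add: alg_hom_mult[OF hom(2)] alg_hom_zero[OF hom(2)] wv)
  then have "skew_action ?v a = 0" by (rule central_regular_cancel[OF z])
  from arg_cong[OF this, of "skew_action w"] show "a = 0" by (simp add: alg_hom_zero[OF hom(1)] wv)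
qed

text \<open>Right multiplication by z acts on the coefficient of w as multiplication by w(z), which
  is again central and regular.\<close>

lemma xw_ops_cancel_central_regular:
  assumes u: "u \<in> xw_ops" and z: "central_regular z" and 0: "u * mult_op z = 0"
  shows "u = 0"
proof -
  obtain T p where T: "finite T" "T \<subseteq> W" and u: "u = (\<Sum>w\<in>T. mult_op (p w) * op_w w)"
    using xw_ops_normal_form[OF u] by blast
  have "(\<Sum>w\<in>T. mult_op (p w * skew_action w z) * op_w w) = u * mult_op z"
    unfolding u sum_distrib_right
    by (rule sum.cong[OF refl]) (use T in \<open>auto simp: alg_hom_mult[OF alg_hom_mult_op] mult.assoc subset_iff
      op_w_mult_op[OF monomial_map_of]\<close>)
  then have "\<forall>w\<in>T. p w * skew_action w z = 0"
    using T by (intro xw_ops_independence) (simp_all add: 0)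
  then have "\<forall>w\<in>T. p w = 0"
    using central_regular_skew_action[OF z] T(2) by (metis central_regularD central_regular_cancel subsetD)
  then show ?thesis by (simp add: u alg_hom_zero[OF alg_hom_mult_op])
qed

subsection \<open>The filtration by the degree in the Dunkl operators\<close>

lemma S_op_in_xw_ops: "i \<noteq> j \<Longrightarrow> S_op j i \<in> xw_ops"
  unfolding S_op_def by (intro xw_ops_closed op_w_in_xw_ops sigma_in_W)

lemma T_op_in_xw_ops: "T_op i \<in> xw_ops"
  unfolding T_op_def
  using mult_op_in_xw_ops[of 1] by (intro xw_ops_closed op_w_in_xw_ops sigma_in_W t_in_W)
    (auto simp: alg_hom_one[OF alg_hom_mult_op])

text \<open>Only the shape matters for the filtration: at most one Dunkl operator remains, and it
  stands on the right. Hence \<open>p'\<close> is merely asserted to exist.\<close>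

lemma op_y_mult_op: "\<exists>p' a. a \<in> xw_ops \<and> Y k * mult_op p = mult_op p' * Y k + a"
proof (induction p rule: skew_induct)
  case one
  show ?case
    by (intro exI[of _ 1] exI[of _ 0]) (simp add: alg_hom_one[OF alg_hom_mult_op] xw_ops_closed)
next
  case (add p q)
  then obtain p' a q' b where "a \<in> xw_ops" "Y k * mult_op p = mult_op p' * Y k + a"
    "b \<in> xw_ops" "Y k * mult_op q = mult_op q' * Y k + b" by blast
  then show ?case
    by (intro exI[of _ "p' + q'"] exI[of _ "a + b"])
      (simp add: alg_hom_add[OF alg_hom_mult_op] xw_ops_closed distrib_left distrib_right)
next
  case (scale r p)
  then obtain p' a where "a \<in> xw_ops" "Y k * mult_op p = mult_op p' * Y k + a" by blast
  then show ?case
    by (intro exI[of _ "r *\<^sub>C p'"] exI[of _ "r *\<^sub>C a"])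
      (simp add: alg_hom_scale[OF alg_hom_mult_op] xw_ops_closed mult_scaleC_left mult_scaleC_right scaleC_add_right)
next
  case (mult i p)
  then obtain p' a where a: "a \<in> xw_ops" and eq: "Y k * mult_op p = mult_op p' * Y k + a" by blast
  note hom = alg_hom_mult[OF alg_hom_mult_op] alg_hom_minus[OF alg_hom_mult_op]
  show ?case
  proof (cases "i = k")
    case True
    have "Y k * mult_op (var i * p) = T_op k * mult_op p + op_x k * (Y k * mult_op p)"
      unfolding hom op_x_eq[symmetric] True mult.assoc[symmetric] op_y_op_x_eq(2) distrib_right ..
    also have "\<dots> = mult_op (var k * p') * Y k + (T_op k * mult_op p + op_x k * a)"
      unfolding eq by (simp add: hom op_x_eq distrib_left mult.assoc)
    finally show ?thesis
      using xw_ops_closed(2)[OF xw_ops_mult[OF T_op_in_xw_ops mult_op_in_xw_ops] xw_ops_mult[OF mult_op_in_xw_ops a]]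
      unfolding op_x_eq by blast
  next
    case False
    have "Y k * mult_op (var i * p) = S_op k i * mult_op p - op_x i * (Y k * mult_op p)"
      unfolding hom op_x_eq[symmetric] mult.assoc[symmetric] op_y_op_x_eq(1)[OF False] left_diff_distrib ..
    also have "\<dots> = mult_op (- (var i * p')) * Y k + (S_op k i * mult_op p - op_x i * a)"
      unfolding eq by (simp add: hom op_x_eq distrib_left mult.assoc)
    finally show ?thesis
      using xw_ops_closed(4)[OF xw_ops_mult[OF S_op_in_xw_ops[OF False] mult_op_in_xw_ops] xw_ops_mult[OF mult_op_in_xw_ops a]]
      unfolding op_x_eq by blast
  qed
qed

lemma op_y_op_w:
  assumes w: "w \<in> W" shows "\<exists>s i. Y k * op_w w = s *\<^sub>C (op_w w * Y i)"
proof -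
  obtain i where i: "perm_of w i = k"
    using monomial_map_bijD[OF monomial_map_of[OF w]] by (metis bij_pointE)
  have "scal_of w i \<noteq> 0" using monomial_map_of[OF w] C_nonzero by (auto simp: monomial_map_def)
  then have "Y k * op_w w = scal_of w i *\<^sub>C (op_w w * Y i)"
    by (simp add: op_w_op_y[OF w monomial_map_of[OF w]] i scaleC_scaleC scaleC_one)
  then show ?thesis by blast
qed

text \<open>The bound is strict: \<open>filt d\<close> consists of operators of order below d, so
  \<open>filt 0\<close> is zero. Words instead of ordered monomials avoid signs when a letter is
  prepended.\<close>

definition filt :: "nat \<Rightarrow> 'n::{finite,linorder} skew endo set" where
  "filt d = cspan {a * op_Y (prod_list (map var ws)) | a ws. a \<in> xw_ops \<and> length ws < d}"

lemma filt_subspace: "cvec.subspace (filt d)"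
  unfolding filt_def by (rule cvec.subspace_span)

lemmas filt_closed = cvec.subspace_0[OF filt_subspace] cvec.subspace_add[OF filt_subspace]
  cvec.subspace_scale[OF filt_subspace] cvec.subspace_diff[OF filt_subspace]
  cvec.subspace_neg[OF filt_subspace] cvec.subspace_sum[OF filt_subspace]

lemma filt_base: "a \<in> xw_ops \<Longrightarrow> length ws < d \<Longrightarrow> a * op_Y (prod_list (map var ws)) \<in> filt d"
  unfolding filt_def by (rule cvec.span_base) auto

lemma clinear_filt_subset:
  assumes u: "u \<in> filt d" and f: "clinear f" and V: "cvec.subspace V"
    and "\<And>a ws. a \<in> xw_ops \<Longrightarrow> length ws < d \<Longrightarrow> f (a * op_Y (prod_list (map var ws))) \<in> V"
  shows "f u \<in> V"
  using u[unfolded filt_def] by (rule clinear_span_subset[OF f _ V, rotated]) (use assms(4) in blast)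

lemma filt_mono: "d \<le> e \<Longrightarrow> filt d \<subseteq> filt e"
  unfolding filt_def by (rule cvec.span_mono) (auto intro: less_le_trans)

lemma xw_ops_mult_filt:
  assumes a: "a \<in> xw_ops" and u: "u \<in> filt d" shows "a * u \<in> filt d"
proof -
  show ?thesis
    using u clinear_mult_left filt_subspace
  proof (rule clinear_filt_subset)
    show "a * (b * op_Y (prod_list (map var ws))) \<in> filt d" if "b \<in> xw_ops" "length ws < d" for b ws
      using filt_base[OF xw_ops_mult[OF a that(1)] that(2)] by (simp add: mult.assoc)
  qed
qed

lemma op_y_mult_filt:
  assumes "u \<in> filt d" shows "Y k * u \<in> filt (Suc d)"
proof -
  have gen: "Y k * (mult_op p * op_w w * op_Y (prod_list (map var ws))) \<in> filt (Suc d)"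
    if w: "w \<in> W" and ws: "length ws < d" for p w ws
  proof -
    obtain p' a where a: "a \<in> xw_ops" and eq: "Y k * mult_op p = mult_op p' * Y k + a" using op_y_mult_op by blast
    obtain s i where i: "Y k * op_w w = s *\<^sub>C (op_w w * Y i)" using op_y_op_w[OF w] by blast
    have "Y k * (mult_op p * op_w w * op_Y (prod_list (map var ws))) =
      (Y k * mult_op p) * op_w w * op_Y (prod_list (map var ws))" by (simp add: mult.assoc)
    also have "\<dots> = mult_op p' * (Y k * op_w w) * op_Y (prod_list (map var ws)) + a * op_w w * op_Y (prod_list (map var ws))"
      unfolding eq by (simp add: distrib_right mult.assoc)
    also have "mult_op p' * (Y k * op_w w) * op_Y (prod_list (map var ws)) =
      s *\<^sub>C (mult_op p' * op_w w * op_Y (prod_list (map var (i # ws))))"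
      unfolding i by (simp add: alg_hom_mult[OF alg_hom_op_Y] op_Y_var mult_scaleC_left mult_scaleC_right mult.assoc)
    finally show ?thesis
      using filt_base[OF xw_ops_base[OF w, of p'], of "i # ws" "Suc d"]
        filt_base[OF xw_ops_mult[OF a op_w_in_xw_ops[OF w]], of ws "Suc d"] ws
      by (simp add: filt_closed)
  qed
  show ?thesis
    using assms clinear_mult_left filt_subspace
  proof (rule clinear_filt_subset)
    fix a :: "'a skew endo" and ws :: "'a list"
    assume a: "a \<in> xw_ops" and ws: "length ws < d"
    show "Y k * (a * op_Y (prod_list (map var ws))) \<in> filt (Suc d)"
      by (rule clinear_xw_ops_subset[OF a clinear_compose[OF clinear_mult_right clinear_mult_left] filt_subspace])
        (rule gen[OF _ ws])
  qed
qed

end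

section \<open>Linear independence of the ordered products\<close>

lemma word_eq_monomial:
  "\<exists>s b. prod_list (map var ws) = s *\<^sub>C monomial b \<and> sum b UNIV = length ws"
proof (induction ws)
  case Nil
  show ?case by (intro exI[of _ 1] exI[of _ "\<lambda>_. 0"]) (simp add: scaleC_one)
next
  case (Cons k ws)
  then obtain s b where b: "prod_list (map var ws) = s *\<^sub>C monomial b" "sum b UNIV = length ws" by blast
  define b' where "b' = b(k := Suc (b k))"
  have "sum b' UNIV = b' k + sum b' (UNIV - {k})" "sum b UNIV = b k + sum b (UNIV - {k})"
    by (rule sum.remove; simp)+
  moreover have "sum b' (UNIV - {k}) = sum b (UNIV - {k})" by (rule sum.cong) (auto simp: b'_def)
  ultimately have "sum b' UNIV = length (k # ws)" using b by (simp add: b'_def)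
  moreover have "prod_list (map var (k # ws)) = (s * monomial_sign b k) *\<^sub>C monomial b'"
    unfolding b'_def using b by (simp add: mult_scaleC_right var_mult_monomial scaleC_scaleC)
  ultimately show ?case by blast
qed

lemma monomial_eq_word:
  "\<exists>ws. monomial b = prod_list (map var ws) \<and> length ws = sum b UNIV" for b :: "'n::{finite,linorder} \<Rightarrow> nat"
proof -
  have rep: "prod_list (map var (replicate m i)) = var i ^ m" for m and i :: 'n
    by (induction m) simp_all
  have "prod_list (map (\<lambda>i. var i ^ b i) xs) = prod_list (map var (concat (map (\<lambda>i. replicate (b i) i) xs)))" for xs
  proof (induction xs)
    case (Cons x xs)
    then show ?case using rep[of "b x" x] by simp
  qed simp
  moreover have "length (concat (map (\<lambda>i. replicate (b i) i) (sorted_list_of_set UNIV))) = sum b UNIV"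
    by (simp add: length_concat o_def sum_list_distinct_conv_sum_set)
  ultimately show ?thesis unfolding monomial_def by blast
qed

text \<open>Writing \<open>Suc (length vs) = length ws\<close> rather than a truncated difference
  makes the span zero for the empty word.\<close>

lemma braided_partial_word:
  "braided_partial i (prod_list (map var ws)) \<in> cspan {prod_list (map var vs) | vs. Suc (length vs) = length ws}"
proof (induction ws)
  case Nil
  then show ?case by (simp add: cvec.span_zero)
next
  case (Cons k ws)
  let ?V = "cspan {prod_list (map var vs) | vs. Suc (length vs) = length (k # ws)} :: 'a skew set"
  have "var k * braided_partial i (prod_list (map var ws)) \<in> ?V"
    using Cons
  proof (rule clinear_span_subset[OF clinear_mult_left _ cvec.subspace_span, rotated])
    fix b :: "'a skew" assume "b \<in> {prod_list (map var vs) | vs. Suc (length vs) = length ws}"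
    then obtain vs where vs: "b = prod_list (map var vs)" "Suc (length vs) = length ws" by blast
    show "var k * b \<in> ?V"
      by (rule cvec.span_base) (use vs in \<open>auto intro!: exI[of _ "k # vs"]\<close>)
  qed
  moreover have "prod_list (map var ws) \<in> ?V" by (rule cvec.span_base) auto
  ultimately show ?case
    by (cases "k = i") (simp_all add: braided_partial_var_mult_same braided_partial_var_mult cvec.span_add cvec.span_neg)
qed

lemma braided_partial_power_other:
  "k \<noteq> i \<Longrightarrow> braided_partial i (var k ^ m * f) = (-1) ^ m *\<^sub>C (var k ^ m * braided_partial i f)"
  by (induction m) (simp_all add: mult.assoc braided_partial_var_mult scaleC_one mult_scaleC_right cvec.scale_minus_left)

lemma braided_partial_power_same:
  "braided_partial i (var i ^ m * f) = of_nat m *\<^sub>C (var i ^ (m - 1) * f) + var i ^ m * braided_partial i f"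
proof (induction m)
  case (Suc m)
  have "var i * (of_nat m *\<^sub>C (var i ^ (m - 1) * f)) = of_nat m *\<^sub>C (var i ^ m * f)"
    by (cases m) (simp_all add: mult_scaleC_right mult.assoc cvec.scale_zero_left)
  then show ?case
    by (simp add: mult.assoc braided_partial_var_mult_same Suc distrib_left scaleC_add_left scaleC_one)
qed (simp add: cvec.scale_zero_left)

section \<open>Commutators with central invariants\<close>

context braided_data
begin

lemma op_y_central_invariant:
  fixes g d :: "'n::{finite,linorder} skew"
  assumes central: "\<And>a. g * a = a * g" and inv: "\<And>w. w \<in> W \<Longrightarrow> skew_action w g = g"
    and partial: "\<And>f. braided_partial i (g * f) = d * f + g * braided_partial i f"
  shows "Y i * mult_op g = mult_op g * Y i + mult_op d"
proof (rule endo_eqI)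
  fix f
  have central': "a * (g * b) = g * (a * b)" for a b by (metis central mult.assoc)
  have s: "sigma_term i j \<epsilon> (g * f) = to_frac g * sigma_term i j \<epsilon> f" if "j \<noteq> i" "\<epsilon> \<in> C" for j \<epsilon>
    using sigma_in_W[of i j \<epsilon>] that
    by (simp add: sigma_term_eq to_frac_mult_Fract alg_hom_mult[OF alg_hom_W] inv central' flip: right_diff_distrib)
  have t: "t_term i \<epsilon> (g * f) = to_frac g * t_term i \<epsilon> f" if "\<epsilon> \<in> C'" for \<epsilon>
    using t_in_W[of \<epsilon> i] that
    by (simp add: t_term_eq to_frac_mult_Fract alg_hom_mult[OF alg_hom_W] inv central' mult_scaleC_right flip: right_diff_distrib)
  have "dunkl_frac C C' c i (g * f) = to_frac (d * f) + to_frac g * dunkl_frac C C' c i f"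
    by (simp add: dunkl_frac_eq s t partial distrib_left sum_distrib_left mult_scaleC_right Fract_add Fract_mult_to_frac
      cong: sum.cong_simp)
  then have "to_frac (dunkl C C' c i (g * f)) = to_frac (g * dunkl C C' c i f + d * f)"
    by (simp add: to_frac_dunkl Fract_add to_frac_mult_Fract[symmetric] add.commute)
  then have "dunkl C C' c i (g * f) = g * dunkl C C' c i f + d * f" by (rule to_frac_eq_iff[THEN iffD1])
  then show "app_endo (Y i * mult_op g) f = app_endo (mult_op g * Y i + mult_op d) f"
    by (simp add: app_endo_simps app_op_y)
qed

definition power_sum :: "nat \<Rightarrow> 'n::{finite,linorder} skew" where
  "power_sum r = (\<Sum>i\<in>UNIV. var i ^ (N * r))"

definition power_sum_deriv :: "nat \<Rightarrow> 'n::{finite,linorder} \<Rightarrow> 'n skew" where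
  "power_sum_deriv r i = of_nat (N * r) *\<^sub>C var i ^ (N * r - 1)"

lemma power_sum_central: "power_sum r * a = a * power_sum r"
  by (simp add: power_sum_def sum_distrib_left sum_distrib_right var_even_power_central)

lemma power_sum_invariant:
  fixes w :: "'n::{finite,linorder} lmap"
  assumes w: "w \<in> W" shows "skew_action w (power_sum r) = power_sum r"
proof -
  have "skew_action w (power_sum r) = (\<Sum>i\<in>UNIV. var (perm_of w i) ^ (N * r))"
    unfolding power_sum_def alg_hom_sum[OF alg_hom_W[OF w]] skew_action_power[OF monomial_map_of[OF w]] ..
  also have "\<dots> = power_sum r" unfolding power_sum_def
    by (rule sum.reindex_bij_betw[OF monomial_map_bijD[OF monomial_map_of[OF w]]])
  finally show ?thesis .
qed

lemma op_y_power_sum: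
  "Y i * mult_op (power_sum r) = mult_op (power_sum r) * Y i + mult_op (power_sum_deriv r i)"
proof (rule op_y_central_invariant[OF power_sum_central power_sum_invariant])
  fix f
  have r: "(\<Sum>j\<in>UNIV. h j) = h i + (\<Sum>j\<in>UNIV - {i}. h j)" for h :: "'a \<Rightarrow> 'a skew"
    by (rule sum.remove) auto
  \<comment> \<open>N r is even, so the sign in \<open>braided_partial_power_other\<close> is
    1.\<close>
  have other: "braided_partial i (var j ^ (N * r) * f) = var j ^ (N * r) * braided_partial i f" if "j \<noteq> i" for j
    unfolding braided_partial_power_other[OF that] by (simp add: scaleC_one)
  have "braided_partial i (power_sum r * f) = (\<Sum>j\<in>UNIV. braided_partial i (var j ^ (N * r) * f))"
    unfolding power_sum_def sum_distrib_right clinear_sum[OF clinear_braided_partial] ..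
  also have "\<dots> = braided_partial i (var i ^ (N * r) * f) + (\<Sum>j\<in>UNIV - {i}. braided_partial i (var j ^ (N * r) * f))"
    by (rule r)
  also have "(\<Sum>j\<in>UNIV - {i}. braided_partial i (var j ^ (N * r) * f)) = (\<Sum>j\<in>UNIV - {i}. var j ^ (N * r) * braided_partial i f)"
    by (rule sum.cong[OF refl], rule other) simp
  also have "braided_partial i (var i ^ (N * r) * f) + \<dots> = power_sum_deriv r i * f +
      (var i ^ (N * r) * braided_partial i f + (\<Sum>j\<in>UNIV - {i}. var j ^ (N * r) * braided_partial i f))"
    unfolding braided_partial_power_same power_sum_deriv_def mult_scaleC_left add.assoc ..
  also have "var i ^ (N * r) * braided_partial i f + (\<Sum>j\<in>UNIV - {i}. var j ^ (N * r) * braided_partial i f) =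
      (\<Sum>j\<in>UNIV. var j ^ (N * r) * braided_partial i f)"
    by (rule r[symmetric])
  also have "\<dots> = power_sum r * braided_partial i f"
    unfolding power_sum_def sum_distrib_right ..
  finally show "braided_partial i (power_sum r * f) = power_sum_deriv r i * f + power_sum r * braided_partial i f" .
qed

lemma xw_ops_commute_power_sum:
  assumes "u \<in> xw_ops" shows "u * mult_op (power_sum r) = mult_op (power_sum r) * u"
proof -
  have "clinear (\<lambda>u. u * mult_op (power_sum r) - mult_op (power_sum r) * u)"
    by (intro clinear_diff_fun clinear_mult_left clinear_mult_right)
  then have "u * mult_op (power_sum r) - mult_op (power_sum r) * u \<in> {0}"
  proof (rule clinear_xw_ops_subset[OF assms _ cvec.subspace_single_0])
    fix p :: "'a skew" and w :: "'a lmap" assume w: "w \<in> W"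
    have "mult_op p * op_w w * mult_op (power_sum r) = mult_op (p * power_sum r) * op_w w"
      by (simp add: mult.assoc op_w_mult_op[OF monomial_map_of[OF w]] power_sum_invariant[OF w]
        alg_hom_mult[OF alg_hom_mult_op])
    also have "\<dots> = mult_op (power_sum r) * (mult_op p * op_w w)"
      by (simp add: alg_hom_mult[OF alg_hom_mult_op] mult.assoc flip: power_sum_central)
    finally show "mult_op p * op_w w * mult_op (power_sum r) - mult_op (power_sum r) * (mult_op p * op_w w) \<in> {0}"
      by simp
  qed
  then show ?thesis by simp
qed

lemma op_y_var_power:
  "\<exists>a\<in>xw_ops. Y k * mult_op (var i ^ m) = (if i = k then 1 else (-1) ^ m) *\<^sub>C (mult_op (var i ^ m) * Y k) + a"
proof (induction m)
  case 0
  show ?case by (intro bexI[of _ 0]) (simp_all add: alg_hom_one[OF alg_hom_mult_op] scaleC_one xw_ops_closed)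
next
  case (Suc m)
  then obtain a where a: "a \<in> xw_ops"
    and eq: "Y k * mult_op (var i ^ m) = (if i = k then 1 else (-1) ^ m) *\<^sub>C (mult_op (var i ^ m) * Y k) + a" by blast
  have hom: "mult_op (var i ^ Suc m) = op_x i * mult_op (var i ^ m)"
    by (simp add: op_x_eq alg_hom_mult[OF alg_hom_mult_op])
  show ?case
  proof (cases "i = k")
    case True
    have "Y k * mult_op (var i ^ Suc m) = T_op k * mult_op (var i ^ m) + op_x k * (Y k * mult_op (var i ^ m))"
      unfolding True hom[unfolded True] mult.assoc[symmetric] op_y_op_x_eq(2) distrib_right ..
    then show ?thesis unfolding eq
      using xw_ops_closed(2)[OF xw_ops_mult[OF T_op_in_xw_ops mult_op_in_xw_ops] xw_ops_mult[OF mult_op_in_xw_ops a]]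
      by (intro bexI[of _ "T_op k * mult_op (var i ^ m) + op_x k * a"])
        (simp_all add: True hom[unfolded True] distrib_left scaleC_one mult.assoc op_x_eq alg_hom_mult[OF alg_hom_mult_op])
  next
    case False
    have "Y k * mult_op (var i ^ Suc m) = S_op k i * mult_op (var i ^ m) - op_x i * (Y k * mult_op (var i ^ m))"
      unfolding hom mult.assoc[symmetric] op_y_op_x_eq(1)[OF False] left_diff_distrib ..
    then show ?thesis unfolding eq
      using xw_ops_closed(4)[OF xw_ops_mult[OF S_op_in_xw_ops[OF False] mult_op_in_xw_ops] xw_ops_mult[OF mult_op_in_xw_ops a]]
      by (intro bexI[of _ "S_op k i * mult_op (var i ^ m) - op_x i * a"])
        (simp_all add: False hom distrib_left mult.assoc op_x_eq alg_hom_mult[OF alg_hom_mult_op] mult_scaleC_right cvec.scale_minus_left)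
  qed
qed

text \<open>Since N r is even and positive, the exponent N r - 1 is odd, and this power of x_i
  passes y_k with the same sign as x_i itself.\<close>

lemma op_y_power_sum_deriv:
  assumes "r > 0"
  shows "\<exists>a\<in>xw_ops. Y k * mult_op (power_sum_deriv r i) =
    (if i = k then 1 else -1) *\<^sub>C (mult_op (power_sum_deriv r i) * Y k) + a"
proof -
  have "odd (N * r - 1)" using assms N_pos by simp
  then obtain a where "a \<in> xw_ops" "Y k * mult_op (var i ^ (N * r - 1)) =
      (if i = k then 1 else -1) *\<^sub>C (mult_op (var i ^ (N * r - 1)) * Y k) + a"
    using op_y_var_power[of k i "N * r - 1"] by (auto simp: uminus_power_if)
  then show ?thesis
    by (intro bexI[of _ "of_nat (N * r) *\<^sub>C a"])
      (simp_all only: power_sum_deriv_def alg_hom_scale[OF alg_hom_mult_op] mult_scaleC_left mult_scaleC_right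
         scaleC_add_right scaleC_scaleC mult.commute xw_ops_closed)
qed

lemma filt_0: "u \<in> filt 0 \<Longrightarrow> u = 0"
  by (simp add: filt_def)

lemma xw_ops_op_Y_span:
  assumes "a \<in> xw_ops" "q \<in> cspan {prod_list (map var vs) | vs. Suc (length vs) = d}"
  shows "a * op_Y q \<in> filt d"
  using assms(2)
  by (rule clinear_span_subset[of "\<lambda>q. a * op_Y q", rotated 3])
    (auto intro!: clinear_compose[OF alg_homD(1)[OF alg_hom_op_Y] clinear_mult_left] filt_subspace filt_base assms(1))

text \<open>Modulo lower order, the commutator with a power sum is a derivation, so that it acts on the
  symbols in the Dunkl operators by the braided partial derivatives.\<close>

lemma op_Y_commutator_power_sum:
  assumes "r > 0"
  shows "op_Y (prod_list (map var ws)) * mult_op (power_sum r) - mult_op (power_sum r) * op_Y (prod_list (map var ws))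
    - (\<Sum>i\<in>UNIV. mult_op (power_sum_deriv r i) * op_Y (braided_partial i (prod_list (map var ws)))) \<in> filt (length ws - 1)"
proof (induction ws)
  case Nil
  show ?case by (simp add: alg_hom_one[OF alg_hom_op_Y] alg_hom_zero[OF alg_hom_op_Y] filt_closed)
next
  case (Cons k ws)
  define q where "q = prod_list (map var ws)"
  let ?G = "mult_op (power_sum r)" and ?D = "\<lambda>i. mult_op (power_sum_deriv r i)"
  note Y = alg_hom_op_Y
  define e where "e = op_Y q * ?G - ?G * op_Y q - (\<Sum>i\<in>UNIV. ?D i * op_Y (braided_partial i q))"
  have e: "e \<in> filt (length ws - 1)" using Cons by (simp add: e_def q_def)
  obtain a where a: "\<And>i. a i \<in> xw_ops"
    and YD: "\<And>i. Y k * ?D i = (if i = k then 1 else -1) *\<^sub>C (?D i * Y k) + a i"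
    using op_y_power_sum_deriv[OF assms, of k] by metis
  \<comment> \<open>The sign with which y_k passes the derivative of the power sum equals the sign
    in the product rule of \<open>braided_partial\<close>; the extra summand for i = k supplies the
    inhomogeneous term of that rule and comes from the commutator of y_k with the power sum.\<close>
  have step: "Y k * (?D i * op_Y (braided_partial i q)) + (if i = k then ?D i * op_Y q else 0)
      = ?D i * op_Y (braided_partial i (var k * q)) + a i * op_Y (braided_partial i q)" for i
  proof (cases "i = k")
    case True
    then show ?thesis
      by (simp add: YD mult.assoc[symmetric] scaleC_one distrib_right braided_partial_var_mult_same alg_hom_add[OF Y]
          alg_hom_mult[OF Y] op_Y_var distrib_left)
  next
    case False
    then show ?thesis
      by (simp add: YD mult.assoc[symmetric] distrib_right braided_partial_var_mult alg_hom_minus[OF Y]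
          alg_hom_mult[OF Y] op_Y_var cvec.scale_minus_left scaleC_one left_diff_distrib)
  qed
  have qG: "op_Y q * ?G = ?G * op_Y q + (\<Sum>i\<in>UNIV. ?D i * op_Y (braided_partial i q)) + e"
    by (simp add: e_def)
  have "Y k * op_Y q * ?G = Y k * (op_Y q * ?G)" by (simp add: mult.assoc)
  also have "\<dots> = (Y k * ?G) * op_Y q + (\<Sum>i\<in>UNIV. Y k * (?D i * op_Y (braided_partial i q))) + Y k * e"
    by (simp add: qG distrib_left sum_distrib_left mult.assoc)
  also have "(Y k * ?G) * op_Y q = ?G * (Y k * op_Y q) + (\<Sum>i\<in>UNIV. if i = k then ?D i * op_Y q else 0)"
    by (simp add: op_y_power_sum distrib_right mult.assoc)
  finally have "Y k * op_Y q * ?G - ?G * (Y k * op_Y q) = Y k * e +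
      (\<Sum>i\<in>UNIV. Y k * (?D i * op_Y (braided_partial i q)) + (if i = k then ?D i * op_Y q else 0))"
    by (simp add: sum.distrib algebra_simps)
  also have "\<dots> = Y k * e + (\<Sum>i\<in>UNIV. ?D i * op_Y (braided_partial i (var k * q)))
      + (\<Sum>i\<in>UNIV. a i * op_Y (braided_partial i q))"
    unfolding step by (simp add: sum.distrib add.assoc)
  finally have eq: "op_Y (var k * q) * ?G - ?G * op_Y (var k * q)
      - (\<Sum>i\<in>UNIV. ?D i * op_Y (braided_partial i (var k * q)))
      = Y k * e + (\<Sum>i\<in>UNIV. a i * op_Y (braided_partial i q))"
    by (simp add: alg_hom_mult[OF Y] op_Y_var)
  \<comment> \<open>For empty \<open>ws\<close> the truncated \<open>length ws - 1\<close> is 0, and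
    \<open>op_y_mult_filt\<close> alone would only give \<open>filt 1\<close>; in that case
    \<open>e\<close> vanishes.\<close>
  have "Y k * e \<in> filt (length ws)"
  proof (cases ws)
    case Nil
    then have "e = 0" using e by (simp add: filt_0)
    then show ?thesis by (simp add: filt_closed)
  next
    case (Cons j vs)
    then show ?thesis using op_y_mult_filt[OF e, of k] by simp
  qed
  moreover have "a i * op_Y (braided_partial i q) \<in> filt (length ws)" for i
    using xw_ops_op_Y_span[OF a braided_partial_word] by (simp add: q_def)
  ultimately have "Y k * e + (\<Sum>i\<in>UNIV. a i * op_Y (braided_partial i q)) \<in> filt (length ws)"
    by (intro filt_closed)
  then show ?case using eq by (simp add: q_def)
qed

definition exps_below :: "nat \<Rightarrow> ('n::finite \<Rightarrow> nat) set" where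
  "exps_below n = {b. sum b UNIV < n}"

lemma finite_exps_below: "finite (exps_below n :: ('n::finite \<Rightarrow> nat) set)"
proof (rule finite_subset)
  show "exps_below n \<subseteq> (UNIV \<rightarrow>\<^sub>E {..<n} :: ('n \<Rightarrow> nat) set)"
  proof
    fix b :: "'n \<Rightarrow> nat" assume "b \<in> exps_below n"
    moreover have "b i \<le> sum b UNIV" for i by (rule member_le_sum) auto
    ultimately show "b \<in> UNIV \<rightarrow>\<^sub>E {..<n}" by (auto simp: exps_below_def intro: le_less_trans)
  qed
  show "finite (UNIV \<rightarrow>\<^sub>E {..<n} :: ('n \<Rightarrow> nat) set)" by (rule finite_PiE) auto
qed

text \<open>The vanishing of the coefficients outside \<open>exps_below d\<close> is recorded so
  that sums may be extended to larger ranges and top coefficients can be read off as 0.\<close>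

lemma filt_normal_form:
  assumes "u \<in> filt d"
  shows "\<exists>q. (\<forall>b. q b \<in> xw_ops) \<and> (\<forall>b. b \<notin> exps_below d \<longrightarrow> q b = 0) \<and>
    u = (\<Sum>b\<in>exps_below d. q b * op_Y (monomial b))"
  using assms unfolding filt_def
proof (induction rule: cvec.span_induct_alt)
  case base
  show ?case by (rule exI[of _ "\<lambda>_. 0"]) (simp add: xw_ops_closed)
next
  case (step k g h)
  obtain a ws where g: "g = a * op_Y (prod_list (map var ws))" and a: "a \<in> xw_ops" and ws: "length ws < d"
    using step(1) by blast
  obtain q where q: "\<forall>b. q b \<in> xw_ops" "\<forall>b. b \<notin> exps_below d \<longrightarrow> q b = 0"
    "h = (\<Sum>b\<in>exps_below d. q b * op_Y (monomial b))" using step(2) by blast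
  obtain s b where b: "prod_list (map var ws) = s *\<^sub>C monomial b" "sum b UNIV = length ws"
    using word_eq_monomial by blast
  have bd: "b \<in> exps_below d" using b ws by (simp add: exps_below_def)
  let ?q = "\<lambda>x. (if x = b then (k * s) *\<^sub>C a else 0) + q x"
  have "(\<Sum>x\<in>exps_below d. ?q x * op_Y (monomial x)) =
      (\<Sum>x\<in>exps_below d. if x = b then (k * s) *\<^sub>C a * op_Y (monomial b) else 0) + h"
    unfolding q(3) sum.distrib[symmetric] by (rule sum.cong[OF refl]) (simp add: distrib_right)
  also have "\<dots> = k *\<^sub>C g + h"
    using bd by (simp add: finite_exps_below g b alg_hom_scale[OF alg_hom_op_Y] mult_scaleC_left mult_scaleC_right scaleC_scaleC)
  finally have "k *\<^sub>C g + h = (\<Sum>x\<in>exps_below d. ?q x * op_Y (monomial x))" ..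
  moreover have "?q x \<in> xw_ops" for x using q(1) a by (simp add: xw_ops_closed)
  moreover have "\<forall>x. x \<notin> exps_below d \<longrightarrow> ?q x = 0" using q(2) bd by auto
  ultimately show ?case by (intro exI[of _ ?q]) blast
qed

text \<open>Multiplying by \<open>x\<^sub>i\<^sup>N - x\<^sub>j\<^sup>N\<close> for \<open>j \<noteq> i\<^sub>0\<close>, as in Lagrange interpolation, isolates the coefficient of index \<open>i\<^sub>0\<close>.\<close>

lemma xw_ops_vandermonde:
  fixes u :: "'n::{finite,linorder} \<Rightarrow> 'n skew endo"
  assumes u: "\<And>i. u i \<in> xw_ops"
    and 0: "\<And>r. (\<Sum>i\<in>UNIV. u i * mult_op (var i ^ (N - 1) * var i ^ (N * r))) = 0"
  shows "u k = 0"
proof -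
  have "\<exists>h. (\<forall>i\<in>J. h i = 0) \<and> central_regular (h k) \<and>
      (\<forall>r. (\<Sum>i\<in>UNIV. u i * mult_op (var i ^ (N - 1) * var i ^ (N * r) * h i)) = 0)"
    if "finite J" "k \<notin> J" for J
    using that
  proof (induction J rule: finite_induct)
    case empty
    show ?case using 0 by (intro exI[of _ "\<lambda>_. 1"]) (simp add: central_regular_one del: One_nat_def)
  next
    case (insert j J)
    then obtain h where h: "\<forall>i\<in>J. h i = 0" "central_regular (h k)"
      "\<And>r. (\<Sum>i\<in>UNIV. u i * mult_op (var i ^ (N - 1) * var i ^ (N * r) * h i)) = 0" by auto
    let ?h = "\<lambda>i. (var i ^ N - var j ^ N) * h i"
    \<comment> \<open>The new equation is the one for r + 1 minus the one for r multiplied by x_j^N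
      on the right; the latter factor does not depend on i and can be taken out of the sum.\<close>
    have "u i * mult_op (var i ^ (N - 1) * var i ^ (N * r) * ?h i) =
        u i * mult_op (var i ^ (N - 1) * var i ^ (N * Suc r) * h i) -
        u i * mult_op (var i ^ (N - 1) * var i ^ (N * r) * h i) * mult_op (var j ^ N)" for i r
    proof -
      have "var i ^ (N * Suc r) = var i ^ (N * r) * var i ^ N" by (simp add: power_add[symmetric] algebra_simps)
      moreover have "var j ^ N * h i = h i * var j ^ N" by (rule var_even_power_central) simp
      ultimately show ?thesis
        by (simp only: mult.assoc left_diff_distrib right_diff_distrib alg_hom_mult[OF alg_hom_mult_op, symmetric]
            alg_hom_diff[OF alg_hom_mult_op])
    qed
    then have "(\<Sum>i\<in>UNIV. u i * mult_op (var i ^ (N - 1) * var i ^ (N * r) * ?h i)) = 0" for r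
      by (simp only: sum_subtractf sum_distrib_right[symmetric] h(3)) simp
    moreover have "central_regular (var k ^ N - var j ^ N)"
      using central_regular_binomial[of N k j 1 "-1"] N_pos insert
      by (simp add: scaleC_one cvec.scale_minus_left)
    ultimately show ?case using h insert
      by (intro exI[of _ ?h]) (auto simp: central_regular_mult)
  qed
  from this[of "UNIV - {k}"] obtain h where h0: "\<forall>i\<in>UNIV - {k}. h i = 0" and h: "central_regular (h k)"
      "\<forall>r. (\<Sum>i\<in>UNIV. u i * mult_op (var i ^ (N - 1) * var i ^ (N * r) * h i)) = 0"
    by (elim meta_impE exE conjE) simp_all
  have "(\<Sum>i\<in>UNIV. u i * mult_op (var i ^ (N - 1) * var i ^ (N * 0) * h i)) =
      u k * mult_op (var k ^ (N - 1) * var k ^ (N * 0) * h k)"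
    by (subst sum.remove[of _ k]) (simp_all add: h0 alg_hom_zero[OF alg_hom_mult_op])
  then have "u k * mult_op (var k ^ (N - 1) * h k) = 0" using h(2)[rule_format, of 0] by simp
  \<comment> \<open>One more factor x_k completes x_k^{N - 1} to the central regular element
    x_k^N.\<close>
  then have "u k * mult_op (var k ^ (N - 1) * h k) * mult_op (var k) = 0" by simp
  also have "u k * mult_op (var k ^ (N - 1) * h k) * mult_op (var k) = u k * mult_op (var k ^ (N - 1) * h k * var k)"
    by (simp add: mult.assoc alg_hom_mult[OF alg_hom_mult_op])
  also have "var k ^ (N - 1) * h k * var k = var k ^ N * h k"
    using N_pos central_regularD[OF h(1), of "var k"] by (simp add: mult.assoc power_minus_mult[of N "var k", symmetric])
  finally have "u k * mult_op (var k ^ N * h k) = 0" .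
  then show ?thesis
    by (rule xw_ops_cancel_central_regular[OF u, rotated])
      (simp add: central_regular_mult central_regular_var_power h(1))
qed

text \<open>Reindexing by the exponent that remains after differentiation along x_i: the total
  degree drops by one, whence \<open>Suc n\<close>, and terms free of x_i contribute
  nothing.\<close>

lemma sum_exps_below_shift:
  fixes h :: "('n::finite \<Rightarrow> nat) \<Rightarrow> 'a::comm_monoid_add"
  assumes "\<And>b. b i = 0 \<Longrightarrow> h b = 0"
  shows "(\<Sum>b\<in>exps_below (Suc n). h b) = (\<Sum>b\<in>exps_below n. h (b(i := Suc (b i))))"
proof -
  have shift: "sum (b(i := Suc (b i))) UNIV = Suc (sum b UNIV)" for b :: "'n \<Rightarrow> nat"
  proof -
    have "sum (b(i := Suc (b i))) UNIV = Suc (b i) + sum b (UNIV - {i})"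
      by (subst sum.remove[of _ i]) (auto intro: sum.cong)
    then show ?thesis by (subst sum.remove[of _ i b]) simp_all
  qed
  have "(\<Sum>b\<in>exps_below (Suc n). h b) = (\<Sum>b\<in>{b \<in> exps_below (Suc n). b i > 0}. h b)"
    by (rule sum.mono_neutral_right) (use assms in \<open>auto simp: finite_exps_below\<close>)
  also have "\<dots> = (\<Sum>b\<in>exps_below n. h (b(i := Suc (b i))))"
  proof (rule sum.reindex_bij_witness[of _ "\<lambda>b. b(i := Suc (b i))" "\<lambda>b. b(i := b i - 1)"])
    fix b assume "b \<in> {b \<in> exps_below (Suc n). b i > 0}"
    then have b: "b \<in> exps_below (Suc n)" "b = (b(i := b i - 1))(i := Suc ((b(i := b i - 1)) i))" by auto
    show "b(i := b i - 1) \<in> exps_below n"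
      using b(1) shift[of "b(i := b i - 1)"] unfolding b(2)[symmetric] by (simp add: exps_below_def)
    show "(b(i := b i - 1))(i := Suc ((b(i := b i - 1)) i)) = b" using b(2) by simp
    then show "h ((b(i := b i - 1))(i := Suc ((b(i := b i - 1)) i))) = h b" by simp
  next
    fix b :: "'n \<Rightarrow> nat" assume "b \<in> exps_below n"
    then show "b(i := Suc (b i)) \<in> {b \<in> exps_below (Suc n). b i > 0}"
      using shift[of b] by (simp add: exps_below_def)
  qed simp
  finally show ?thesis .
qed

lemma op_Y_monomial_independence:
  fixes q :: "('n::{finite,linorder} \<Rightarrow> nat) \<Rightarrow> 'n skew endo"
  assumes "\<And>b. q b \<in> xw_ops" "(\<Sum>b\<in>exps_below n. q b * op_Y (monomial b)) = 0"
  shows "\<forall>b\<in>exps_below n. q b = 0"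
  using assms
proof (induction n arbitrary: q)
  case 0
  show ?case by (simp add: exps_below_def)
next
  case (Suc n)
  let ?M = "\<lambda>b :: 'n \<Rightarrow> nat. op_Y (monomial b)" and ?L = "\<Sum>b\<in>exps_below (Suc n). q b * op_Y (monomial b)"
  let ?G = "\<lambda>r. mult_op (power_sum r :: 'n skew)" and ?D = "\<lambda>r (i :: 'n). mult_op (power_sum_deriv r i)"
  \<comment> \<open>The contribution of direction i to exponent b after differentiation: integer and
    sign are those of \<open>braided_partial i\<close> on the monomial with exponent b +
    e_i.\<close>
  let ?u = "\<lambda>b i. (of_nat (Suc (b i)) * monomial_sign b i) *\<^sub>C q (b(i := Suc (b i)))"
  \<comment> \<open>These b have degree n - 1, the highest one after differentiation, where no error
    term contributes.\<close>
  have top: "(\<Sum>i\<in>UNIV. ?u b i * ?D r i) = 0" if b: "Suc (sum b UNIV) = n" and r: "r > 0" for b r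
  proof -
    define e where "e = (\<lambda>b. ?M b * ?G r - ?G r * ?M b - (\<Sum>i\<in>UNIV. ?D r i * op_Y (braided_partial i (monomial b))))"
    have e: "e b \<in> filt (sum b UNIV - 1)" for b
    proof -
      obtain ws where ws: "monomial b = prod_list (map var ws)" "length ws = sum b UNIV"
        using monomial_eq_word by blast
      show ?thesis unfolding e_def ws(1) ws(2)[symmetric] by (rule op_Y_commutator_power_sum[OF r])
    qed
    have "q b * e b \<in> filt (n - 1)" if "b \<in> exps_below (Suc n)" for b
    proof (rule subsetD[OF filt_mono xw_ops_mult_filt[OF Suc.prems(1) e]])
      have "sum b UNIV \<le> n" using that by (simp add: exps_below_def)
      then show "sum b UNIV - 1 \<le> n - 1" by (rule diff_le_mono)
    qed
    then have "(\<Sum>b\<in>exps_below (Suc n). q b * e b) \<in> filt (n - 1)" by (rule filt_closed(6))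
    then obtain s where s: "\<And>b. s b \<in> xw_ops" "\<And>b. b \<notin> exps_below (n - 1) \<Longrightarrow> s b = 0"
      and "(\<Sum>b\<in>exps_below (Suc n). q b * e b) = (\<Sum>b\<in>exps_below (n - 1). s b * ?M b)"
      using filt_normal_form by blast
    \<comment> \<open>The error has order below n - 1; it is written over the larger range to be
      collected in one sum with the main term.\<close>
    moreover have "(\<Sum>b\<in>exps_below (n - 1). s b * ?M b) = (\<Sum>b\<in>exps_below n. s b * ?M b)"
      by (rule sum.mono_neutral_left) (use s(2) in \<open>auto simp: finite_exps_below, auto simp: exps_below_def\<close>)
    ultimately have R: "(\<Sum>b\<in>exps_below (Suc n). q b * e b) = (\<Sum>b\<in>exps_below n. s b * ?M b)" by simp
    have D: "(\<Sum>b\<in>exps_below (Suc n). q b * (?D r i * op_Y (braided_partial i (monomial b)))) =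
        (\<Sum>b\<in>exps_below n. ?u b i * ?D r i * ?M b)" for i
    proof -
      have "(\<Sum>b\<in>exps_below (Suc n). q b * (?D r i * op_Y (braided_partial i (monomial b)))) =
          (\<Sum>b\<in>exps_below n. q (b(i := Suc (b i))) * (?D r i * op_Y (braided_partial i (monomial (b(i := Suc (b i)))))))"
        by (rule sum_exps_below_shift) (simp add: braided_partial_monomial alg_hom_zero[OF alg_hom_op_Y] cvec.scale_zero_left)
      also have "\<dots> = (\<Sum>b\<in>exps_below n. ?u b i * ?D r i * ?M b)"
        by (rule sum.cong[OF refl])
          (simp add: braided_partial_monomial alg_hom_scale[OF alg_hom_op_Y] mult_scaleC_left mult_scaleC_right mult.assoc)
      finally show ?thesis .
    qed
    have "0 = ?L * ?G r - ?G r * ?L" by (simp add: Suc.prems(2))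
    also have "\<dots> = (\<Sum>b\<in>exps_below (Suc n). q b * (?M b * ?G r - ?G r * ?M b))"
      unfolding sum_distrib_left sum_distrib_right sum_subtractf[symmetric]
      by (rule sum.cong[OF refl])
        (simp add: right_diff_distrib mult.assoc[symmetric] xw_ops_commute_power_sum[OF Suc.prems(1)])
    also have "\<dots> = (\<Sum>b\<in>exps_below (Suc n). (\<Sum>i\<in>UNIV. q b * (?D r i * op_Y (braided_partial i (monomial b)))) + q b * e b)"
      by (simp add: e_def right_diff_distrib sum_distrib_left)
    also have "\<dots> = (\<Sum>i\<in>UNIV. \<Sum>b\<in>exps_below n. ?u b i * ?D r i * ?M b) + (\<Sum>b\<in>exps_below n. s b * ?M b)"
      unfolding sum.distrib R D[symmetric] by (simp add: sum.swap[of _ UNIV])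
    also have "\<dots> = (\<Sum>b\<in>exps_below n. ((\<Sum>i\<in>UNIV. ?u b i * ?D r i) + s b) * ?M b)"
      by (simp add: distrib_right sum.distrib sum_distrib_right sum.swap[of _ UNIV])
    finally have "(\<Sum>b\<in>exps_below n. ((\<Sum>i\<in>UNIV. ?u b i * ?D r i) + s b) * ?M b) = 0" ..
    moreover have "(\<Sum>i\<in>UNIV. ?u b i * ?D r i) + s b \<in> xw_ops" for b
      by (intro xw_ops_closed xw_ops_mult Suc.prems(1) mult_op_in_xw_ops s(1))
    ultimately have "\<forall>b\<in>exps_below n. (\<Sum>i\<in>UNIV. ?u b i * ?D r i) + s b = 0"
      by (intro Suc.IH)
    then show ?thesis using b s(2)[of b] by (auto simp: exps_below_def)
  qed
  have high: "q b = 0" if b: "sum b UNIV = n" "n > 0" for b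
  proof -
    obtain k where k: "b k > 0" using b by (metis gr0I sum.neutral)
    define a where "a = b(k := b k - 1)"
    have ba: "b = a(k := Suc (a k))" using k by (auto simp: a_def)
    have "sum a UNIV = a k + sum a (UNIV - {k})" "sum b UNIV = b k + sum b (UNIV - {k})"
      by (rule sum.remove; simp)+
    moreover have "sum a (UNIV - {k}) = sum b (UNIV - {k})" by (rule sum.cong) (auto simp: a_def)
    ultimately have a: "Suc (sum a UNIV) = n" using b k by (simp add: a_def)
    \<comment> \<open>The equations for r + 1 involve the exponents N (r + 1) - 1 = (N - 1) + N r;
      the common nonzero factor N (r + 1) is divided out.\<close>
    have "?u a k = 0"
    proof (rule xw_ops_vandermonde[of "?u a"])
      show "?u a i \<in> xw_ops" for i by (intro xw_ops_closed Suc.prems(1))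
      fix r
      have "N * Suc r - 1 = N - 1 + N * r" using N_pos by simp
      then have "?u a i * ?D (Suc r) i = of_nat (N * Suc r) *\<^sub>C (?u a i * mult_op (var i ^ (N - 1) * var i ^ (N * r)))" for i
        by (simp only: power_sum_deriv_def alg_hom_scale[OF alg_hom_mult_op] mult_scaleC_right power_add)
      then have "of_nat (N * Suc r) *\<^sub>C (\<Sum>i\<in>UNIV. ?u a i * mult_op (var i ^ (N - 1) * var i ^ (N * r))) = 0"
        using top[OF a, of "Suc r"] by (simp only: cvec.scale_sum_right zero_less_Suc)
      moreover have "(of_nat (N * Suc r) :: complex) \<noteq> 0" using N_pos by (simp only: of_nat_eq_0_iff) simp
      ultimately show "(\<Sum>i\<in>UNIV. ?u a i * mult_op (var i ^ (N - 1) * var i ^ (N * r))) = 0"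
        by (simp only: cvec.scale_eq_0_iff) simp
    qed
    moreover have "of_nat (Suc (a k)) * monomial_sign a k \<noteq> 0"
      by (simp add: monomial_sign_def del: of_nat_Suc)
    ultimately show ?thesis unfolding ba[symmetric] by (simp only: cvec.scale_eq_0_iff) simp
  qed
  show ?case
  \<comment> \<open>In degree 0 there is no letter to differentiate; the relation then consists of a
    single coefficient.\<close>
  proof (cases "n = 0")
    case True
    have "exps_below (Suc n) = {\<lambda>_ :: 'n. 0}" using True by (auto simp: exps_below_def)
    then show ?thesis using Suc.prems(2) by (simp add: alg_hom_one[OF alg_hom_op_Y])
  next
    case False
    then have q0: "q b = 0" if "b \<in> exps_below (Suc n) - exps_below n" for b
      using high[of b] that by (auto simp: exps_below_def)
    have "?L = (\<Sum>b\<in>exps_below n. q b * ?M b)"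
      by (rule sum.mono_neutral_right) (use q0 in \<open>auto simp: finite_exps_below, auto simp: exps_below_def\<close>)
    then have "\<forall>b\<in>exps_below n. q b = 0" using Suc.IH Suc.prems by simp
    then show ?thesis using q0 by blast
  qed
qed

section \<open>Independence of the products x^a w y^b\<close>

definition pbw_op :: "('n::{finite,linorder} \<Rightarrow> nat) \<times> 'n lmap \<times> ('n \<Rightarrow> nat) \<Rightarrow> 'n skew endo" where
  "pbw_op = (\<lambda>(a, w, b). mult_op (monomial a) * op_w w * op_Y (monomial b))"

lemma pbw_independence:
  fixes k :: "('n::{finite,linorder} \<Rightarrow> nat) \<times> 'n lmap \<times> ('n \<Rightarrow> nat) \<Rightarrow> complex"
  assumes T: "finite T" "T \<subseteq> UNIV \<times> W \<times> UNIV" and 0: "(\<Sum>t\<in>T. k t *\<^sub>C pbw_op t) = 0"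
  shows "\<forall>t\<in>T. k t = 0"
proof -
  \<comment> \<open>Extension by 0 allows the sum over \<open>T\<close> to be taken over the full
    product \<open>A \<times> V \<times> exps_below n\<close>.\<close>
  define k' where "k' = (\<lambda>t. if t \<in> T then k t else 0)"
  define A where "A = fst ` T"
  define V where "V = fst ` snd ` T"
  obtain n where n: "snd ` snd ` T \<subseteq> exps_below n"
  proof -
    let ?m = "\<Sum>t\<in>T. sum (snd (snd t)) UNIV"
    have "sum (snd (snd t)) UNIV \<le> ?m" if "t \<in> T" for t
      by (rule member_le_sum) (use that T in auto)
    then have "snd ` snd ` T \<subseteq> exps_below (Suc ?m)" by (auto simp: exps_below_def less_Suc_eq_le)
    then show ?thesis by (rule that)
  qed
  have fin: "finite A" "finite V" using T by (simp_all add: A_def V_def)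
  have V: "V \<subseteq> W" using T(2) by (auto simp: V_def)
  have sub: "T \<subseteq> A \<times> V \<times> exps_below n" using n by (force simp: A_def V_def)
  let ?p = "\<lambda>b w. \<Sum>a\<in>A. k' (a, w, b) *\<^sub>C monomial a"
  let ?q = "\<lambda>b. \<Sum>w\<in>V. mult_op (?p b w) * op_w w"
  have "(\<Sum>b\<in>exps_below n. ?q b * op_Y (monomial b)) = (\<Sum>b\<in>exps_below n. \<Sum>w\<in>V. \<Sum>a\<in>A. k' (a, w, b) *\<^sub>C pbw_op (a, w, b))"
    by (simp add: pbw_op_def sum_distrib_right alg_hom_sum[OF alg_hom_mult_op] alg_hom_scale[OF alg_hom_mult_op] mult_scaleC_left)
  also have "\<dots> = (\<Sum>a\<in>A. \<Sum>w\<in>V. \<Sum>b\<in>exps_below n. k' (a, w, b) *\<^sub>C pbw_op (a, w, b))"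
    by (subst sum.swap, subst sum.swap[of _ _ A]) (intro sum.cong refl sum.swap)
  also have "\<dots> = (\<Sum>t\<in>A \<times> V \<times> exps_below n. k' t *\<^sub>C pbw_op t)"
    by (simp add: sum.cartesian_product case_prod_unfold)
  also have "\<dots> = (\<Sum>t\<in>T. k t *\<^sub>C pbw_op t)"
    by (rule sum.mono_neutral_cong_right)
      (use sub fin in \<open>auto simp: finite_exps_below k'_def cvec.scale_zero_left\<close>)
  finally have "(\<Sum>b\<in>exps_below n. ?q b * op_Y (monomial b)) = 0" by (simp add: 0)
  moreover have "?q b \<in> xw_ops" for b
    using V by (intro xw_ops_closed(6) xw_ops_base) auto
  \<comment> \<open>The three layers are removed from right to left: first the exponents of y, then
    the group elements, finally the exponents of x.\<close>
  ultimately have q: "\<forall>b\<in>exps_below n. ?q b = 0" by (rule op_Y_monomial_independence[rotated])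
  show ?thesis
  proof
    fix t assume t: "t \<in> T"
    obtain a w b where abw: "t = (a, w, b)" by (cases t)
    have mem: "a \<in> A" "w \<in> V" "b \<in> exps_below n" using sub t by (auto simp: abw)
    have "?q b = 0" using q mem by blast
    then have "?p b w = 0" using xw_ops_independence[OF fin(2) V, of "?p b"] mem by blast
    then have "coeffs (?p b w) = 0" by (simp add: clinear_zero[OF clinear_coeffs])
    moreover have "Poly_Mapping.lookup (coeffs (?p b w)) a = (\<Sum>x\<in>A. if x = a then k' (x, w, b) else 0)"
      by (simp add: clinear_sum[OF clinear_coeffs] clinear_scale[OF clinear_coeffs] lookup_sum lookup_single when_def
          if_distrib[of "(*) _"] cong: if_cong)
    ultimately have "k' (a, w, b) = 0" using fin mem by simp
    then show "k t = 0" using t by (simp add: k'_def abw)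
  qed
qed

end

section \<open>Quotients with a basis\<close>

lemma cspan_image_explicit:
  assumes "v \<in> cspan (bas ` J)"
  shows "\<exists>T k. finite T \<and> T \<subseteq> J \<and> v = (\<Sum>t\<in>T. k t *\<^sub>C bas t)"
proof -
  obtain U r where U: "finite U" "U \<subseteq> bas ` J" and v: "v = (\<Sum>a\<in>U. r a *\<^sub>C a)"
    using assms unfolding cvec.span_explicit by blast
  obtain T where T: "T \<subseteq> J" "inj_on bas T" "U = bas ` T" using U(2) unfolding subset_image_inj by blast
  have "finite T" using U(1) T finite_imageD by blast
  moreover have "v = (\<Sum>t\<in>T. r (bas t) *\<^sub>C bas t)" unfolding v T(3) by (simp add: sum.reindex T(2))
  ultimately show ?thesis using T(1) by (intro exI[of _ T] exI[of _ "\<lambda>t. r (bas t)"]) blast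
qed

text \<open>Modulo \<open>R\<close>, a difference of two elements with equal image is a combination
  of the \<open>bas t\<close>. Its image is 0, so independence of the images kills all coefficients
  and leaves an element of \<open>R\<close>.\<close>

lemma quotient_bij_basis:
  assumes \<phi>: "clinear \<phi>" and R: "cvec.subspace R" "\<And>r. r \<in> R \<Longrightarrow> \<phi> r = 0"
    and F: "\<And>u v. u \<in> F \<Longrightarrow> v \<in> F \<Longrightarrow> u - v \<in> F" "F \<subseteq> cspan (bas ` J \<union> R)" and H: "\<phi> ` F = H"
    and indep: "\<And>T k. finite T \<Longrightarrow> T \<subseteq> J \<Longrightarrow> (\<Sum>t\<in>T. k t *\<^sub>C \<phi> (bas t)) = 0 \<Longrightarrow> \<forall>t\<in>T. k t = 0"
  shows "quotient_bij \<phi> F R H"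
  unfolding quotient_bij_def
proof (intro conjI ballI H iffI)
  fix u v assume uv: "u \<in> F" "v \<in> F"
  show "\<phi> u = \<phi> v" if "u - v \<in> R"
    using R(2)[OF that] by (simp add: clinear_diff[OF \<phi>])
  assume eq: "\<phi> u = \<phi> v"
  have "u - v \<in> cspan (bas ` J \<union> R)" using F uv by blast
  then obtain p r where p: "p \<in> cspan (bas ` J)" and r: "r \<in> R" and upr: "u - v = p + r"
    unfolding cvec.span_Un cvec.span_eq_iff[THEN iffD2, OF R(1)] by blast
  obtain T k where T: "finite T" "T \<subseteq> J" "p = (\<Sum>t\<in>T. k t *\<^sub>C bas t)" using cspan_image_explicit[OF p] by blast
  have "\<phi> (p + r) = 0" unfolding upr[symmetric] by (simp add: clinear_diff[OF \<phi>] eq)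
  then have "\<phi> p = 0" by (simp add: clinear_add[OF \<phi>] R(2)[OF r])
  then have "(\<Sum>t\<in>T. k t *\<^sub>C \<phi> (bas t)) = 0" by (simp add: T(3) clinear_sum[OF \<phi>] clinear_scale[OF \<phi>])
  then have "\<forall>t\<in>T. k t = 0" by (rule indep[OF T(1,2)])
  then have "p = 0" by (simp add: T(3) cvec.scale_zero_left)
  then show "u - v \<in> R" using r upr by simp
qed

lemma cspan_cong:
  assumes "u - v \<in> R" "v \<in> cspan (B \<union> R)" shows "u \<in> cspan (B \<union> R)"
proof -
  have "u - v \<in> cspan (B \<union> R)" using assms(1) by (intro cvec.span_base) simp
  then have "(u - v) + v \<in> cspan (B \<union> R)" using assms(2) by (rule cvec.span_add)
  then show ?thesis by simp
qed

section \<open>Generated subalgebras\<close>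

lemma subalg_sum: "(\<And>a. a \<in> A \<Longrightarrow> h a \<in> subalg S) \<Longrightarrow> sum h A \<in> subalg S"
proof (induction A rule: infinite_finite_induct)
  case (insert x A)
  then show ?case by (simp add: subalg.add)
qed (use subalg.scale[OF subalg.one, of 0 S] in \<open>simp_all add: cvec.scale_zero_left\<close>)

lemma subalg_prod_list: "set xs \<subseteq> subalg S \<Longrightarrow> prod_list xs \<in> subalg S"
  by (induction xs) (auto intro: subalg.one subalg.mult)

lemma range_alg_hom_skew:
  fixes \<phi> :: "'n skew \<Rightarrow> 'a::calg"
  assumes hom: "alg_hom \<phi>"
  shows "range \<phi> = subalg (range (\<lambda>i. \<phi> (var i)))"
proof (intro equalityI subsetI)
  fix u assume "u \<in> range \<phi>"
  then obtain s where u: "u = \<phi> s" by auto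
  show "u \<in> subalg (range (\<lambda>i. \<phi> (var i)))"
    unfolding u
    by (induction s rule: skew_induct)
      (auto simp: alg_hom_one[OF hom] alg_hom_add[OF hom] alg_hom_scale[OF hom] alg_hom_mult[OF hom] intro: subalg.intros)
next
  fix u assume "u \<in> subalg (range (\<lambda>i. \<phi> (var i)))"
  then show "u \<in> range \<phi>"
  proof (induction rule: subalg.induct)
    case one
    show ?case by (simp flip: alg_hom_one[OF hom])
  next
    case (add a b)
    then show ?case by (auto simp flip: alg_hom_add[OF hom])
  next
    case (scale a k)
    then show ?case by (auto simp flip: alg_hom_scale[OF hom])
  next
    case (mult a b)
    then show ?case by (auto simp flip: alg_hom_mult[OF hom])
  qed auto
qed

lemma free_on_closed:
  shows "1 \<in> free_on G" and "g \<in> G \<Longrightarrow> gen g \<in> free_on G"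
    and "p \<in> free_on G \<Longrightarrow> q \<in> free_on G \<Longrightarrow> p + q \<in> free_on G"
    and "p \<in> free_on G \<Longrightarrow> q \<in> free_on G \<Longrightarrow> p - q \<in> free_on G"
    and "p \<in> free_on G \<Longrightarrow> k *\<^sub>C p \<in> free_on G"
    and "p \<in> free_on G \<Longrightarrow> q \<in> free_on G \<Longrightarrow> p * q \<in> free_on G"
proof -
  show "1 \<in> free_on G" by (simp add: free_on_def zero_list_def flip: single_one)
  show "g \<in> G \<Longrightarrow> gen g \<in> free_on G" by (simp add: free_on_def gen_def)
  assume p: "p \<in> free_on G"
  have scale: "k *\<^sub>C p \<in> free_on G" if "p \<in> free_on G" for k and p :: "'a free_alg"
    using that by (auto simp: free_on_def in_keys_iff)
  then show "k *\<^sub>C p \<in> free_on G" using p .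
  assume q: "q \<in> free_on G"
  have add: "p + q \<in> free_on G" if "q \<in> free_on G" for q
    using p that keys_add[of p q] by (auto simp: free_on_def)
  then show "p + q \<in> free_on G" using q .
  show "p - q \<in> free_on G" using add[OF scale[OF q, of "-1"]] by (simp add: cvec.scale_minus_left scaleC_one)
  show "p * q \<in> free_on G" unfolding free_on_def
  proof (intro CollectI ballI)
    fix w assume "w \<in> Poly_Mapping.keys (p * q)"
    then obtain u v where "w = u @ v" "u \<in> Poly_Mapping.keys p" "v \<in> Poly_Mapping.keys q"
      using keys_mult[of p q] by (auto simp: plus_list_def)
    then show "set w \<subseteq> G" using p q by (simp add: free_on_def)
  qed
qed

lemma eval_free_image_free_on: "eval_free f ` free_on G = subalg (f ` G)"
proof (intro equalityI subsetI)
  fix u assume "u \<in> eval_free f ` free_on G"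
  then obtain p where p: "p \<in> free_on G" and u: "u = eval_free f p" by blast
  show "u \<in> subalg (f ` G)"
    unfolding u eval_free_def lin_ext_def
  proof (intro subalg_sum subalg.scale subalg_prod_list)
    fix w assume "w \<in> Poly_Mapping.keys p"
    then have "set w \<subseteq> G" using p by (simp add: free_on_def)
    then show "set (map f w) \<subseteq> subalg (f ` G)" by (auto intro: subalg.incl)
  qed
next
  note hom = alg_hom_eval_free[of f]
  fix u assume "u \<in> subalg (f ` G)"
  then show "u \<in> eval_free f ` free_on G"
  proof (induction rule: subalg.induct)
    case one
    show ?case by (rule image_eqI[OF _ free_on_closed(1)]) (simp add: alg_hom_one[OF hom])
  next
    case (incl s)
    then show ?case by (auto intro!: image_eqI[OF _ free_on_closed(2)])
  next
    case (add a b)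
    then show ?case by (auto simp: alg_hom_add[OF hom, symmetric] free_on_closed)
  next
    case (scale a k)
    then show ?case by (auto simp: alg_hom_scale[OF hom, symmetric] free_on_closed)
  next
    case (mult a b)
    then show ?case by (auto simp: alg_hom_mult[OF hom, symmetric] free_on_closed)
  qed
qed

lemma alg_hom_free_eqI:
  assumes "alg_hom \<phi>" "alg_hom \<psi>" "\<And>g. \<phi> (gen g) = \<psi> (gen g)"
  shows "\<phi> p = \<psi> p"
proof (induction p rule: free_vec_induct)
  case (single w)
  show ?case by (simp add: prod_list_gen[symmetric] alg_hom_prod_list[OF assms(1)] alg_hom_prod_list[OF assms(2)] assms(3) o_def)
qed (simp_all add: alg_hom_add[OF assms(1)] alg_hom_add[OF assms(2)] alg_hom_scale[OF assms(1)] alg_hom_scale[OF assms(2)])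

lemma alg_hom_compose: "alg_hom \<phi> \<Longrightarrow> alg_hom \<psi> \<Longrightarrow> alg_hom (\<lambda>x. \<psi> (\<phi> x))"
  by (simp add: alg_hom_def clinear_iff)

section \<open>The presentation by generators and relations\<close>

context braided_data
begin

abbreviation gx :: "'n \<Rightarrow> ('n::{finite,linorder}, 'n lmap) cgen free_alg" where "gx i \<equiv> gen (GX i)"
abbreviation gy :: "'n \<Rightarrow> ('n::{finite,linorder}, 'n lmap) cgen free_alg" where "gy i \<equiv> gen (GY i)"
abbreviation gw :: "'n lmap \<Rightarrow> ('n::{finite,linorder}, 'n lmap) cgen free_alg" where "gw w \<equiv> gen (GW w)"
abbreviation F :: "('n::{finite,linorder}, 'n lmap) cgen free_alg set" where "F \<equiv> free_on (cgens W)"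

definition rel_ideal :: "('n::{finite,linorder}, 'n lmap) cgen free_alg set" where
  "rel_ideal = ideal_in F (cherednik_rels C C' c)"

lemma F_closed:
  shows "1 \<in> F" and "gx i \<in> F" and "gy i \<in> F" and "w \<in> W \<Longrightarrow> gw w \<in> F"
    and "u \<in> F \<Longrightarrow> v \<in> F \<Longrightarrow> u + v \<in> F" and "u \<in> F \<Longrightarrow> v \<in> F \<Longrightarrow> u - v \<in> F"
    and "u \<in> F \<Longrightarrow> k *\<^sub>C u \<in> F" and "u \<in> F \<Longrightarrow> v \<in> F \<Longrightarrow> u * v \<in> F"
  by (auto simp: cgens_def intro!: free_on_closed)

lemma rel_ideal_subspace: "cvec.subspace rel_ideal"
  by (simp add: rel_ideal_def ideal_in_def cvec.subspace_span)

lemma rel_ideal_base: "a \<in> F \<Longrightarrow> r \<in> cherednik_rels C C' c \<Longrightarrow> b \<in> F \<Longrightarrow> a * r * b \<in> rel_ideal"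
  unfolding rel_ideal_def ideal_in_def by (rule cvec.span_base) blast

lemma rel_ideal_mult:
  fixes u a :: "('n::{finite,linorder}, 'n lmap) cgen free_alg"
  assumes u: "u \<in> rel_ideal" and a: "a \<in> F"
  shows "a * u \<in> rel_ideal" and "u * a \<in> rel_ideal"
proof -
  have u: "u \<in> cspan {b * r * d | b r d. b \<in> F \<and> r \<in> cherednik_rels C C' c \<and> d \<in> F}"
    using u by (simp add: rel_ideal_def ideal_in_def)
  show "a * u \<in> rel_ideal"
  proof (rule clinear_span_subset[OF clinear_mult_left _ rel_ideal_subspace u])
    fix v :: "('n, 'n lmap) cgen free_alg" assume "v \<in> {b * r * d | b r d. b \<in> F \<and> r \<in> cherednik_rels C C' c \<and> d \<in> F}"
    then obtain b r d where v: "v = b * r * d" "b \<in> F" "r \<in> cherednik_rels C C' c" "d \<in> F" by blast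
    show "a * v \<in> rel_ideal"
      using rel_ideal_base[OF F_closed(8)[OF a v(2)] v(3,4)] by (simp add: v(1) mult.assoc)
  qed
  show "u * a \<in> rel_ideal"
  proof (rule clinear_span_subset[OF clinear_mult_right _ rel_ideal_subspace u])
    fix v :: "('n, 'n lmap) cgen free_alg" assume "v \<in> {b * r * d | b r d. b \<in> F \<and> r \<in> cherednik_rels C C' c \<and> d \<in> F}"
    then obtain b r d where v: "v = b * r * d" "b \<in> F" "r \<in> cherednik_rels C C' c" "d \<in> F" by blast
    show "v * a \<in> rel_ideal"
      using rel_ideal_base[OF v(2,3) F_closed(8)[OF v(4) a]] by (simp add: v(1) mult.assoc)
  qed
qed

lemma rels_in_rel_ideal: "r \<in> cherednik_rels C C' c \<Longrightarrow> r \<in> rel_ideal"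
  using rel_ideal_base[OF F_closed(1) _ F_closed(1)] by simp

definition eqv :: "('n::{finite,linorder}, 'n lmap) cgen free_alg \<Rightarrow> ('n, 'n lmap) cgen free_alg \<Rightarrow> bool" where
  "eqv u v \<longleftrightarrow> u - v \<in> rel_ideal"

lemma eqv_sym: "eqv u v \<Longrightarrow> eqv v u"
  unfolding eqv_def using cvec.subspace_neg[OF rel_ideal_subspace, of "u - v"] by simp

lemma eqv_trans [trans]: "eqv u v \<Longrightarrow> eqv v w \<Longrightarrow> eqv u w"
  unfolding eqv_def using cvec.subspace_add[OF rel_ideal_subspace, of "u - v" "v - w"] by simp

lemma eqv_add: "eqv u v \<Longrightarrow> eqv u' v' \<Longrightarrow> eqv (u + u') (v + v')"
  unfolding eqv_def using cvec.subspace_add[OF rel_ideal_subspace, of "u - v" "u' - v'"] by (simp add: algebra_simps)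

lemma eqv_scale: "eqv u v \<Longrightarrow> eqv (k *\<^sub>C u) (k *\<^sub>C v)"
  unfolding eqv_def using cvec.subspace_scale[OF rel_ideal_subspace, of "u - v" k] by (simp add: cvec.scale_right_diff_distrib)

text \<open>The ideal is formed inside \<open>F\<close>, so congruences may be multiplied by
  elements of \<open>F\<close>; this explains the membership conditions carried along below.\<close>

lemma eqv_mult_left: "eqv u v \<Longrightarrow> a \<in> F \<Longrightarrow> eqv (a * u) (a * v)"
  unfolding eqv_def using rel_ideal_mult(1)[of "u - v" a] by (simp add: right_diff_distrib)

lemma eqv_mult_right: "eqv u v \<Longrightarrow> a \<in> F \<Longrightarrow> eqv (u * a) (v * a)"
  unfolding eqv_def using rel_ideal_mult(2)[of "u - v" a] by (simp add: left_diff_distrib)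

lemma eqv_rels:
  shows eqv_xx: "i \<noteq> j \<Longrightarrow> gx i * gx j + gx j * gx i \<in> rel_ideal"
    and eqv_yy: "i \<noteq> j \<Longrightarrow> gy i * gy j + gy j * gy i \<in> rel_ideal"
    and eqv_wx: "w \<in> W \<Longrightarrow> eqv (gw w * gx i * gw (inv\<^bsub>GL\<^esub> w)) (\<Sum>k\<in>UNIV. coef w i k *\<^sub>C gx k)"
    and eqv_wy: "w \<in> W \<Longrightarrow> eqv (gw w * gy i * gw (inv\<^bsub>GL\<^esub> w)) (\<Sum>k\<in>UNIV. dual_coef w i k *\<^sub>C gy k)"
    and eqv_yx: "i \<noteq> j \<Longrightarrow> eqv (gy j * gx i) (- (gx i * gy j) - c 1 *\<^sub>C (\<Sum>\<epsilon>\<in>C. \<epsilon> *\<^sub>C gw (sigma_map i j \<epsilon>)))"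
    and eqv_yx_same: "eqv (gy i * gx i) (gx i * gy i + (1 + c 1 *\<^sub>C (\<Sum>j\<in>UNIV - {i}. \<Sum>\<epsilon>\<in>C. gw (sigma_map i j \<epsilon>))
          + (\<Sum>\<epsilon>\<in>C' - {1}. c \<epsilon> *\<^sub>C gw (t_map i \<epsilon>))))"
    and eqv_ww: "v \<in> W \<Longrightarrow> w \<in> W \<Longrightarrow> eqv (gw v * gw w) (gw (v \<circ> w))"
    and eqv_w_id: "eqv (gw id) 1"
proof -
  note defs = cherednik_rels_def Let_def
  \<comment> \<open>The relations form a left-nested union of eight families; the chains of
    \<open>UnI1\<close> and \<open>UnI2\<close> select the family.\<close>
  show "i \<noteq> j \<Longrightarrow> gx i * gx j + gx j * gx i \<in> rel_ideal" by (rule rels_in_rel_ideal) (unfold defs, rule UnI1, rule UnI1, rule UnI1, rule UnI1, rule UnI1, rule UnI1, rule UnI1, rule CollectI, intro exI conjI, rule refl, (assumption | rule TrueI)+)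
  show "i \<noteq> j \<Longrightarrow> gy i * gy j + gy j * gy i \<in> rel_ideal" by (rule rels_in_rel_ideal) (unfold defs, rule UnI1, rule UnI1, rule UnI1, rule UnI1, rule UnI1, rule UnI1, rule UnI2, rule CollectI, intro exI conjI, rule refl, (assumption | rule TrueI)+)
  show "w \<in> W \<Longrightarrow> eqv (gw w * gx i * gw (inv\<^bsub>GL\<^esub> w)) (\<Sum>k\<in>UNIV. coef w i k *\<^sub>C gx k)"
    unfolding eqv_def by (rule rels_in_rel_ideal) (unfold defs, rule UnI1, rule UnI1, rule UnI1, rule UnI1, rule UnI1, rule UnI2, rule CollectI, intro exI conjI, rule refl, (assumption | rule TrueI)+)
  show "w \<in> W \<Longrightarrow> eqv (gw w * gy i * gw (inv\<^bsub>GL\<^esub> w)) (\<Sum>k\<in>UNIV. dual_coef w i k *\<^sub>C gy k)"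
    unfolding eqv_def by (rule rels_in_rel_ideal) (unfold defs, rule UnI1, rule UnI1, rule UnI1, rule UnI1, rule UnI2, rule CollectI, intro exI conjI, rule refl, (assumption | rule TrueI)+)
  show "v \<in> W \<Longrightarrow> w \<in> W \<Longrightarrow> eqv (gw v * gw w) (gw (v \<circ> w))"
    unfolding eqv_def GL_simps(2)[symmetric] by (rule rels_in_rel_ideal) (unfold defs, rule UnI1, rule UnI2, rule CollectI, intro exI conjI, rule refl, (assumption | rule TrueI)+)
  show "eqv (gw id) 1"
    unfolding eqv_def GL_simps(3)[symmetric] by (rule rels_in_rel_ideal) (unfold defs, rule UnI2, rule singletonI)
  show "eqv (gy j * gx i) (- (gx i * gy j) - c 1 *\<^sub>C (\<Sum>\<epsilon>\<in>C. \<epsilon> *\<^sub>C gw (sigma_map i j \<epsilon>)))" if "i \<noteq> j"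
  proof -
    have "gy j * gx i + gx i * gy j + c 1 *\<^sub>C (\<Sum>\<epsilon>\<in>C. \<epsilon> *\<^sub>C gw (sigma_map i j \<epsilon>)) \<in> rel_ideal"
      by (rule rels_in_rel_ideal) (unfold defs, rule UnI1, rule UnI1, rule UnI1, rule UnI2, rule CollectI, intro exI conjI, rule refl, rule that)
    then show ?thesis by (simp add: eqv_def algebra_simps)
  qed
  show "eqv (gy i * gx i) (gx i * gy i + (1 + c 1 *\<^sub>C (\<Sum>j\<in>UNIV - {i}. \<Sum>\<epsilon>\<in>C. gw (sigma_map i j \<epsilon>))
          + (\<Sum>\<epsilon>\<in>C' - {1}. c \<epsilon> *\<^sub>C gw (t_map i \<epsilon>))))"
  proof -
    have "gy i * gx i - gx i * gy i - (1 + c 1 *\<^sub>C (\<Sum>j\<in>UNIV - {i}. \<Sum>\<epsilon>\<in>C. gw (sigma_map i j \<epsilon>))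
          + (\<Sum>\<epsilon>\<in>C' - {1}. c \<epsilon> *\<^sub>C gw (t_map i \<epsilon>))) \<in> rel_ideal"
      by (rule rels_in_rel_ideal) (unfold defs, rule UnI1, rule UnI1, rule UnI2, rule CollectI, intro exI conjI, rule refl, (assumption | rule TrueI)+)
    then show ?thesis by (simp add: eqv_def diff_diff_eq)
  qed
qed

text \<open>The free algebra violates the skew-commutation relations, so here \<^const>\<open>skew_lift\<close> depends on the choice
  of representatives and is a homomorphism only modulo the ideal.\<close>

abbreviation lift_x :: "'n skew \<Rightarrow> ('n::{finite,linorder}, 'n lmap) cgen free_alg" where "lift_x \<equiv> skew_lift gx"
abbreviation lift_y :: "'n skew \<Rightarrow> ('n::{finite,linorder}, 'n lmap) cgen free_alg" where "lift_y \<equiv> skew_lift gy"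

lemma eval_free_in_F:
  assumes "\<And>g. f g \<in> F" shows "eval_free f p \<in> F"
proof (induction p rule: free_vec_induct)
  case (single ws)
  have "prod_list (map f ws) \<in> F"
    by (induction ws) (simp_all add: F_closed(1) F_closed(8)[OF assms])
  then show ?case by simp
qed (simp_all add: alg_hom_add[OF alg_hom_eval_free] alg_hom_scale[OF alg_hom_eval_free] F_closed)

text \<open>Each generator a r b of the skew ideal is sent to a multiple of an anticommutator of
  values of \<open>f\<close>, so anticommutation modulo the ideal is enough.\<close>

lemma eval_free_skew_ideal_rel_ideal:
  fixes f :: "'m \<Rightarrow> ('n::{finite,linorder}, 'n lmap) cgen free_alg"
  assumes anti: "\<And>i j. i \<noteq> j \<Longrightarrow> f i * f j + f j * f i \<in> rel_ideal" and f: "\<And>i. f i \<in> F"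
    and p: "p \<in> skew_ideal"
  shows "eval_free f p \<in> rel_ideal"
proof -
  note hom = alg_hom_eval_free[of f]
  have p: "p \<in> cspan {a * r * b | a r b. a \<in> UNIV \<and> r \<in> {gen i * gen j + gen j * gen i | i j. i \<noteq> j} \<and> b \<in> UNIV}"
    using p by (simp only: skew_ideal_def ideal_in_def)
  show ?thesis
  proof (rule clinear_span_subset[OF alg_homD(1)[OF hom] _ rel_ideal_subspace p])
    fix v :: "'m free_alg" assume "v \<in> {a * r * b | a r b. a \<in> UNIV \<and> r \<in> {gen i * gen j + gen j * gen i | i j. i \<noteq> j} \<and> b \<in> UNIV}"
    then obtain a b i j where v: "v = a * (gen i * gen j + gen j * gen i) * b" "i \<noteq> j" by blast
    have "eval_free f v = eval_free f a * (f i * f j + f j * f i) * eval_free f b"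
      by (simp add: v alg_hom_mult[OF hom] alg_hom_add[OF hom])
    then show "eval_free f v \<in> rel_ideal"
      using anti[OF v(2)] f by (simp add: rel_ideal_mult eval_free_in_F)
  qed
qed

lemma rep_abs_skew: "rep_skew (abs_skew p) - p \<in> skew_ideal"
  by (rule Quotient3_rep_abs[OF Quotient3_skew]) (simp add: skew_ideal_simps)

context
  fixes f :: "'n::{finite,linorder} \<Rightarrow> ('n, 'n lmap) cgen free_alg"
  assumes anti: "\<And>i j. i \<noteq> j \<longrightarrow> f i * f j + f j * f i \<in> rel_ideal" and f: "\<And>i. f i \<in> F"
begin

lemma eqv_lift_abs: "eqv (skew_lift f (abs_skew p)) (eval_free f p)"
  unfolding eqv_def skew_lift_def alg_hom_diff[OF alg_hom_eval_free, symmetric]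
  by (rule eval_free_skew_ideal_rel_ideal[OF anti[rule_format] f rep_abs_skew])

lemma
  shows eqv_lift_one: "eqv (skew_lift f 1) 1"
    and eqv_lift_add: "eqv (skew_lift f (s + t)) (skew_lift f s + skew_lift f t)"
    and eqv_lift_scale: "eqv (skew_lift f (k *\<^sub>C s)) (k *\<^sub>C skew_lift f s)"
    and eqv_lift_var_mult: "eqv (skew_lift f (var i * s)) (f i * skew_lift f s)"
proof -
  obtain p q where s: "s = abs_skew p" and t: "t = abs_skew q" using abs_skew_surj by metis
  note abs = eqv_lift_abs and hom = alg_hom_eval_free[of f]
  show "eqv (skew_lift f 1) 1" using abs[of 1] by (simp add: alg_hom_one[OF alg_hom_abs_skew] alg_hom_one[OF hom])
  show "eqv (skew_lift f (s + t)) (skew_lift f s + skew_lift f t)"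
    using abs[of "p + q"] eqv_add[OF abs[of p] abs[of q], THEN eqv_sym]
    unfolding s t alg_hom_add[OF alg_hom_abs_skew] alg_hom_add[OF hom] by (rule eqv_trans)
  show "eqv (skew_lift f (k *\<^sub>C s)) (k *\<^sub>C skew_lift f s)"
    using abs[of "k *\<^sub>C p"] eqv_scale[OF abs[of p], THEN eqv_sym]
    unfolding s alg_hom_scale[OF alg_hom_abs_skew] alg_hom_scale[OF hom] by (rule eqv_trans)
  show "eqv (skew_lift f (var i * s)) (f i * skew_lift f s)"
    using abs[of "gen i * p"] eqv_mult_left[OF abs[of p] f, THEN eqv_sym]
    unfolding s alg_hom_mult[OF alg_hom_abs_skew] alg_hom_mult[OF hom] eval_free_gen var.abs_eq by (rule eqv_trans)
qed

end

lemmas lift_x_one = eqv_lift_one[of gx, OF eqv_xx[unfolded atomize_imp] F_closed(2)]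
  and lift_x_add = eqv_lift_add[of gx, OF eqv_xx[unfolded atomize_imp] F_closed(2)]
  and lift_x_scale = eqv_lift_scale[of gx, OF eqv_xx[unfolded atomize_imp] F_closed(2)]
  and lift_x_var_mult = eqv_lift_var_mult[of gx, OF eqv_xx[unfolded atomize_imp] F_closed(2)]
  and lift_y_one = eqv_lift_one[of gy, OF eqv_yy[unfolded atomize_imp] F_closed(3)]
  and lift_y_add = eqv_lift_add[of gy, OF eqv_yy[unfolded atomize_imp] F_closed(3)]
  and lift_y_scale = eqv_lift_scale[of gy, OF eqv_yy[unfolded atomize_imp] F_closed(3)]
  and lift_y_var_mult = eqv_lift_var_mult[of gy, OF eqv_yy[unfolded atomize_imp] F_closed(3)]

lemma lift_in_F: "lift_x s \<in> F" "lift_y s \<in> F"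
  unfolding skew_lift_def by (intro eval_free_in_F F_closed)+

section \<open>Straightening words modulo the relations\<close>

definition pbw_word :: "('n::{finite,linorder} \<Rightarrow> nat) \<times> 'n lmap \<times> ('n \<Rightarrow> nat) \<Rightarrow> ('n, 'n lmap) cgen free_alg" where
  "pbw_word = (\<lambda>(a, w, b). lift_x (monomial a) * gw w * lift_y (monomial b))"

text \<open>The ideal is included in the span, so that membership depends only on the class modulo
  the relations.\<close>

definition pbw_span :: "('n::{finite,linorder}, 'n lmap) cgen free_alg set" where
  "pbw_span = cspan (pbw_word ` (UNIV \<times> W \<times> UNIV) \<union> rel_ideal)"

lemma pbw_span_closed:
  shows "cvec.subspace pbw_span"
    and "u \<in> pbw_span \<Longrightarrow> v \<in> pbw_span \<Longrightarrow> u + v \<in> pbw_span"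
    and "u \<in> pbw_span \<Longrightarrow> k *\<^sub>C u \<in> pbw_span"
    and "u \<in> pbw_span \<Longrightarrow> - u \<in> pbw_span"
    and "(\<And>a. a \<in> A \<Longrightarrow> h a \<in> pbw_span) \<Longrightarrow> sum h A \<in> pbw_span"
  by (auto simp: pbw_span_def cvec.subspace_span cvec.span_add cvec.span_scale cvec.span_neg cvec.span_sum)

lemma eqv_pbw_span: "eqv u v \<Longrightarrow> v \<in> pbw_span \<Longrightarrow> u \<in> pbw_span"
  unfolding pbw_span_def eqv_def by (rule cspan_cong)

text \<open>Arbitrary s and t are convenient for straightening. Since the lifts are linear only
  modulo the ideal, the reduction to monomials proceeds by congruences.\<close>

lemma pbw_span_base:
  assumes w: "w \<in> W" shows "lift_x s * gw w * lift_y t \<in> pbw_span"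
proof (induction s rule: monomial_induct)
  case (monomial a)
  note F = F_closed(8)[OF lift_in_F(1) F_closed(4)[OF w]]
  show ?case
  proof (induction t rule: monomial_induct)
    case (monomial b)
    show ?case unfolding pbw_span_def
      by (rule cvec.span_base) (use w in \<open>auto simp: pbw_word_def intro!: image_eqI[of _ _ "(a, w, b)"]\<close>)
  next
    case (add p q)
    from pbw_span_closed(2)[OF add] show ?case
      unfolding distrib_left[symmetric] by (rule eqv_pbw_span[OF eqv_mult_left[OF lift_y_add F]])
  next
    case (scale k p)
    from pbw_span_closed(3)[OF scale] show ?case
      unfolding mult_scaleC_right[symmetric] by (rule eqv_pbw_span[OF eqv_mult_left[OF lift_y_scale F]])
  qed
next
  case (add p q)
  from pbw_span_closed(2)[OF add] show ?case
    unfolding distrib_right[symmetric]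
    by (rule eqv_pbw_span[OF eqv_mult_right[OF eqv_mult_right[OF lift_x_add F_closed(4)[OF w]] lift_in_F(2)]])
next
  case (scale k p)
  from pbw_span_closed(3)[OF scale] show ?case
    unfolding mult_scaleC_left[symmetric]
    by (rule eqv_pbw_span[OF eqv_mult_right[OF eqv_mult_right[OF lift_x_scale F_closed(4)[OF w]] lift_in_F(2)]])
qed

lemma mult_pbw_span:
  fixes u v :: "('n::{finite,linorder}, 'n lmap) cgen free_alg"
  assumes u: "u \<in> F" and base: "\<And>s w t. w \<in> W \<Longrightarrow> u * (lift_x s * gw w * lift_y t) \<in> pbw_span"
    and v: "v \<in> pbw_span"
  shows "u * v \<in> pbw_span"
proof -
  have v: "v \<in> cspan (pbw_word ` (UNIV \<times> W \<times> UNIV) \<union> rel_ideal)" using v by (simp add: pbw_span_def)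
  show ?thesis
  proof (rule clinear_span_subset[OF clinear_mult_left _ pbw_span_closed(1) v])
    fix b :: "('n, 'n lmap) cgen free_alg" assume "b \<in> pbw_word ` (UNIV \<times> W \<times> UNIV) \<union> rel_ideal"
    then show "u * b \<in> pbw_span"
    proof
      assume "b \<in> pbw_word ` (UNIV \<times> W \<times> UNIV)"
      then show ?thesis using base by (auto simp: pbw_word_def)
    next
      assume "b \<in> rel_ideal"
      then have "u * b \<in> rel_ideal" using u by (rule rel_ideal_mult(1))
      then show ?thesis unfolding pbw_span_def by (intro cvec.span_base) simp
    qed
  qed
qed

lemma gx_mult_pbw_span: "v \<in> pbw_span \<Longrightarrow> gx i * v \<in> pbw_span"
proof (rule mult_pbw_span[OF F_closed(2)])
  fix s t :: "'a skew" and w :: "'a lmap" assume w: "w \<in> W"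
  have "eqv (gx i * lift_x s * gw w * lift_y t) (lift_x (var i * s) * gw w * lift_y t)"
    by (intro eqv_mult_right lift_in_F F_closed w eqv_sym[OF lift_x_var_mult])
  then show "gx i * (lift_x s * gw w * lift_y t) \<in> pbw_span"
    unfolding mult.assoc[symmetric] by (rule eqv_pbw_span[OF _ pbw_span_base[OF w]])
qed

lemma eqv_gw_inv: "w \<in> W \<Longrightarrow> eqv (gw (inv\<^bsub>GL\<^esub> w) * gw w) 1"
  using eqv_trans[OF eqv_ww[of "inv\<^bsub>GL\<^esub> w" w] _] eqv_w_id by (simp add: W_inv W_inv_comp)

text \<open>The group generators are invertible only modulo the relations, so the conjugation
  relation is turned into a commutation relation by multiplying with \<open>gw w\<close> from the
  right.\<close>

lemma eqv_move:
  assumes w: "w \<in> W" and a: "a \<in> F" and conj: "eqv (gw w * a * gw (inv\<^bsub>GL\<^esub> w)) b"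
  shows "eqv (gw w * a) (b * gw w)"
proof -
  have "eqv (gw w * a * (gw (inv\<^bsub>GL\<^esub> w) * gw w)) (gw w * a * 1)"
    by (intro eqv_mult_left eqv_gw_inv w F_closed a)
  then have "eqv (gw w * a) (gw w * a * (gw (inv\<^bsub>GL\<^esub> w) * gw w))" by (simp add: eqv_sym)
  also have "eqv \<dots> (b * gw w)"
    using eqv_mult_right[OF conj F_closed(4)[OF w]] by (simp add: mult.assoc)
  finally show ?thesis .
qed

lemma eqv_gw_gx: "w \<in> W \<Longrightarrow> eqv (gw w * gx i) (scal_of w i *\<^sub>C (gx (perm_of w i) * gw w))"
  using eqv_move[OF _ F_closed(2) eqv_wx, of w i]
  by (simp add: coef_monomial_map[OF monomial_map_of] sum_if_scaleC mult_scaleC_left)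

lemma eqv_gy_gw:
  assumes w: "w \<in> W" shows "\<exists>s i. eqv (gy k * gw w) (s *\<^sub>C (gw w * gy i))"
proof -
  obtain i where i: "perm_of w i = k"
    using monomial_map_bijD[OF monomial_map_of[OF w]] by (metis bij_pointE)
  have nz: "scal_of w i \<noteq> 0" using monomial_map_of[OF w] C_nonzero by (auto simp: monomial_map_def)
  have "eqv (gw w * gy i) (inverse (scal_of w i) *\<^sub>C (gy k * gw w))"
    using eqv_move[OF w F_closed(3) eqv_wy[OF w], of i] w
    by (simp add: dual_coef_monomial_map[OF monomial_map_of] sum_if_scaleC mult_scaleC_left i)
  from eqv_scale[OF eqv_sym[OF this], of "scal_of w i"] show ?thesis
    using nz by (auto simp: scaleC_scaleC scaleC_one)
qed

text \<open>Any \<open>s'\<close> serves the spanning argument, so the action of w on the skew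
  polynomial is not tracked.\<close>

lemma gw_lift_x:
  assumes w: "w \<in> W" shows "\<exists>s'. eqv (gw w * lift_x s) (lift_x s' * gw w)"
proof (induction s rule: skew_induct)
  case one
  have "eqv (gw w * lift_x 1) (gw w * 1)" by (intro eqv_mult_left lift_x_one F_closed w)
  also have "eqv (gw w * 1) (lift_x 1 * gw w)"
    using eqv_sym[OF eqv_mult_right[OF lift_x_one F_closed(4)[OF w]]] by simp
  finally show ?case by blast
next
  case (add p q)
  then obtain p' q' where pq: "eqv (gw w * lift_x p) (lift_x p' * gw w)" "eqv (gw w * lift_x q) (lift_x q' * gw w)" by blast
  have "eqv (gw w * lift_x (p + q)) (gw w * (lift_x p + lift_x q))" by (intro eqv_mult_left lift_x_add F_closed w)
  also have "eqv (gw w * (lift_x p + lift_x q)) ((lift_x p' + lift_x q') * gw w)"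
    using eqv_add[OF pq] by (simp add: distrib_left distrib_right)
  also have "eqv ((lift_x p' + lift_x q') * gw w) (lift_x (p' + q') * gw w)"
    by (intro eqv_mult_right eqv_sym[OF lift_x_add] F_closed w)
  finally show ?case by blast
next
  case (scale k p)
  then obtain p' where p: "eqv (gw w * lift_x p) (lift_x p' * gw w)" by blast
  have "eqv (gw w * lift_x (k *\<^sub>C p)) (gw w * (k *\<^sub>C lift_x p))" by (intro eqv_mult_left lift_x_scale F_closed w)
  also have "eqv (gw w * (k *\<^sub>C lift_x p)) ((k *\<^sub>C lift_x p') * gw w)"
    using eqv_scale[OF p] by (simp add: mult_scaleC_left mult_scaleC_right)
  also have "eqv ((k *\<^sub>C lift_x p') * gw w) (lift_x (k *\<^sub>C p') * gw w)"
    by (intro eqv_mult_right eqv_sym[OF lift_x_scale] F_closed w)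
  finally show ?case by blast
next
  case (mult i p)
  then obtain p' where p: "eqv (gw w * lift_x p) (lift_x p' * gw w)" by blast
  let ?l = "scal_of w i" and ?j = "perm_of w i"
  have "eqv (gw w * lift_x (var i * p)) (gw w * (gx i * lift_x p))" by (intro eqv_mult_left lift_x_var_mult F_closed w)
  also have "eqv (gw w * (gx i * lift_x p)) (?l *\<^sub>C (gx ?j * gw w) * lift_x p)"
    using eqv_mult_right[OF eqv_gw_gx[OF w] lift_in_F(1)] by (simp add: mult.assoc)
  also have "eqv (?l *\<^sub>C (gx ?j * gw w) * lift_x p) (?l *\<^sub>C (gx ?j * lift_x p') * gw w)"
    using eqv_scale[OF eqv_mult_left[OF p F_closed(2)]] by (simp add: mult.assoc mult_scaleC_left)
  also have "eqv (?l *\<^sub>C (gx ?j * lift_x p') * gw w) (lift_x (?l *\<^sub>C (var ?j * p')) * gw w)"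
    by (intro eqv_mult_right F_closed w eqv_trans[OF eqv_scale[OF eqv_sym[OF lift_x_var_mult]] eqv_sym[OF lift_x_scale]])
  finally show ?case by blast
qed

lemma gw_mult_pbw_span: "v \<in> W \<Longrightarrow> u \<in> pbw_span \<Longrightarrow> gw v * u \<in> pbw_span"
proof (rule mult_pbw_span[OF F_closed(4)])
  fix s t :: "'a skew" and w :: "'a lmap" assume v: "v \<in> W" and w: "w \<in> W"
  obtain s' where s': "eqv (gw v * lift_x s) (lift_x s' * gw v)" using gw_lift_x[OF v] by blast
  have "eqv (gw v * lift_x s * (gw w * lift_y t)) (lift_x s' * gw v * (gw w * lift_y t))"
    by (intro eqv_mult_right s' F_closed lift_in_F w)
  also have "eqv (lift_x s' * gw v * (gw w * lift_y t)) (lift_x s' * (gw (v \<circ> w) * lift_y t))"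
    using eqv_mult_left[OF eqv_mult_right[OF eqv_ww[OF v w] lift_in_F(2)] lift_in_F(1)] by (simp add: mult.assoc)
  finally show "gw v * (lift_x s * gw w * lift_y t) \<in> pbw_span"
    using pbw_span_base[OF W_mult[OF v w]] by (simp add: mult.assoc eqv_pbw_span)
qed

text \<open>y_j is moved to the right through the x-part one letter at a time. Each relation leaves
  x_i y_j times a shorter product, which is the induction hypothesis, and lower terms covered by
  \<open>gw_mult_pbw_span\<close>; at the end y_j passes w and is absorbed into the y-part.\<close>

lemma gy_mult_base: "w \<in> W \<Longrightarrow> gy j * (lift_x s * gw w * lift_y t) \<in> pbw_span"
proof (induction s arbitrary: w t rule: skew_induct)
  case one
  note w = one
  obtain r i where ri: "eqv (gy j * gw w) (r *\<^sub>C (gw w * gy i))" using eqv_gy_gw[OF w] by blast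
  have "eqv (gy j * (lift_x 1 * (gw w * lift_y t))) (gy j * (1 * (gw w * lift_y t)))"
    by (intro eqv_mult_left eqv_mult_right lift_x_one F_closed lift_in_F w)
  also have "eqv \<dots> (r *\<^sub>C (gw w * gy i) * lift_y t)"
    using eqv_mult_right[OF ri lift_in_F(2)] by (simp add: mult.assoc)
  also have "eqv \<dots> (r *\<^sub>C (gw w * lift_y (var i * t)))"
    using eqv_scale[OF eqv_mult_left[OF eqv_sym[OF lift_y_var_mult] F_closed(4)[OF w]]] by (simp add: mult_scaleC_left mult.assoc)
  also have "eqv \<dots> (r *\<^sub>C (lift_x 1 * (gw w * lift_y (var i * t))))"
    using eqv_scale[OF eqv_mult_right[OF eqv_sym[OF lift_x_one] F_closed(8)[OF F_closed(4)[OF w] lift_in_F(2)]]] by simp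
  finally show ?case using pbw_span_closed(3)[OF pbw_span_base[OF w]] by (simp add: mult.assoc eqv_pbw_span)
next
  case (add p q)
  have "eqv (gy j * (lift_x (p + q) * gw w * lift_y t)) (gy j * ((lift_x p + lift_x q) * gw w * lift_y t))"
    by (intro eqv_mult_left eqv_mult_right lift_x_add F_closed lift_in_F add.prems)
  then show ?case using pbw_span_closed(2)[OF add.IH(1)[OF add.prems] add.IH(2)[OF add.prems]]
    by (simp add: distrib_left distrib_right eqv_pbw_span)
next
  case (scale k p)
  have "eqv (gy j * (lift_x (k *\<^sub>C p) * gw w * lift_y t)) (gy j * ((k *\<^sub>C lift_x p) * gw w * lift_y t))"
    by (intro eqv_mult_left eqv_mult_right lift_x_scale F_closed lift_in_F scale.prems)
  then show ?case using pbw_span_closed(3)[OF scale.IH[OF scale.prems]]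
    by (simp add: mult_scaleC_left mult_scaleC_right eqv_pbw_span)
next
  case (mult i p)
  note w = mult.prems
  let ?u = "lift_x p * gw w * lift_y t"
  have u: "?u \<in> F" by (intro F_closed lift_in_F w)
  have uspan: "?u \<in> pbw_span" by (rule pbw_span_base[OF w])
  have "eqv (gy j * (lift_x (var i * p) * gw w * lift_y t)) (gy j * (gx i * lift_x p * gw w * lift_y t))"
    by (intro eqv_mult_left eqv_mult_right lift_x_var_mult F_closed lift_in_F w)
  then have 1: "eqv (gy j * (lift_x (var i * p) * gw w * lift_y t)) (gy j * gx i * ?u)" by (simp add: mult.assoc)
  have "gy j * gx i * ?u \<in> pbw_span"
  proof (cases "i = j")
    case True
    from eqv_mult_right[OF eqv_yx_same[of j] u] show ?thesis unfolding True
      by (rule eqv_pbw_span)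
       (simp only: distrib_right mult_1_left mult_scaleC_left sum_distrib_right mult.assoc[of "gx j"],
        intro pbw_span_closed gx_mult_pbw_span gw_mult_pbw_span mult.IH w uspan sigma_in_W t_in_W; auto)
  next
    case False
    from eqv_mult_right[OF eqv_yx[OF False] u] show ?thesis
      by (rule eqv_pbw_span)
       (simp only: left_diff_distrib distrib_right diff_conv_add_uminus minus_mult_left[symmetric] mult_scaleC_left sum_distrib_right mult.assoc[of "gx i"],
        intro pbw_span_closed gx_mult_pbw_span gw_mult_pbw_span mult.IH w uspan sigma_in_W False; assumption)
  qed
  then show ?case by (rule eqv_pbw_span[OF 1])
qed

lemma gy_mult_pbw_span: "u \<in> pbw_span \<Longrightarrow> gy j * u \<in> pbw_span"
  by (rule mult_pbw_span[OF F_closed(3) gy_mult_base])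

text \<open>The span contains 1 and is stable under left multiplication by every generator, hence it
  contains all words.\<close>

lemma F_subset_pbw_span: "F \<subseteq> pbw_span"
proof
  fix u assume u: "u \<in> F"
  have "eqv 1 (lift_x 1 * gw id * lift_y 1)"
  proof -
    have "eqv (lift_x 1 * gw id * lift_y 1) (1 * gw id * lift_y 1)"
      by (intro eqv_mult_right lift_x_one F_closed lift_in_F W_one)
    also have "eqv \<dots> (1 * lift_y 1)" using eqv_mult_right[OF eqv_w_id lift_in_F(2)] by simp
    also have "eqv \<dots> 1" using lift_y_one by simp
    finally show ?thesis by (rule eqv_sym)
  qed
  then have one: "1 \<in> pbw_span" by (rule eqv_pbw_span) (rule pbw_span_base[OF W_one])
  have "prod_list (map gen ws) \<in> pbw_span" if "set ws \<subseteq> cgens W" for ws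
    using that
  proof (induction ws)
    case Nil
    show ?case by (simp add: one)
  next
    case (Cons g ws)
    then have "prod_list (map gen ws) \<in> pbw_span" "g \<in> cgens W" by auto
    then show ?case
      by (auto simp: cgens_def gx_mult_pbw_span gy_mult_pbw_span gw_mult_pbw_span)
  qed
  then have "lin_ext (\<lambda>ws. Poly_Mapping.single ws 1) u \<in> pbw_span"
    unfolding lin_ext_def
    by (intro pbw_span_closed) (use u in \<open>auto simp: free_on_def prod_list_gen\<close>)
  then show "u \<in> pbw_span" by (simp only: lin_ext_one_single)
qed

end

context braided_data
begin

abbreviation ev :: "('n::{finite,linorder}, 'n lmap) cgen free_alg \<Rightarrow> 'n skew endo" where
  "ev \<equiv> eval_free (eval_gen C C' c)"

lemma alg_hom_ev: "alg_hom ev"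
  by (rule alg_hom_eval_free)

text \<open>Evaluation forgets the representative chosen by \<open>skew_lift\<close>: on the free
  algebra both sides come from homomorphisms that agree on the generators.\<close>

lemma ev_lift: "ev (lift_x s) = mult_op s" "ev (lift_y s) = op_Y s"
proof -
  obtain p where s: "s = abs_skew p" using abs_skew_surj by blast
  have abs: "abs_skew (rep_skew s) = s" by (rule Quotient3_abs_rep[OF Quotient3_skew])
  have "ev (eval_free gx q) = mult_op (abs_skew q)" for q :: "'a free_alg"
    by (rule alg_hom_free_eqI[of "\<lambda>q. ev (eval_free gx q)"])
      (simp_all add: alg_hom_compose alg_hom_eval_free alg_hom_abs_skew alg_hom_mult_op op_x_eq flip: var.abs_eq)
  then show "ev (lift_x s) = mult_op s" by (simp add: skew_lift_def abs)
  have "ev (eval_free gy q) = op_Y (abs_skew q)" for q :: "'a free_alg"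
    by (rule alg_hom_free_eqI[of "\<lambda>q. ev (eval_free gy q)"])
      (simp_all add: alg_hom_compose alg_hom_eval_free alg_hom_abs_skew alg_hom_op_Y op_Y_var flip: var.abs_eq)
  then show "ev (lift_y s) = op_Y s" by (simp add: skew_lift_def abs)
qed

lemma ev_pbw_word: "ev (pbw_word t) = pbw_op t"
  by (cases t) (simp add: pbw_word_def pbw_op_def alg_hom_mult[OF alg_hom_ev] ev_lift)

section \<open>Validity of the relations for the operators, and the presentation\<close>

lemma op_x_anticommute: "i \<noteq> j \<Longrightarrow> op_x i * op_x j + op_x j * op_x i = 0"
  unfolding op_x_eq alg_hom_mult[OF alg_hom_mult_op, symmetric] alg_hom_add[OF alg_hom_mult_op, symmetric]
  by (simp add: var_anticommute[of i j] alg_hom_zero[OF alg_hom_mult_op])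

lemma op_w_conj_op_x:
  fixes w :: "'n::{finite,linorder} lmap"
  assumes w: "w \<in> W"
  shows "op_w w * op_x i * op_w (inv\<^bsub>GL\<^esub> w) = (\<Sum>k\<in>UNIV. coef w i k *\<^sub>C op_x k)"
  using op_w_inv[OF w]
  by (simp add: op_w_op_x[OF monomial_map_of[OF w]] coef_monomial_map[OF monomial_map_of[OF w]] sum_if_scaleC
    mult_scaleC_left mult.assoc)

lemma op_w_conj_op_y:
  fixes w :: "'n::{finite,linorder} lmap"
  assumes w: "w \<in> W"
  shows "op_w w * Y i * op_w (inv\<^bsub>GL\<^esub> w) = (\<Sum>k\<in>UNIV. dual_coef w i k *\<^sub>C Y k)"
  using op_w_inv[OF w]
  by (simp add: op_w_op_y[OF w monomial_map_of[OF w]] dual_coef_monomial_map[OF monomial_map_of[OF w]] sum_if_scaleC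
    mult_scaleC_left mult.assoc)

lemma ev_rels:
  assumes "r \<in> cherednik_rels C C' c" shows "ev r = 0"
proof -
  note hom = alg_hom_add[OF alg_hom_ev] alg_hom_diff[OF alg_hom_ev] alg_hom_mult[OF alg_hom_ev]
    alg_hom_scale[OF alg_hom_ev] alg_hom_sum[OF alg_hom_ev] alg_hom_one[OF alg_hom_ev]
  have S: "Y j * op_x i + op_x i * Y j + c 1 *\<^sub>C (\<Sum>\<epsilon>\<in>C. \<epsilon> *\<^sub>C op_w (sigma_map i j \<epsilon>)) = 0"
    if "i \<noteq> j" for i j :: 'a
    using op_y_op_x[OF that] by (simp add: S_op_def)
  have T: "Y i * op_x i - op_x i * Y i = 1 + c 1 *\<^sub>C (\<Sum>j\<in>UNIV - {i}. \<Sum>\<epsilon>\<in>C. op_w (sigma_map i j \<epsilon>))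
          + (\<Sum>\<epsilon>\<in>C' - {1}. c \<epsilon> *\<^sub>C op_w (t_map i \<epsilon>))" for i :: 'a
    using op_y_op_x_same[of i] by (simp add: T_op_def)
  show ?thesis
    using assms unfolding cherednik_rels_def Let_def
    by (elim UnE; clarsimp simp: hom op_x_anticommute op_y_anticommute op_w_conj_op_x op_w_conj_op_y S T op_w_comp op_w_id)
qed

lemma ev_ideal: "u \<in> ideal_in F (cherednik_rels C C' c) \<Longrightarrow> ev u = 0"
  by (rule alg_hom_ideal_in[OF alg_hom_ev]) (rule ev_rels)

lemma cherednik_eq: "cherednik C C' c = ev ` (F :: ('n::{finite,linorder}, 'n lmap) cgen free_alg set)"
proof -
  have "eval_gen C C' c ` cgens W = op_w ` W \<union> range Y \<union> (range op_x :: 'n skew endo set)"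
    by (auto simp: cgens_def image_Un image_image)
  then show ?thesis by (simp add: cherednik_def eval_free_image_free_on)
qed

lemma presentation:
  "quotient_bij ev F (ideal_in F (cherednik_rels C C' c)) (cherednik C C' c :: 'n::{finite,linorder} skew endo set)"
proof (rule quotient_bij_basis[where bas = pbw_word and J = "UNIV \<times> W \<times> UNIV"])
  show "clinear ev" by (rule alg_homD(1)[OF alg_hom_ev])
  show "cvec.subspace (ideal_in F (cherednik_rels C C' c))" by (simp add: ideal_in_def cvec.subspace_span)
  show "ev r = 0" if "r \<in> ideal_in F (cherednik_rels C C' c)" for r
    using that by (rule ev_ideal)
  show "F \<subseteq> cspan (pbw_word ` (UNIV \<times> W \<times> UNIV) \<union> ideal_in F (cherednik_rels C C' c))"
    using F_subset_pbw_span by (simp add: pbw_span_def rel_ideal_def)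
  show "ev ` F = cherednik C C' c" by (rule cherednik_eq[symmetric])
  show "\<forall>t\<in>T. k t = 0" if "finite T" "T \<subseteq> UNIV \<times> W \<times> UNIV" "(\<Sum>t\<in>T. k t *\<^sub>C ev (pbw_word t)) = 0" for T k
    using pbw_independence[OF that(1,2)] that(3) by (simp add: ev_pbw_word)
qed (rule F_closed(6))

lemma cherednik_subset_pbw: "cherednik C C' c \<subseteq> cspan (pbw_op ` (UNIV \<times> W \<times> UNIV))"
proof
  fix h :: "'a skew endo" assume "h \<in> cherednik C C' c"
  then obtain u where u: "u \<in> F" and h: "h = ev u" by (auto simp: cherednik_eq)
  have "u \<in> cspan (pbw_word ` (UNIV \<times> W \<times> UNIV) \<union> rel_ideal)" using u F_subset_pbw_span by (auto simp: pbw_span_def)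
  then show "h \<in> cspan (pbw_op ` (UNIV \<times> W \<times> UNIV))" unfolding h
  proof (rule clinear_span_subset[OF alg_homD(1)[OF alg_hom_ev] _ cvec.subspace_span, rotated])
    fix b :: "('a, 'a lmap) cgen free_alg" assume "b \<in> pbw_word ` (UNIV \<times> W \<times> UNIV) \<union> rel_ideal"
    then show "ev b \<in> cspan (pbw_op ` (UNIV \<times> W \<times> UNIV))"
    proof
      assume "b \<in> pbw_word ` (UNIV \<times> W \<times> UNIV)"
      then obtain t where "t \<in> UNIV \<times> W \<times> UNIV" "ev b = pbw_op t" using ev_pbw_word by blast
      then show ?thesis by (auto intro: cvec.span_base)
    next
      assume "b \<in> rel_ideal"
      then have "ev b = 0" unfolding rel_ideal_def by (rule ev_ideal)
      then show ?thesis by (simp add: cvec.span_zero)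
    qed
  qed
qed

section \<open>The triangular decomposition\<close>

lemma range_mult_op: "range mult_op = subalg (range (op_x :: 'n \<Rightarrow> 'n skew endo))"
  using range_alg_hom_skew[OF alg_hom_mult_op] by (simp add: op_x_eq)

lemma range_op_Y: "range op_Y = subalg (range Y)"
  using range_alg_hom_skew[OF alg_hom_op_Y] by (simp add: op_Y_var)

lemma inj_mult_op: "inj (mult_op :: 'n skew \<Rightarrow> _)"
proof (rule injI)
  fix p q :: "'n skew" assume "mult_op p = mult_op q"
  then have "app_endo (mult_op p) 1 = app_endo (mult_op q) 1" by simp
  then show "p = q" by simp
qed

text \<open>A special case of \<open>pbw_independence\<close>, with zero exponent in x and trivial
  group element.\<close>

lemma inj_op_Y: "inj (op_Y :: 'n::{finite,linorder} skew \<Rightarrow> 'n skew endo)"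
proof (rule injI)
  fix p q :: "'n skew" assume "op_Y p = op_Y q"
  let ?v = "coeffs (p - q)"
  let ?e = "\<lambda>b :: 'n \<Rightarrow> nat. (\<lambda>_ :: 'n. 0 :: nat, id :: 'n lmap, b)"
  have inj: "inj_on ?e A" for A by (auto simp: inj_on_def)
  have "0 = op_Y (p - q)" using \<open>op_Y p = op_Y q\<close> by (simp add: alg_hom_diff[OF alg_hom_op_Y])
  also have "\<dots> = op_Y (lin_ext monomial ?v)" by (simp add: lin_ext_monomial_coeffs)
  also have "\<dots> = (\<Sum>b\<in>Poly_Mapping.keys ?v. Poly_Mapping.lookup ?v b *\<^sub>C op_Y (monomial b))"
    by (simp add: lin_ext_def alg_hom_sum[OF alg_hom_op_Y] alg_hom_scale[OF alg_hom_op_Y])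
  also have "\<dots> = (\<Sum>t\<in>?e ` Poly_Mapping.keys ?v. Poly_Mapping.lookup ?v (snd (snd t)) *\<^sub>C pbw_op t)"
    by (simp add: sum.reindex[OF inj] pbw_op_def op_w_id alg_hom_one[OF alg_hom_mult_op])
  finally have "\<forall>t\<in>?e ` Poly_Mapping.keys ?v. Poly_Mapping.lookup ?v (snd (snd t)) = 0"
    by (intro pbw_independence) (auto simp: W_one)
  then have "?v = 0" by (intro poly_mapping_eqI) (auto simp: in_keys_iff)
  then have "p - q = 0" by (simp only: coeffs_zero_iff)
  then show "p = q" by simp
qed

text \<open>Independence of W over the skew polynomials, applied to constant coefficients.\<close>

lemma inj_group_alg: "inj_on (lin_ext op_w) (group_alg W :: ('n::{finite,linorder} lmap \<Rightarrow>\<^sub>0 complex) set)"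
proof (rule inj_onI)
  fix u v :: "'n lmap \<Rightarrow>\<^sub>0 complex" assume uv: "u \<in> group_alg W" "v \<in> group_alg W" and eq: "lin_ext op_w u = lin_ext op_w v"
  have keys: "Poly_Mapping.keys (u - v) \<subseteq> W"
  proof
    fix w assume "w \<in> Poly_Mapping.keys (u - v)"
    then have "w \<in> Poly_Mapping.keys u \<union> Poly_Mapping.keys v" by (auto simp: in_keys_iff lookup_minus)
    then show "w \<in> W" using uv by (auto simp: group_alg_def)
  qed
  have "(\<Sum>w\<in>Poly_Mapping.keys (u - v). mult_op (Poly_Mapping.lookup (u - v) w *\<^sub>C 1) * op_w w) = lin_ext op_w (u - v)"
    by (simp add: lin_ext_def alg_hom_scale[OF alg_hom_mult_op] alg_hom_one[OF alg_hom_mult_op] mult_scaleC_left)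
  also have "\<dots> = 0" by (simp add: clinear_diff[OF clinear_lin_ext] eq)
  finally have "\<forall>w\<in>Poly_Mapping.keys (u - v). Poly_Mapping.lookup (u - v) w *\<^sub>C (1 :: 'n skew) = 0"
    by (rule xw_ops_independence[OF finite_keys keys])
  then have "\<forall>w\<in>Poly_Mapping.keys (u - v). Poly_Mapping.lookup (u - v) w = 0"
    by (simp only: cvec.scale_eq_0_iff one_neq_zero simp_thms)
  then have "u - v = 0" by (intro poly_mapping_eqI) (metis in_keys_iff lookup_zero)
  then show "u = v" by simp
qed

lemma lin_ext_convolve:
  assumes "u \<in> group_alg W" "v \<in> group_alg W"
  shows "lin_ext op_w (convolve GL u v) = lin_ext op_w u * lin_ext op_w (v :: 'n::{finite,linorder} lmap \<Rightarrow>\<^sub>0 complex)"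
proof -
  have "lin_ext op_w (convolve GL u v) = (\<Sum>a\<in>Poly_Mapping.keys u. \<Sum>b\<in>Poly_Mapping.keys v.
      (Poly_Mapping.lookup u a * Poly_Mapping.lookup v b) *\<^sub>C op_w (a \<circ> b))"
    by (simp add: convolve_def clinear_sum[OF clinear_lin_ext])
  also have "\<dots> = (\<Sum>a\<in>Poly_Mapping.keys u. \<Sum>b\<in>Poly_Mapping.keys v.
      (Poly_Mapping.lookup u a *\<^sub>C op_w a) * (Poly_Mapping.lookup v b *\<^sub>C op_w b))"
  proof (intro sum.cong refl)
    fix a b assume "a \<in> Poly_Mapping.keys u" "b \<in> Poly_Mapping.keys v"
    then have "a \<in> W" "b \<in> W" using assms by (auto simp: group_alg_def)
    then show "(Poly_Mapping.lookup u a * Poly_Mapping.lookup v b) *\<^sub>C op_w (a \<circ> b) =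
      (Poly_Mapping.lookup u a *\<^sub>C op_w a) * (Poly_Mapping.lookup v b *\<^sub>C op_w b)"
      by (simp add: op_w_comp mult_scaleC_left mult_scaleC_right scaleC_scaleC)
  qed
  also have "\<dots> = lin_ext op_w u * lin_ext op_w v" by (simp add: lin_ext_def sum_product)
  finally show ?thesis .
qed

text \<open>\<open>W\<close> contains the identity and is closed under composition, so its linear
  span is already a subalgebra.\<close>

lemma subalg_op_w: "subalg (op_w ` W) = cspan (op_w ` (W :: 'n::{finite,linorder} lmap set))"
proof (intro equalityI subsetI)
  fix u :: "'n skew endo" assume "u \<in> subalg (op_w ` W)"
  then show "u \<in> cspan (op_w ` W)"
  proof (induction rule: subalg.induct)
    case one
    show ?case unfolding op_w_id[symmetric] by (intro cvec.span_base imageI W_one)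
  next
    case (mult a b)
    have "op_w v * b \<in> cspan (op_w ` W)" if v: "v \<in> W" for v
      using mult.IH(2)
    proof (rule clinear_span_subset[OF clinear_mult_left _ cvec.subspace_span, rotated])
      fix d :: "'n skew endo" assume "d \<in> op_w ` W"
      then show "op_w v * d \<in> cspan (op_w ` W)"
        using v by (auto simp: op_w_comp[symmetric] intro!: cvec.span_base imageI W_mult)
    qed
    then show ?case
      by (intro clinear_span_subset[OF clinear_mult_right _ cvec.subspace_span mult.IH(1)]) auto
  qed (auto intro: cvec.span_base cvec.span_add cvec.span_scale)
next
  fix u :: "'n skew endo" assume "u \<in> cspan (op_w ` W)"
  then show "u \<in> subalg (op_w ` W)"
  proof (induction rule: cvec.span_induct_alt)
    case base
    show ?case using subalg.scale[OF subalg.one, of 0] by (simp add: cvec.scale_zero_left)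
  next
    case (step k g h)
    then show ?case by (auto intro: subalg.intros)
  qed
qed

lemma lin_ext_group_alg: "lin_ext op_w ` group_alg W = subalg (op_w ` (W :: 'n::{finite,linorder} lmap set))"
  unfolding subalg_op_w
proof (intro equalityI subsetI)
  fix u :: "'n skew endo" assume "u \<in> lin_ext op_w ` group_alg W"
  then obtain v where v: "v \<in> group_alg W" and u: "u = lin_ext op_w v" by blast
  show "u \<in> cspan (op_w ` W)" unfolding u lin_ext_def
  proof (intro cvec.span_sum cvec.span_scale cvec.span_base imageI)
    show "w \<in> W" if "w \<in> Poly_Mapping.keys v" for w
      using v that by (auto simp: group_alg_def)
  qed
next
  fix u :: "'n skew endo" assume "u \<in> cspan (op_w ` W)"
  from cspan_image_explicit[OF this]
  obtain T k where T: "finite T" "T \<subseteq> W" and u: "u = (\<Sum>w\<in>T. k w *\<^sub>C op_w w)" by blast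
  let ?v = "\<Sum>w\<in>T. Poly_Mapping.single w (k w)"
  have "Poly_Mapping.keys ?v \<subseteq> T"
  proof
    fix w assume "w \<in> Poly_Mapping.keys ?v"
    then show "w \<in> T" using T(1) by (cases "w \<in> T") (auto simp: in_keys_iff lookup_sum lookup_single when_def)
  qed
  then have "?v \<in> group_alg W" using T(2) by (auto simp: group_alg_def)
  moreover have "u = lin_ext op_w ?v" by (simp add: u clinear_sum[OF clinear_lin_ext])
  ultimately show "u \<in> lin_ext op_w ` group_alg W" by blast
qed

end

lemma subalg_mono: "S \<subseteq> T \<Longrightarrow> subalg S \<subseteq> subalg T"
proof
  fix u assume "S \<subseteq> T" "u \<in> subalg S"
  show "u \<in> subalg T" using \<open>u \<in> subalg S\<close>
    by (induction rule: subalg.induct) (use \<open>S \<subseteq> T\<close> in \<open>auto intro: subalg.intros\<close>)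
qed

lemma tensor_rels_intros:
  assumes "a \<in> A" "b \<in> B" "d \<in> D"
  shows "a' \<in> A \<Longrightarrow> pure_tensor (a + a') b d - pure_tensor a b d - pure_tensor a' b d \<in> tensor_rels A B D"
    and "b' \<in> B \<Longrightarrow> pure_tensor a (b + b') d - pure_tensor a b d - pure_tensor a b' d \<in> tensor_rels A B D"
    and "d' \<in> D \<Longrightarrow> pure_tensor a b (d + d') - pure_tensor a b d - pure_tensor a b d' \<in> tensor_rels A B D"
    and "pure_tensor (k *\<^sub>C a) b d - k *\<^sub>C pure_tensor a b d \<in> tensor_rels A B D"
    and "pure_tensor a (k *\<^sub>C b) d - k *\<^sub>C pure_tensor a b d \<in> tensor_rels A B D"
    and "pure_tensor a b (k *\<^sub>C d) - k *\<^sub>C pure_tensor a b d \<in> tensor_rels A B D"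
proof -
  show "a' \<in> A \<Longrightarrow> pure_tensor (a + a') b d - pure_tensor a b d - pure_tensor a' b d \<in> tensor_rels A B D"
    unfolding tensor_rels_def
    by (rule cvec.span_base, rule UnI1, rule UnI1, rule UnI1, rule UnI1, rule UnI1, rule CollectI, intro exI conjI, rule refl, (rule assms | assumption)+)
  show "b' \<in> B \<Longrightarrow> pure_tensor a (b + b') d - pure_tensor a b d - pure_tensor a b' d \<in> tensor_rels A B D"
    unfolding tensor_rels_def
    by (rule cvec.span_base, rule UnI1, rule UnI1, rule UnI1, rule UnI1, rule UnI2, rule CollectI, intro exI conjI, rule refl, (rule assms | assumption)+)
  show "d' \<in> D \<Longrightarrow> pure_tensor a b (d + d') - pure_tensor a b d - pure_tensor a b d' \<in> tensor_rels A B D"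
    unfolding tensor_rels_def
    by (rule cvec.span_base, rule UnI1, rule UnI1, rule UnI1, rule UnI2, rule CollectI, intro exI conjI, rule refl, (rule assms | assumption)+)
  show "pure_tensor (k *\<^sub>C a) b d - k *\<^sub>C pure_tensor a b d \<in> tensor_rels A B D"
    unfolding tensor_rels_def
    by (rule cvec.span_base, rule UnI1, rule UnI1, rule UnI2, rule CollectI, intro exI conjI, rule refl, (rule assms | assumption)+)
  show "pure_tensor a (k *\<^sub>C b) d - k *\<^sub>C pure_tensor a b d \<in> tensor_rels A B D"
    unfolding tensor_rels_def
    by (rule cvec.span_base, rule UnI1, rule UnI2, rule CollectI, intro exI conjI, rule refl, (rule assms | assumption)+)
  show "pure_tensor a b (k *\<^sub>C d) - k *\<^sub>C pure_tensor a b d \<in> tensor_rels A B D"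
    unfolding tensor_rels_def
    by (rule cvec.span_base, rule UnI2, rule CollectI, intro exI conjI, rule refl, (rule assms | assumption)+)
qed

lemma tensor_cong_span:
  assumes "u - v - v' \<in> R" "v \<in> cspan (B \<union> R)" "v' \<in> cspan (B \<union> R)"
  shows "u \<in> cspan (B \<union> R)"
  by (rule cspan_cong[of u "v + v'"]) (use assms in \<open>simp_all add: diff_diff_eq cvec.span_add\<close>)

lemma clinear_tensor_mult: "clinear tensor_mult"
  unfolding tensor_mult_def by (rule clinear_lin_ext)

lemma tensor_mult_pure: "tensor_mult (pure_tensor a b d) = a * b * d"
  by (simp add: tensor_mult_def scaleC_one)

lemma tensor_mult_rels:
  assumes "r \<in> tensor_rels A B D" shows "tensor_mult r = 0"
proof -
  note lin = clinear_diff[OF clinear_tensor_mult] clinear_scale[OF clinear_tensor_mult]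
  have "tensor_mult r \<in> {0}"
    using assms unfolding tensor_rels_def
    by (rule clinear_span_subset[OF clinear_tensor_mult _ cvec.subspace_single_0, rotated])
      (auto simp: lin tensor_mult_pure distrib_left distrib_right mult_scaleC_left mult_scaleC_right)
  then show ?thesis by simp
qed

context braided_data
begin

definition pbw_tensor :: "('n::{finite,linorder} \<Rightarrow> nat) \<times> 'n lmap \<times> ('n \<Rightarrow> nat) \<Rightarrow>
    ('n skew endo \<times> 'n skew endo \<times> 'n skew endo \<Rightarrow>\<^sub>0 complex)" where
  "pbw_tensor = (\<lambda>(a, w, b). pure_tensor (mult_op (monomial a)) (op_w w) (op_Y (monomial b)))"

text \<open>The outer slots are expanded into monomials for a fixed group element; the middle slot,
  a general element of the span of the group, follows by induction over that span.\<close>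

lemma pure_tensor_in_span:
  fixes s t :: "'n::{finite,linorder} skew" and b :: "'n skew endo"
  defines "B \<equiv> cspan (op_w ` (W :: 'n lmap set))"
  defines "R \<equiv> tensor_rels (range mult_op) B (range op_Y)"
  assumes b: "b \<in> B"
  shows "pure_tensor (mult_op s) b (op_Y t) \<in> cspan (pbw_tensor ` (UNIV \<times> W \<times> UNIV) \<union> R)"
proof -
  let ?Q = "cspan (pbw_tensor ` (UNIV \<times> W \<times> UNIV) \<union> R)"
  note rels = tensor_rels_intros[where A = "range mult_op" and B = B and D = "range op_Y", folded R_def]
  have "pure_tensor (mult_op s) (op_w w) (op_Y t) \<in> ?Q" if w: "w \<in> W" for s t w
  proof -
    have wB: "op_w w \<in> B" unfolding B_def using w by (intro cvec.span_base imageI)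
    show ?thesis
    proof (induction s rule: monomial_induct)
      case (monomial a)
      show ?case
      proof (induction t rule: monomial_induct)
        case (monomial b)
        show ?case using w by (intro cvec.span_base UnI1 image_eqI[of _ _ "(a, w, b)"]) (auto simp: pbw_tensor_def)
      next
        case (add p q)
        show ?case unfolding alg_hom_add[OF alg_hom_op_Y] by (rule tensor_cong_span[OF rels(3) add]) (rule rangeI wB)+
      next
        case (scale k p)
        show ?case unfolding alg_hom_scale[OF alg_hom_op_Y]
          by (rule cspan_cong[OF rels(6) cvec.span_scale[OF scale]]) (rule rangeI wB)+
      qed
    next
      case (add p q)
      show ?case unfolding alg_hom_add[OF alg_hom_mult_op] by (rule tensor_cong_span[OF rels(1) add]) (rule rangeI wB)+
    next
      case (scale k p)
      show ?case unfolding alg_hom_scale[OF alg_hom_mult_op]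
        by (rule cspan_cong[OF rels(4) cvec.span_scale[OF scale]]) (rule rangeI wB)+
    qed
  qed
  note gen = this
  \<comment> \<open>Membership in \<open>B\<close> is carried along because the trilinearity
    relations are available only for elements of the given subspaces.\<close>
  have "b \<in> B \<and> pure_tensor (mult_op s) b (op_Y t) \<in> ?Q"
    using b unfolding B_def
  proof (induction rule: cvec.span_induct_alt)
    case base
    \<comment> \<open>Homogeneity in the middle slot makes a pure tensor with middle entry 0
      congruent to 0.\<close>
    have "pure_tensor (mult_op s) (0 *\<^sub>C 0) (op_Y t) \<in> ?Q"
      by (rule cspan_cong[OF rels(5)]) (auto simp: B_def cvec.span_zero cvec.scale_zero_left)
    then show ?case by (simp add: cvec.span_zero cvec.scale_zero_left)
  next
    case (step k g h)
    then obtain w where w: "w \<in> W" "g = op_w w" by blast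
    have g: "g \<in> B" unfolding B_def w(2) using w(1) by (intro cvec.span_base imageI)
    then have kg: "k *\<^sub>C g \<in> B" unfolding B_def by (rule cvec.span_scale)
    have h: "h \<in> B" using step.IH by (simp add: B_def)
    have kg_span: "pure_tensor (mult_op s) (k *\<^sub>C g) (op_Y t) \<in> ?Q"
      by (rule cspan_cong[OF rels(5) cvec.span_scale[OF gen[OF w(1), folded w(2)]]]) (rule rangeI g)+
    have "pure_tensor (mult_op s) (k *\<^sub>C g + h) (op_Y t) \<in> ?Q"
      by (rule tensor_cong_span[OF rels(2) kg_span step.IH[THEN conjunct2]]) (rule rangeI kg h)+
    then show ?case using kg h by (auto simp: B_def cvec.span_add)
  qed
  then show ?thesis ..
qed

lemma triangular_decomposition:
  fixes x y :: "'n::{finite,linorder} \<Rightarrow> 'n skew endo"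
  defines "x \<equiv> op_x" and "y \<equiv> Y"
  shows "quotient_bij tensor_mult
       (tensor_gens (subalg (range x)) (subalg (op_w ` W)) (subalg (range y)))
       (tensor_rels (subalg (range x)) (subalg (op_w ` W)) (subalg (range y))) (cherednik C C' c)"
proof -
  \<comment> \<open>The outer factors are parametrised by the skew polynomials and the middle one is
    described as a span; the subalgebras reappear at the end.\<close>
  define A where "A = (range mult_op :: 'n skew endo set)"
  define B where "B = cspan (op_w ` (W :: 'n lmap set))"
  define D where "D = (range op_Y :: 'n skew endo set)"
  have "quotient_bij tensor_mult (tensor_gens A B D) (tensor_rels A B D) (cherednik C C' c)"
  proof (rule quotient_bij_basis[where bas = pbw_tensor and J = "UNIV \<times> W \<times> UNIV"])
    show "cvec.subspace (tensor_rels A B D)" by (simp add: tensor_rels_def cvec.subspace_span)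
    show "u - v \<in> tensor_gens A B D" if "u \<in> tensor_gens A B D" "v \<in> tensor_gens A B D" for u v
    proof -
      have "Poly_Mapping.keys (u - v) \<subseteq> Poly_Mapping.keys u \<union> Poly_Mapping.keys v"
        by (auto simp: in_keys_iff lookup_minus)
      then show ?thesis using that unfolding tensor_gens_def by blast
    qed
    show "tensor_gens A B D \<subseteq> cspan (pbw_tensor ` (UNIV \<times> W \<times> UNIV) \<union> tensor_rels A B D)"
    proof
      fix u assume u: "u \<in> tensor_gens A B D"
      have "lin_ext (\<lambda>t. Poly_Mapping.single t 1) u \<in> cspan (pbw_tensor ` (UNIV \<times> W \<times> UNIV) \<union> tensor_rels A B D)"
        unfolding lin_ext_def
      proof (intro cvec.span_sum cvec.span_scale)
        fix t assume "t \<in> Poly_Mapping.keys u"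
        then have "t \<in> A \<times> B \<times> D" using u by (auto simp: tensor_gens_def)
        then obtain s b r where "t = (mult_op s, b, op_Y r)" "b \<in> B" by (auto simp: A_def D_def)
        then show "Poly_Mapping.single t 1 \<in> cspan (pbw_tensor ` (UNIV \<times> W \<times> UNIV) \<union> tensor_rels A B D)"
          using pure_tensor_in_span[of b s r] by (simp add: A_def B_def D_def)
      qed
      then show "u \<in> cspan (pbw_tensor ` (UNIV \<times> W \<times> UNIV) \<union> tensor_rels A B D)"
        by (simp only: lin_ext_one_single)
    qed
    have mult_pbw: "tensor_mult (pbw_tensor t) = pbw_op t" for t
      by (cases t) (simp add: pbw_tensor_def pbw_op_def tensor_mult_pure)
    show "\<forall>t\<in>T. k t = 0" if "finite T" "T \<subseteq> UNIV \<times> W \<times> UNIV" "(\<Sum>t\<in>T. k t *\<^sub>C tensor_mult (pbw_tensor t)) = 0" for T k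
      using pbw_independence[OF that(1,2)] that(3) by (simp add: mult_pbw)
    show "tensor_mult ` tensor_gens A B D = cherednik C C' c"
    proof (intro equalityI subsetI)
      have sub: "A \<subseteq> cherednik C C' c" "B \<subseteq> cherednik C C' c" "D \<subseteq> cherednik C C' c"
        unfolding A_def B_def D_def range_mult_op range_op_Y subalg_op_w[symmetric] cherednik_def
        by (intro subalg_mono; blast)+
      fix h assume "h \<in> tensor_mult ` tensor_gens A B D"
      then obtain u where u: "Poly_Mapping.keys u \<subseteq> A \<times> B \<times> D" and h: "h = tensor_mult u" by (auto simp: tensor_gens_def)
      show "h \<in> cherednik C C' c" unfolding h tensor_mult_def lin_ext_def cherednik_def
      proof (intro subalg_sum subalg.scale, fold cherednik_def)
        fix t assume "t \<in> Poly_Mapping.keys u"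
        then obtain a b d where t: "t = (a, b, d)" "a \<in> A" "b \<in> B" "d \<in> D" using u by auto
        then show "(case t of (a, b, d) \<Rightarrow> a * b * d) \<in> cherednik C C' c"
          using sub unfolding cherednik_def by (auto intro!: subalg.mult)
      qed
    next
      fix h :: "'n skew endo" assume "h \<in> cherednik C C' c"
      then have "h \<in> cspan (pbw_op ` (UNIV \<times> W \<times> UNIV))" using cherednik_subset_pbw by blast
      from cspan_image_explicit[OF this]
      obtain T k where T: "finite T" "T \<subseteq> UNIV \<times> W \<times> UNIV" and h: "h = (\<Sum>t\<in>T. k t *\<^sub>C pbw_op t)" by blast
      let ?u = "\<Sum>t\<in>T. k t *\<^sub>C pbw_tensor t"
      have "Poly_Mapping.keys (k t *\<^sub>C pbw_tensor t) \<subseteq> A \<times> B \<times> D" if "t \<in> T" for t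
      proof -
        obtain a w b where t: "t = (a, w, b)" by (cases t)
        then have w: "w \<in> W" using T(2) that by auto
        have "op_w w \<in> B" unfolding B_def using w by (intro cvec.span_base imageI)
        then show ?thesis by (auto simp: t pbw_tensor_def A_def D_def in_keys_iff lookup_single when_def split: if_splits)
      qed
      then have "Poly_Mapping.keys ?u \<subseteq> A \<times> B \<times> D"
        using keys_sum[of "\<lambda>t. k t *\<^sub>C pbw_tensor t" T] by blast
      then have "?u \<in> tensor_gens A B D" by (simp add: tensor_gens_def)
      moreover have "h = tensor_mult ?u"
        by (simp add: h clinear_sum[OF clinear_tensor_mult] clinear_scale[OF clinear_tensor_mult] mult_pbw)
      ultimately show "h \<in> tensor_mult ` tensor_gens A B D" by blast
    qed
  qed (rule clinear_tensor_mult tensor_mult_rels; assumption?)+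
  then show ?thesis
    unfolding x_def y_def A_def B_def D_def range_mult_op range_op_Y subalg_op_w[symmetric] .
qed

end

theorem theorem0p2:
  fixes C C' :: "complex set" and c :: "complex \<Rightarrow> complex"
    and x y :: "'n::{finite,linorder} \<Rightarrow> 'n skew endo"
    and w :: "'n lmap \<Rightarrow> 'n skew endo"
    and W :: "'n lmap set" and H :: "'n skew endo set"
  assumes "subgroup C complex_units" and "finite C"
    and "subgroup C' complex_units" and "finite C'"
    and "C' \<subseteq> C" and "-1 \<in> C"
  defines "W \<equiv> refl_group C C'"
    and "x \<equiv> op_x" and "y \<equiv> op_y C C' c" and "w \<equiv> op_w"
    and "H \<equiv> cherednik C C' c"
  shows
    "(\<forall>i j. i \<noteq> j \<longrightarrow> x i * x j + x j * x i = 0 \<and> y i * y j + y j * y i = 0) \<and>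
     (\<forall>g\<in>W. \<forall>i.
        w g * x i * w (inv\<^bsub>GL\<^esub> g) = (\<Sum>k\<in>UNIV. coef g i k *\<^sub>C x k) \<and>
        w g * y i * w (inv\<^bsub>GL\<^esub> g) = (\<Sum>k\<in>UNIV. dual_coef g i k *\<^sub>C y k)) \<and>
     (\<forall>i j. i \<noteq> j \<longrightarrow>
        y j * x i + x i * y j = - (c 1 *\<^sub>C (\<Sum>\<epsilon>\<in>C. \<epsilon> *\<^sub>C w (sigma_map i j \<epsilon>)))) \<and>
     (\<forall>i. y i * x i - x i * y i =
        1 + c 1 *\<^sub>C (\<Sum>j\<in>UNIV - {i}. \<Sum>\<epsilon>\<in>C. w (sigma_map i j \<epsilon>))
          + (\<Sum>\<epsilon>\<in>C' - {1}. c \<epsilon> *\<^sub>C w (t_map i \<epsilon>))) \<and>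
     quotient_bij (eval_free (eval_gen C C' c))
       (free_on (cgens W)) (ideal_in (free_on (cgens W)) (cherednik_rels C C' c)) H \<and>
     (\<exists>\<phi>. alg_hom \<phi> \<and> inj \<phi> \<and> (\<forall>i. \<phi> (var i) = x i) \<and> range \<phi> = subalg (range x)) \<and>
     (\<exists>\<phi>. alg_hom \<phi> \<and> inj \<phi> \<and> (\<forall>i. \<phi> (var i) = y i) \<and> range \<phi> = subalg (range y)) \<and>
     (inj_on (lin_ext w) (group_alg W) \<and>
      lin_ext w ` group_alg W = subalg (w ` W) \<and>
      lin_ext w (Poly_Mapping.single \<one>\<^bsub>GL\<^esub> 1) = 1 \<and>
      (\<forall>u\<in>group_alg W. \<forall>v\<in>group_alg W.
         lin_ext w (convolve GL u v) = lin_ext w u * lin_ext w v)) \<and>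
     quotient_bij tensor_mult
       (tensor_gens (subalg (range x)) (subalg (w ` W)) (subalg (range y)))
       (tensor_rels (subalg (range x)) (subalg (w ` W)) (subalg (range y))) H"
proof -
  interpret braided_data C C' c
    by (rule braided_data.intro) (fact assms)+
  have x: "alg_hom mult_op" "inj (mult_op :: 'n skew \<Rightarrow> _)" "\<forall>i. mult_op (var i) = x i" "range mult_op = subalg (range x)"
    unfolding x_def by (simp_all add: alg_hom_mult_op inj_mult_op op_x_eq range_mult_op)
  have y: "alg_hom op_Y" "inj op_Y" "\<forall>i. op_Y (var i) = y i" "range op_Y = subalg (range y)"
    unfolding y_def by (simp_all add: alg_hom_op_Y inj_op_Y op_Y_var range_op_Y)
  show ?thesis
  proof (intro conjI)
    show "\<forall>i j. i \<noteq> j \<longrightarrow> x i * x j + x j * x i = 0 \<and> y i * y j + y j * y i = 0"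
      unfolding x_def y_def by (simp add: op_x_anticommute op_y_anticommute)
    show "\<forall>g\<in>W. \<forall>i. w g * x i * w (inv\<^bsub>GL\<^esub> g) = (\<Sum>k\<in>UNIV. coef g i k *\<^sub>C x k) \<and>
        w g * y i * w (inv\<^bsub>GL\<^esub> g) = (\<Sum>k\<in>UNIV. dual_coef g i k *\<^sub>C y k)"
      unfolding x_def y_def w_def W_def by (simp add: op_w_conj_op_x op_w_conj_op_y)
    show "\<forall>i j. i \<noteq> j \<longrightarrow> y j * x i + x i * y j = - (c 1 *\<^sub>C (\<Sum>\<epsilon>\<in>C. \<epsilon> *\<^sub>C w (sigma_map i j \<epsilon>)))"
      unfolding x_def y_def w_def by (simp add: op_y_op_x S_op_def)
    show "\<forall>i. y i * x i - x i * y i = 1 + c 1 *\<^sub>C (\<Sum>j\<in>UNIV - {i}. \<Sum>\<epsilon>\<in>C. w (sigma_map i j \<epsilon>))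
          + (\<Sum>\<epsilon>\<in>C' - {1}. c \<epsilon> *\<^sub>C w (t_map i \<epsilon>))"
      unfolding x_def y_def w_def by (simp add: op_y_op_x_same T_op_def)
    show "quotient_bij (eval_free (eval_gen C C' c))
       (free_on (cgens W)) (ideal_in (free_on (cgens W)) (cherednik_rels C C' c)) H"
      unfolding W_def H_def by (rule presentation)
    show "\<exists>\<phi>. alg_hom \<phi> \<and> inj \<phi> \<and> (\<forall>i. \<phi> (var i) = x i) \<and> range \<phi> = subalg (range x)"
      using x by blast
    show "\<exists>\<phi>. alg_hom \<phi> \<and> inj \<phi> \<and> (\<forall>i. \<phi> (var i) = y i) \<and> range \<phi> = subalg (range y)"
      using y by blast
    show "inj_on (lin_ext w) (group_alg W)" unfolding w_def W_def by (rule inj_group_alg)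
    show "lin_ext w ` group_alg W = subalg (w ` W)" unfolding w_def W_def by (rule lin_ext_group_alg)
    show "lin_ext w (Poly_Mapping.single \<one>\<^bsub>GL\<^esub> 1) = 1"
      unfolding w_def by (simp add: op_w_id scaleC_one)
    show "\<forall>u\<in>group_alg W. \<forall>v\<in>group_alg W. lin_ext w (convolve GL u v) = lin_ext w u * lin_ext w v"
      unfolding w_def W_def by (simp add: lin_ext_convolve)
    show "quotient_bij tensor_mult
       (tensor_gens (subalg (range x)) (subalg (w ` W)) (subalg (range y)))
       (tensor_rels (subalg (range x)) (subalg (w ` W)) (subalg (range y))) H"
      unfolding x_def y_def w_def W_def H_def by (rule triangular_decomposition)
  qed
qed

end
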